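(* Let $A$ be a semi-Fredholm symmetric operator on $H$, with symplectic space of boundary values $\mathcal V=\operatorname{dom}A^*/\operatorname{dom}A$ and Cauchy data space $\mathcal C=\gamma(\ker A^* )\subset\mathcal V$. Let $X$ be a topological space and let $L=(L_x)_{x\in X}$ be a continuous family of Fredholm self-adjoint boundary conditions for $A$. Then the family $A_L=(A_{L_x})_{x\in X}$ of Fredholm self-adjoint extensions of $A$ satisfies $$\operatorname{ind}A_L=\operatorname{ind}_{\mathcal V}(L,\mathcal C)\in K^1(X).$$
   Context: $H$ is a separable infinite-dimensional complex Hilbert space. Domains of closed operators carry the graph inner product. A symmetric operator is assumed closed and densely defined; it is semi-Fredholm if its range is closed and its kernel is finite-dimensional. Boundary values. For a symmetric operator $A$, $\mathcal V=\operatorname{dom}A^*/\operatorname{dom}A$ is the quotient Hilbert space, $\gamma:\operatorname{dom}A^*\to\mathcal V$ the quotient map, with symplectic form $$\omega(\gamma\xi,\gamma\eta)=\langle A^*\xi,\eta\rangle-\langle\xi,A^*\eta\rangle,\qquad \xi,\eta\in\operatorname{dom}A^*.$$ One has $\omega(\xi,\eta)=\langle J\xi,\eta\rangle$ on $\mathcal V$ with $J$ skew-adjoint and unitary. For a subspace $L\subset\mathcal V$, $A_L$ is the restriction of $A^*$ to $\gamma^{-1}(L)$; it is self-adjoint iff $L$ is Lagrangian (equal to its $\omega$-annihilator). If $A$ is semi-Fredholm, $\mathcal C=\gamma(\ker A^* )$ is a Lagrangian subspace. A Fredholm self-adjoint boundary condition for $A$ is a Lagrangian subspace $L\subset\mathcal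 V$ such that $A_L$ is Fredholm; equivalently, $(L,\mathcal C)$ is a Fredholm pair, i.e. $L+\mathcal C$ is closed and $\dim(L\cap\mathcal C)$, $\operatorname{codim}(L+\mathcal C)$ are finite. Families of closed subspaces are continuous when the orthogonal projections are norm continuous; families of operators are graph continuous when the family of graphs is continuous. The family $A_L$ is then graph continuous. $K^1$ index. For a Hilbert space $W$ let $\mathcal U(W)$ be the unitary group with the norm topology, $\mathcal U_K(W)=\{u\in\mathcal U(W): u-1\text{ compact}\}$ and $\mathcal U_F(W)=\{u\in\mathcal U(W): u+1\text{ Fredholm}\}$. For arbitrary $X$, $K^1(X):=[X,\mathcal U_K(H)]=[X,\mathcal U_F(H)]$ (the inclusion $\mathcal U_K(H)\subset\mathcal U_F(H)$ is a homotopy equivalence), with addition given by direct sum and zero element the constant map $1$. The index of a continuous $f:X\to\mathcal U_F(W)$ is the class of $f\oplus1:X\to\mathcal U_F(W\oplus H')$ in $K^1(X)$, $H'$ an auxiliary infinite-dimensional separable Hilbert space (for $\dim W=\infty$ this is the class of $f$). The index of a graph continuous family $(B_x)$ of Fredholm self-adjoint operators is the index of the family of Cayley transforms $(B_x-i)(B_x+i)^{-1}\in\mathcal U_F(H)$. For a Hilbert space $\Lambda$ with skew-adjoint unitary $J$ and symplectic form $\omega(\xi,\eta)=\langle J\xi,\eta\rangle$, put $\Lambda^\pm=\ker(J\mp i)$. Each Lagrangian subspace $L$ is the graph of a unitary $u_L:\Lambda^+\to\Lambda^-$. For a continuous family $(L_x,M_x)$ of Fredholm pairs of Lagrangian subspaces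 of $\Lambda$ one has $-u_{M_x}^{-1}u_{L_x}\in\mathcal U_F(\Lambda^+)$, and $\operatorname{ind}_\Lambda(L,M)\in K^1(X)$ is the index of the family $x\mapsto-u_{M_x}^{-1}u_{L_x}$. *)

theory Defs
  imports "HOL-Analysis.Analysis"
begin

text \<open>The inner product is linear in its first argument; none of the notions below depends on
  this choice.\<close>

class chilbert_space = real_inner + complete_space +
  fixes scaleC :: "complex \<Rightarrow> 'a \<Rightarrow> 'a" (infixr "*\<^sub>C" 75)
    and cinner :: "'a \<Rightarrow> 'a \<Rightarrow> complex"
  assumes scaleC_add_right: "c *\<^sub>C (x + y) = c *\<^sub>C x + c *\<^sub>C y"
    and scaleC_add_left: "(c + d) *\<^sub>C x = c *\<^sub>C x + d *\<^sub>C x"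
    and scaleC_scaleC: "c *\<^sub>C (d *\<^sub>C x) = (c * d) *\<^sub>C x"
    and scaleR_scaleC: "r *\<^sub>R x = complex_of_real r *\<^sub>C x"
    and cinner_commute: "cinner x y = cnj (cinner y x)"
    and cinner_add_left: "cinner (x + y) z = cinner x z + cinner y z"
    and cinner_scaleC_left: "cinner (c *\<^sub>C x) y = c * cinner x y"
    and inner_cinner: "inner x y = Re (cinner x y)"

global_interpretation complex_vector:
    vector_space "scaleC :: complex \<Rightarrow> 'a \<Rightarrow> 'a::chilbert_space"
proof
  show "1 *\<^sub>C x = x" for x :: 'a
    using scaleR_scaleC[of 1 x] by simp
qed (simp_all add: scaleC_add_right scaleC_add_left scaleC_scaleC)

instantiation prod :: (chilbert_space, chilbert_space) chilbert_space
begin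

definition "c *\<^sub>C p = (c *\<^sub>C fst p, c *\<^sub>C snd p)"

definition "cinner p q = cinner (fst p) (fst q) + cinner (snd p) (snd q)"

instance
proof
  fix p q r :: "'a \<times> 'b" and c d :: complex and t :: real
  show "c *\<^sub>C (p + q) = c *\<^sub>C p + c *\<^sub>C q"
    by (simp add: scaleC_prod_def scaleC_add_right)
  show "(c + d) *\<^sub>C p = c *\<^sub>C p + d *\<^sub>C p"
    by (simp add: scaleC_prod_def scaleC_add_left)
  show "c *\<^sub>C d *\<^sub>C p = (c * d) *\<^sub>C p"
    by (simp add: scaleC_prod_def scaleC_scaleC)
  show "t *\<^sub>R p = complex_of_real t *\<^sub>C p"
    by (simp add: scaleC_prod_def scaleR_prod_def scaleR_scaleC)
  show "cinner p q = cnj (cinner q p)"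
    using cinner_commute[of "fst p" "fst q"] cinner_commute[of "snd p" "snd q"]
    by (simp add: cinner_prod_def)
  show "cinner (p + q) r = cinner p r + cinner q r"
    by (simp add: cinner_prod_def cinner_add_left)
  show "cinner (c *\<^sub>C p) q = c * cinner p q"
    by (simp add: cinner_prod_def scaleC_prod_def cinner_scaleC_left algebra_simps)
  show "inner p q = Re (cinner p q)"
    by (simp add: cinner_prod_def inner_prod_def inner_cinner)
qed

end

abbreviation csubspace :: "'a::chilbert_space set \<Rightarrow> bool" where
  "csubspace \<equiv> complex_vector.subspace"

definition finite_dim :: "'a::chilbert_space set \<Rightarrow> bool" where
  "finite_dim S \<longleftrightarrow> (\<exists>B. finite B \<and> S \<subseteq> complex_vector.span B)"

definition finite_codim_in :: "'a::chilbert_space set \<Rightarrow> 'a set \<Rightarrow> bool" where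
  "finite_codim_in W S \<longleftrightarrow> (\<exists>B. finite B \<and> W \<subseteq> complex_vector.span (S \<union> B))"

definition ortho_compl :: "'a::chilbert_space set \<Rightarrow> 'a set" where
  "ortho_compl S = {x. \<forall>y\<in>S. cinner x y = 0}"

definition orth_projection :: "'a::chilbert_space set \<Rightarrow> 'a \<Rightarrow>\<^sub>L 'a" where
  "orth_projection S = Blinfun (\<lambda>x. THE y. y \<in> S \<and> x - y \<in> ortho_compl S)"

definition continuous_subspaces :: "'x topology \<Rightarrow> ('x \<Rightarrow> 'a::chilbert_space set) \<Rightarrow> bool" where
  "continuous_subspaces X L \<longleftrightarrow> continuous_map X euclidean (\<lambda>x. orth_projection (L x))"

text \<open>An operator is identified with its graph, so that \<^term>\<open>Domain A\<close> and \<^term>\<open>Range A\<close> are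
  its domain and range, equality is equality of operators with domains, and inclusion is
  extension of operators.\<close>

type_synonym 'a operator = "('a \<times> 'a) set"

definition op_ker :: "'a::chilbert_space operator \<Rightarrow> 'a set" where
  "op_ker A = {\<xi>. (\<xi>, 0) \<in> A}"

definition adjoint_op :: "'a::chilbert_space operator \<Rightarrow> 'a operator" where
  "adjoint_op A = {(\<eta>, \<eta>'). \<forall>(\<xi>, \<xi>')\<in>A. cinner \<xi>' \<eta> = cinner \<xi> \<eta>'}"

definition symmetric_op :: "'a::chilbert_space operator \<Rightarrow> bool" where
  "symmetric_op A \<longleftrightarrow> csubspace A \<and> single_valued A \<and> closed A \<and> closure (Domain A) = UNIV \<and>
    A \<subseteq> adjoint_op A"

definition semi_fredholm :: "'a::chilbert_space operator \<Rightarrow> bool" where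
  "semi_fredholm A \<longleftrightarrow> closed (Range A) \<and> finite_dim (op_ker A)"

text \<open>\<^term>\<open>W\<close> is the space in which the operator acts.\<close>

definition fredholm_in :: "'a::chilbert_space set \<Rightarrow> 'a operator \<Rightarrow> bool" where
  "fredholm_in W A \<longleftrightarrow> closed (Range A) \<and> finite_dim (op_ker A) \<and> finite_codim_in W (Range A)"

text \<open>The quotient Hilbert space of \<^term>\<open>Domain (adjoint_op A)\<close> (with the graph norm) by
  \<^term>\<open>Domain A\<close> depends on the operator and therefore cannot be a type. It is given by its
  quotient map \<^term>\<open>\<gamma>\<close>, which may take values in any Hilbert space: \<^term>\<open>\<gamma>\<close> is linear, has
  kernel \<^term>\<open>Domain A\<close>, and its image carries the quotient norm, namely the distance to (the
  graph of) \<^term>\<open>A\<close> in the graph norm. Only the values of \<^term>\<open>\<gamma>\<close> on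
  \<^term>\<open>Domain (adjoint_op A)\<close> are ever used.\<close>

definition boundary_map :: "'a::chilbert_space operator \<Rightarrow> ('a \<Rightarrow> 'v::chilbert_space) \<Rightarrow> bool" where
  "boundary_map A \<gamma> \<longleftrightarrow>
    (\<forall>\<xi>\<in>Domain (adjoint_op A). \<forall>\<eta>\<in>Domain (adjoint_op A). \<gamma> (\<xi> + \<eta>) = \<gamma> \<xi> + \<gamma> \<eta>) \<and>
    (\<forall>c. \<forall>\<xi>\<in>Domain (adjoint_op A). \<gamma> (c *\<^sub>C \<xi>) = c *\<^sub>C \<gamma> \<xi>) \<and>
    {\<xi> \<in> Domain (adjoint_op A). \<gamma> \<xi> = 0} = Domain A \<and>
    (\<forall>(\<xi>, \<xi>')\<in>adjoint_op A. norm (\<gamma> \<xi>) = infdist (\<xi>, \<xi>') A)"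

lemma orth_decomposition:
  fixes S :: "'a::chilbert_space set"
  assumes S: "csubspace S" "closed S"
  shows "\<exists>y\<in>S. x - y \<in> ortho_compl S \<and> norm (x - y) = infdist x S"
proof -
  have ne: "S \<noteq> {}"
    using complex_vector.subspace_0[OF S(1)] by auto
  define d where "d = infdist x S"
  have d0: "d \<ge> 0" by (simp add: d_def infdist_nonneg)
  have le: "d \<le> norm (x - z)" if "z \<in> S" for z
    using infdist_le[OF that, of x] by (simp add: d_def dist_norm)
  have subR: "r *\<^sub>R z \<in> S" if "z \<in> S" for z r
    using complex_vector.subspace_scale[OF S(1) that] by (simp add: scaleR_scaleC)
  have "\<exists>z\<in>S. norm (x - z) < d + inverse (real (Suc n))" for n
  proof (rule ccontr)
    assume "\<not> ?thesis"
    then have "d + inverse (real (Suc n)) \<le> dist x z" if "z \<in> S" for z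
      using that by (force simp: dist_norm)
    then have "d + inverse (real (Suc n)) \<le> infdist x S"
      using ne by (simp add: infdist_notempty cINF_greatest)
    then show False by (simp add: d_def)
  qed
  then obtain y where yS: "\<And>n. y n \<in> S"
    and yd: "\<And>n. norm (x - y n) < d + inverse (real (Suc n))"
    by metis
  have par: "(norm (y m - y n))\<^sup>2 \<le> 2 * (norm (x - y m))\<^sup>2 + 2 * (norm (x - y n))\<^sup>2 - 4 * d\<^sup>2"
    for m n
  proof -
    have "(1/2) *\<^sub>R (y m + y n) \<in> S"
      by (intro subR complex_vector.subspace_add[OF S(1)] yS)
    then have "d\<^sup>2 \<le> (norm (x - (1/2) *\<^sub>R (y m + y n)))\<^sup>2"
      using le d0 by (simp add: power_mono)
    moreover have "(norm (y m - y n))\<^sup>2 =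
        2 * (norm (x - y m))\<^sup>2 + 2 * (norm (x - y n))\<^sup>2 - 4 * (norm (x - (1/2) *\<^sub>R (y m + y n)))\<^sup>2"
      unfolding power2_norm_eq_inner
      by (simp add: inner_diff_left inner_diff_right inner_add_left inner_add_right
          inner_commute algebra_simps)
    ultimately show ?thesis by simp
  qed
  have lim: "(\<lambda>n. norm (x - y n)) \<longlonglongrightarrow> d"
  proof (rule tendsto_sandwich)
    show "\<forall>\<^sub>F n in sequentially. d \<le> norm (x - y n)"
      using le yS by simp
    show "\<forall>\<^sub>F n in sequentially. norm (x - y n) \<le> d + inverse (real (Suc n))"
      using yd by (simp add: less_imp_le)
    show "(\<lambda>n. d + inverse (real (Suc n))) \<longlonglongrightarrow> d"
      using tendsto_add[OF tendsto_const LIMSEQ_inverse_real_of_nat, of d] by simp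
  qed simp
  have "Cauchy y"
  proof (rule metric_CauchyI)
    fix e :: real assume e: "e > 0"
    have "(\<lambda>n. (norm (x - y n))\<^sup>2) \<longlonglongrightarrow> d\<^sup>2"
      by (intro tendsto_power lim)
    then have "\<forall>\<^sub>F n in sequentially. (norm (x - y n))\<^sup>2 < d\<^sup>2 + e\<^sup>2 / 4"
      using e by (simp add: order_tendstoD(2))
    then obtain N where N: "\<And>n. n \<ge> N \<Longrightarrow> (norm (x - y n))\<^sup>2 < d\<^sup>2 + e\<^sup>2 / 4"
      by (auto simp: eventually_sequentially)
    have "dist (y m) (y n) < e" if "m \<ge> N" "n \<ge> N" for m n
    proof -
      have "(norm (y m - y n))\<^sup>2 < e\<^sup>2"
        using par[of m n] N[OF that(1)] N[OF that(2)] by linarith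
      then show ?thesis
        using e by (simp add: dist_norm power2_less_imp_less)
    qed
    then show "\<exists>M. \<forall>m\<ge>M. \<forall>n\<ge>M. dist (y m) (y n) < e" by blast
  qed
  then obtain w where w: "y \<longlonglongrightarrow> w"
    using Cauchy_convergent convergent_def by blast
  have wS: "w \<in> S"
    using closed_sequentially[OF S(2)] yS w by blast
  have wd: "norm (x - w) = d"
    by (rule LIMSEQ_unique[OF tendsto_norm[OF tendsto_diff[OF tendsto_const w]] lim])
  have re: "inner (x - w) z = 0" if "z \<in> S" for z
  proof (cases "z = 0")
    case False
    define t where "t = inner (x - w) z / (norm z)\<^sup>2"
    have "w + t *\<^sub>R z \<in> S"
      by (intro complex_vector.subspace_add[OF S(1)] wS subR that)
    then have "(norm (x - w))\<^sup>2 \<le> (norm (x - (w + t *\<^sub>R z)))\<^sup>2"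
      using le d0 wd by (simp add: power_mono)
    also have "\<dots> = (norm (x - w))\<^sup>2 - 2 * t * inner (x - w) z + t\<^sup>2 * (norm z)\<^sup>2"
      unfolding power2_norm_eq_inner
      by (simp add: inner_diff_left inner_diff_right inner_add_left inner_add_right
          inner_commute power2_eq_square algebra_simps)
    also have "\<dots> = (norm (x - w))\<^sup>2 - (inner (x - w) z)\<^sup>2 / (norm z)\<^sup>2"
      using False by (simp add: t_def power2_eq_square field_simps)
    finally have "(inner (x - w) z)\<^sup>2 / (norm z)\<^sup>2 \<le> 0" by simp
    then have "(inner (x - w) z)\<^sup>2 \<le> 0"
      using False by (simp add: divide_le_0_iff)
    then show ?thesis by simp
  qed simp
  have "x - w \<in> ortho_compl S"
    unfolding ortho_compl_def
  proof safe
    fix z assume z: "z \<in> S"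
    have "\<i> *\<^sub>C z \<in> S"
      by (rule complex_vector.subspace_scale[OF S(1) z])
    then have "Re (cinner (x - w) (\<i> *\<^sub>C z)) = 0"
      using re by (simp add: inner_cinner)
    moreover have "cinner (x - w) (\<i> *\<^sub>C z) = - \<i> * cinner (x - w) z"
      using cinner_commute[of "x - w" "\<i> *\<^sub>C z"] cinner_commute[of "x - w" z]
      by (simp add: cinner_scaleC_left)
    ultimately have "Im (cinner (x - w) z) = 0" by simp
    moreover have "Re (cinner (x - w) z) = 0"
      using re[OF z] by (simp add: inner_cinner)
    ultimately show "cinner (x - w) z = 0" by (simp add: complex_eq_iff)
  qed
  then show ?thesis using wS wd d_def by blast
qed

lemma cinner_zero_left: "cinner 0 (y::'a::chilbert_space) = 0"
  using cinner_scaleC_left[of 0 0 y] by simp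

lemma cinner_diff_left: "cinner (x - y) z = cinner x z - cinner y (z::'a::chilbert_space)"
  using cinner_add_left[of "x - y" y z] by simp

lemma csubspace_ortho_compl: "csubspace (ortho_compl S)"
  by (simp add: complex_vector.subspace_def ortho_compl_def cinner_zero_left cinner_add_left
      cinner_scaleC_left)

lemma orth_decomposition_unique:
  fixes x y :: "'a::chilbert_space"
  assumes S: "csubspace S" and "x \<in> S" "y \<in> S" "z - x \<in> ortho_compl S" "z - y \<in> ortho_compl S"
  shows "x = y"
proof -
  have "x - y \<in> S"
    using assms by (simp add: complex_vector.subspace_diff)
  moreover have "x - y \<in> ortho_compl S"
    using complex_vector.subspace_diff[OF csubspace_ortho_compl assms(5,4)] by simp
  ultimately have "cinner (x - y) (x - y) = 0"
    by (simp add: ortho_compl_def)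
  then have "inner (x - y) (x - y) = 0" by (simp add: inner_cinner)
  then show ?thesis by simp
qed

lemma boundary_map_exists:
  fixes A :: "'a::chilbert_space operator"
  assumes "symmetric_op A"
  shows "\<exists>\<gamma> :: 'a \<Rightarrow> 'a \<times> 'a. boundary_map A \<gamma>"
proof -
  have A: "csubspace A" "closed A" "closure (Domain A) = UNIV" "A \<subseteq> adjoint_op A"
    using assms by (auto simp: symmetric_op_def)
  let ?B = "adjoint_op A"
  have right: "cinner x (y + z) = cinner x y + cinner x z"
    "cinner x (c *\<^sub>C y) = cnj c * cinner x y" for x y z :: 'a and c
    using cinner_commute[of x "y + z"] cinner_commute[of x y] cinner_commute[of x z]
      cinner_commute[of x "c *\<^sub>C y"]
    by (simp_all add: cinner_add_left cinner_scaleC_left)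
  have add: "(a + b, a' + b') \<in> ?B" if "(a, a') \<in> ?B" "(b, b') \<in> ?B" for a a' b b'
    using that unfolding adjoint_op_def by (fastforce simp: right)
  have scale: "(c *\<^sub>C a, c *\<^sub>C a') \<in> ?B" if "(a, a') \<in> ?B" for c a a'
    using that unfolding adjoint_op_def by (fastforce simp: right)
  have sv: "a' = b'" if "(a, a') \<in> ?B" "(a, b') \<in> ?B" for a a' b'
  proof -
    have "cinner (a' - b') x = 0" if "x \<in> Domain A" for x
    proof -
      have "cinner x a' = cinner x b'"
        using \<open>(a, a') \<in> ?B\<close> \<open>(a, b') \<in> ?B\<close> that unfolding adjoint_op_def by fastforce
      then show ?thesis
        using cinner_commute[of a' x] cinner_commute[of b' x] by (simp add: cinner_diff_left)
    qed
    then have "Domain A \<subseteq> {x. inner (a' - b') x = 0}"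
      unfolding inner_cinner by fastforce
    moreover have "closed {x. inner (a' - b') x = 0}" by (rule closed_hyperplane)
    ultimately have "closure (Domain A) \<subseteq> {x. inner (a' - b') x = 0}"
      by (rule closure_minimal)
    then have "a' - b' \<in> {x. inner (a' - b') x = 0}" using A(3) by blast
    then have "inner (a' - b') (a' - b') = 0" by (rule CollectD)
    then show ?thesis unfolding inner_eq_zero_iff by simp
  qed
  define S where "S x = (THE x'. (x, x') \<in> ?B)" for x
  have S: "S x = x'" if "(x, x') \<in> ?B" for x x'
    unfolding S_def using that sv by blast
  obtain P where P: "\<And>p. P p \<in> A" "\<And>p. p - P p \<in> ortho_compl A"
    "\<And>p. norm (p - P p) = infdist p A"
    using orth_decomposition[OF A(1,2)] by metis
  have P_eq: "P p = q" if "q \<in> A" "p - q \<in> ortho_compl A" for p q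
    using orth_decomposition_unique[OF A(1) P(1) that(1) P(2) that(2)] .
  define \<gamma> where "\<gamma> x = (x, S x) - P (x, S x)" for x
  have "\<gamma> (x + y) = \<gamma> x + \<gamma> y" if "(x, x') \<in> ?B" "(y, y') \<in> ?B" for x x' y y'
  proof -
    have "P (x + y, x' + y') = P (x, x') + P (y, y')"
    proof (rule P_eq)
      show "P (x, x') + P (y, y') \<in> A" by (rule complex_vector.subspace_add[OF A(1) P(1) P(1)])
      have "(x, x') - P (x, x') + ((y, y') - P (y, y')) \<in> ortho_compl A"
        by (rule complex_vector.subspace_add[OF csubspace_ortho_compl P(2) P(2)])
      moreover have "(x + y, x' + y') = (x, x') + (y, y')" by simp
      ultimately show "(x + y, x' + y') - (P (x, x') + P (y, y')) \<in> ortho_compl A"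
        by (metis add_diff_add)
    qed
    then show ?thesis
      using S[OF that(1)] S[OF that(2)] S[OF add[OF that]] by (simp add: \<gamma>_def prod_eq_iff)
  qed
  moreover have "\<gamma> (c *\<^sub>C x) = c *\<^sub>C \<gamma> x" if "(x, x') \<in> ?B" for c x x'
  proof -
    have "P (c *\<^sub>C x, c *\<^sub>C x') = c *\<^sub>C P (x, x')"
    proof (rule P_eq)
      show "c *\<^sub>C P (x, x') \<in> A" by (rule complex_vector.subspace_scale[OF A(1) P(1)])
      have "c *\<^sub>C ((x, x') - P (x, x')) \<in> ortho_compl A"
        by (rule complex_vector.subspace_scale[OF csubspace_ortho_compl P(2)])
      moreover have "(c *\<^sub>C x, c *\<^sub>C x') = c *\<^sub>C (x, x')" by (simp add: scaleC_prod_def)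
      ultimately show "(c *\<^sub>C x, c *\<^sub>C x') - c *\<^sub>C P (x, x') \<in> ortho_compl A"
        by (metis complex_vector.scale_right_diff_distrib)
    qed
    then show ?thesis
      using S[OF that] S[OF scale[OF that]]
      by (simp add: \<gamma>_def complex_vector.scale_right_diff_distrib scaleC_prod_def)
  qed
  moreover have nrm: "norm (\<gamma> x) = infdist (x, x') A" if "(x, x') \<in> ?B" for x x'
    using S[OF that] P(3) by (simp add: \<gamma>_def)
  moreover have "{x \<in> Domain ?B. \<gamma> x = 0} = Domain A"
  proof safe
    fix x x' assume x: "(x, x') \<in> ?B" "\<gamma> x = 0"
    then have "(x, x') = P (x, x')" using S[OF x(1)] by (simp add: \<gamma>_def)
    then show "x \<in> Domain A" using P(1) by (metis DomainI)
  next
    fix x x' assume x: "(x, x') \<in> A"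
    then show "x \<in> Domain ?B" using A(4) by auto
    have "norm (\<gamma> x) = infdist (x, x') A" using x A(4) nrm by blast
    then show "\<gamma> x = 0" using x by simp
  qed
  ultimately have "boundary_map A \<gamma>"
    unfolding boundary_map_def by fast
  then show ?thesis by (intro exI)
qed

definition bvals :: "'a::chilbert_space operator \<Rightarrow> ('a \<Rightarrow> 'v::chilbert_space) \<Rightarrow> 'v set" where
  "bvals A \<gamma> = \<gamma> ` Domain (adjoint_op A)"

definition bform ::
    "'a::chilbert_space operator \<Rightarrow> ('a \<Rightarrow> 'v::chilbert_space) \<Rightarrow> 'v \<Rightarrow> 'v \<Rightarrow> complex" where
  "bform A \<gamma> v w = (THE c. \<exists>(\<xi>, \<xi>')\<in>adjoint_op A. \<exists>(\<eta>, \<eta>')\<in>adjoint_op A.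
     \<gamma> \<xi> = v \<and> \<gamma> \<eta> = w \<and> c = cinner \<xi>' \<eta> - cinner \<xi> \<eta>')"

definition bstruct ::
    "'a::chilbert_space operator \<Rightarrow> ('a \<Rightarrow> 'v::chilbert_space) \<Rightarrow> 'v \<Rightarrow> 'v" where
  "bstruct A \<gamma> v = (THE w. w \<in> bvals A \<gamma> \<and> (\<forall>z\<in>bvals A \<gamma>. bform A \<gamma> v z = cinner w z))"

definition lagrangian :: "'v::chilbert_space set \<Rightarrow> ('v \<Rightarrow> 'v \<Rightarrow> complex) \<Rightarrow> 'v set \<Rightarrow> bool" where
  "lagrangian \<Lambda> \<omega> L \<longleftrightarrow> csubspace L \<and> L \<subseteq> \<Lambda> \<and> L = {v \<in> \<Lambda>. \<forall>w\<in>L. \<omega> v w = 0}"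

definition cauchy_data ::
    "'a::chilbert_space operator \<Rightarrow> ('a \<Rightarrow> 'v::chilbert_space) \<Rightarrow> 'v set" where
  "cauchy_data A \<gamma> = \<gamma> ` op_ker (adjoint_op A)"

definition bc_op ::
    "'a::chilbert_space operator \<Rightarrow> ('a \<Rightarrow> 'v::chilbert_space) \<Rightarrow> 'v set \<Rightarrow> 'a operator" where
  "bc_op A \<gamma> L = {(\<xi>, \<xi>') \<in> adjoint_op A. \<gamma> \<xi> \<in> L}"

definition fredholm_bc ::
    "'a::chilbert_space operator \<Rightarrow> ('a \<Rightarrow> 'v::chilbert_space) \<Rightarrow> 'v set \<Rightarrow> bool" where
  "fredholm_bc A \<gamma> L \<longleftrightarrow>
    lagrangian (bvals A \<gamma>) (bform A \<gamma>) L \<and> fredholm_in UNIV (bc_op A \<gamma> L)"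

text \<open>Hilbert spaces are here closed subspaces \<^term>\<open>W\<close> of a type. Operators on \<^term>\<open>W\<close> are
  encoded as bounded operators of the ambient space that vanish on \<^term>\<open>ortho_compl W\<close>; this is
  isometric for the operator norms.\<close>

definition unitaries :: "'w::chilbert_space set \<Rightarrow> ('w \<Rightarrow>\<^sub>L 'w) set" where
  "unitaries W = {u. (\<forall>c x. blinfun_apply u (c *\<^sub>C x) = c *\<^sub>C blinfun_apply u x) \<and>
     (\<forall>x\<in>W. norm (u x) = norm x) \<and> blinfun_apply u ` W = W \<and> (\<forall>x\<in>ortho_compl W. u x = 0)}"

definition unitaries_F :: "'w::chilbert_space set \<Rightarrow> ('w \<Rightarrow>\<^sub>L 'w) set" where
  "unitaries_F W = {u \<in> unitaries W. fredholm_in W {(x, u x + x) | x. x \<in> W}}"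

definition htpy_class :: "'x topology \<Rightarrow> 'y topology \<Rightarrow> ('x \<Rightarrow> 'y) \<Rightarrow> ('x \<Rightarrow> 'y) set" where
  "htpy_class X Y f = {g. homotopic_with (\<lambda>_. True) X Y f g}"

definition htpy_classes :: "'x topology \<Rightarrow> 'y topology \<Rightarrow> ('x \<Rightarrow> 'y) set set" where
  "htpy_classes X Y = htpy_class X Y ` {f. continuous_map X Y f}"

definition K1 :: "'x topology \<Rightarrow> ('x \<Rightarrow> ('a::chilbert_space \<Rightarrow>\<^sub>L 'a)) set set" where
  "K1 X = htpy_classes X (top_of_set (unitaries_F UNIV))"

definition unitary_iso :: "'w::chilbert_space set \<Rightarrow> ('w \<Rightarrow> 'a::chilbert_space) \<Rightarrow> bool" where
  "unitary_iso W \<Phi> \<longleftrightarrow> (\<forall>x\<in>W. \<forall>y\<in>W. \<Phi> (x + y) = \<Phi> x + \<Phi> y) \<and>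
     (\<forall>c. \<forall>x\<in>W. \<Phi> (c *\<^sub>C x) = c *\<^sub>C \<Phi> x) \<and> (\<forall>x\<in>W. norm (\<Phi> x) = norm x) \<and> \<Phi> ` W = UNIV"

definition transport ::
    "'w::chilbert_space set \<Rightarrow> ('w \<Rightarrow> 'a::chilbert_space) \<Rightarrow> ('w \<Rightarrow>\<^sub>L 'w) \<Rightarrow> 'a \<Rightarrow>\<^sub>L 'a" where
  "transport W \<Phi> u = Blinfun (\<lambda>y. \<Phi> (u (inv_into W \<Phi> y)))"

definition plus_one ::
    "('w::chilbert_space \<Rightarrow>\<^sub>L 'w) \<Rightarrow> ('w \<times> 'a::chilbert_space) \<Rightarrow>\<^sub>L ('w \<times> 'a)" where
  "plus_one u = Blinfun (\<lambda>(x, y). (u x, y))"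

text \<open>The index of a family \<^term>\<open>f\<close> of unitaries of \<^term>\<open>W\<close> is the homotopy class of the direct
  sum of \<^term>\<open>f\<close> with the identity of the auxiliary space, regarded as a family of unitaries of
  the type \<^typ>\<open>'a\<close> by means of any unitary identification \<^term>\<open>\<Phi>\<close>. (The unitary group being path
  connected, all identifications yield the same class. The auxiliary space is \<^typ>\<open>'a\<close> as well.)\<close>

definition K1_index ::
    "'x topology \<Rightarrow> 'w::chilbert_space set \<Rightarrow> ('x \<Rightarrow> 'w \<Rightarrow>\<^sub>L 'w)
      \<Rightarrow> ('x \<Rightarrow> ('a::chilbert_space \<Rightarrow>\<^sub>L 'a)) set" where
  "K1_index X W f =
    (\<Union>\<Phi> \<in> {\<Phi> :: 'w \<times> 'a \<Rightarrow> 'a. unitary_iso (W \<times> UNIV) \<Phi>}.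
       htpy_class X (top_of_set (unitaries_F UNIV))
         (\<lambda>x. transport (W \<times> UNIV) \<Phi> (plus_one (f x))))"

text \<open>The operator $(B - i)(B + i)^{-1}$.\<close>

definition cayley :: "'a::chilbert_space operator \<Rightarrow> 'a \<Rightarrow>\<^sub>L 'a" where
  "cayley B = Blinfun (\<lambda>y. THE z. \<exists>(\<xi>, \<xi>')\<in>B. y = \<xi>' + \<i> *\<^sub>C \<xi> \<and> z = \<xi>' - \<i> *\<^sub>C \<xi>)"

definition op_index ::
    "'x topology \<Rightarrow> ('x \<Rightarrow> 'a::chilbert_space operator) \<Rightarrow> ('x \<Rightarrow> ('a \<Rightarrow>\<^sub>L 'a)) set" where
  "op_index X B = K1_index X UNIV (\<lambda>x. cayley (B x))"

definition eig_plus :: "'v::chilbert_space set \<Rightarrow> ('v \<Rightarrow> 'v) \<Rightarrow> 'v set" where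
  "eig_plus \<Lambda> J = {v \<in> \<Lambda>. J v = \<i> *\<^sub>C v}"

definition eig_minus :: "'v::chilbert_space set \<Rightarrow> ('v \<Rightarrow> 'v) \<Rightarrow> 'v set" where
  "eig_minus \<Lambda> J = {v \<in> \<Lambda>. J v = - (\<i> *\<^sub>C v)}"

text \<open>A Lagrangian subspace \<^term>\<open>L\<close> is the set of all \<^term>\<open>x + lag_unitary \<Lambda> J L x\<close>, where
  \<^term>\<open>x\<close> ranges over \<^term>\<open>eig_plus \<Lambda> J\<close>.\<close>

definition lag_unitary ::
    "'v::chilbert_space set \<Rightarrow> ('v \<Rightarrow> 'v) \<Rightarrow> 'v set \<Rightarrow> 'v \<Rightarrow> 'v" where
  "lag_unitary \<Lambda> J L x = (THE y. y \<in> eig_minus \<Lambda> J \<and> x + y \<in> L)"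

text \<open>The operator $- u_M^{-1} u_L$ on \<^term>\<open>eig_plus \<Lambda> J\<close>, extended by zero.\<close>

definition pair_unitary ::
    "'v::chilbert_space set \<Rightarrow> ('v \<Rightarrow> 'v) \<Rightarrow> 'v set \<Rightarrow> 'v set \<Rightarrow> 'v \<Rightarrow>\<^sub>L 'v" where
  "pair_unitary \<Lambda> J L M = Blinfun (\<lambda>v. - inv_into (eig_plus \<Lambda> J) (lag_unitary \<Lambda> J M)
     (lag_unitary \<Lambda> J L (orth_projection (eig_plus \<Lambda> J) v)))"

definition pair_index ::
    "'x topology \<Rightarrow> 'v::chilbert_space set \<Rightarrow> ('v \<Rightarrow> 'v) \<Rightarrow> ('x \<Rightarrow> 'v set) \<Rightarrow> ('x \<Rightarrow> 'v set)
      \<Rightarrow> ('x \<Rightarrow> ('a::chilbert_space \<Rightarrow>\<^sub>L 'a)) set" where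
  "pair_index X \<Lambda> J L M = K1_index X (eig_plus \<Lambda> J) (\<lambda>x. pair_unitary \<Lambda> J (L x) (M x))"

end

theory Submission
  imports Defs
begin

text \<open>Let $\kappa_L$ be the Cayley transform of $A_L$, let $N = \ker(A^* - i)$, and assume
  for the moment that $\ker A = 0$. All $\kappa_L$ agree on $\operatorname{ran}(A + i) = N^\perp$, and on $N$, which
  $\gamma$ identifies with $\mathcal V^+$ up to the factor $\sqrt 2$, $\kappa_L$ becomes $-u_L$. Let
  $w$ be $\kappa_{\mathcal C}$ on $N^\perp$ and $-\kappa_{\mathcal C}$ on $N$. Then
  $w^{-1} \kappa_L = 1 \oplus (-u_{\mathcal C}^{-1} u_L)$, so that it suffices to deform
  $\kappa_L = w (w^{-1} \kappa_L)$ to $w^{-1} \kappa_L$. As the range of $A$ is closed, $w + 1$ is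
  invertible. Hence $w = V_1$ for a path $V_t = (1 + t Y) (1 - t Y)^{-1}$ with $Y$ bounded and
  skew-adjoint, which starts at $1$. By the choice of $\mathcal C$ the compression of $Y$ to $N$
  vanishes, and this makes the Fredholm property of $V_t w^{-1} \kappa_L + 1$ independent of $t$. In
  general $\ker A$ contributes a summand $-1$ to $w^{-1} \kappa_L$, which is rotated to $1$. The
  choice of the identifications in the definition of the index is immaterial since the unitary
  group is path connected in the norm topology.\<close>

section \<open>Complex Hilbert spaces\<close>

text \<open>The Cayley transform of the extension with boundary condition C is -1 on the kernel of
  that extension. This is all of \<open>op_ker (adjoint_op A)\<close>, possibly
  infinite-dimensional, so this transform need not lie in \<open>unitaries_F UNIV\<close>. The sign
  change on N repairs this: on c' + i c in N, with (c, c') in the extension, w + 1 yields 2 i c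
  where the transform itself plus 1 yields 2 c'. Since \<open>unitaries_F UNIV\<close> is not closed
  under products, an arbitrary path of unitaries from w to 1 may lose the Fredholm property of its
  product with the remaining factor, so that path connectedness alone is of no help at this point.
  What distinguishes the Cayley path is that the extension with condition C has the same range as A.
  For c' + i c in N one can therefore write c' = A b, and Y maps c' + i c to -(c' + i b), a vector
  of the range of A + i. This extension, the adjoint restricted to the sum of the domain of A and
  the kernel of the adjoint, is the analogue of the Krein-von Neumann extension of a positive
  operator.\<close>

instance chilbert_space \<subseteq> banach ..

lemma scaleC_one [simp]: "1 *\<^sub>C x = (x::'a::chilbert_space)"
  by (rule complex_vector.scale_one)

lemma scaleC_minus1 [simp]: "(-1) *\<^sub>C x = - (x::'a::chilbert_space)"
  by (metis complex_vector.scale_minus_left scaleC_one)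

lemma scaleC_ii [simp]: "\<i> *\<^sub>C \<i> *\<^sub>C x = - (x::'a::chilbert_space)"
  by (simp add: scaleC_scaleC)

lemma scaleC_two: "2 *\<^sub>C x = x + (x::'a::chilbert_space)"
  using scaleC_add_left[of 1 1 x] by simp

lemma scaleC_half [simp]: "(1/2) *\<^sub>C x + (1/2) *\<^sub>C x = (x::'a::chilbert_space)"
  by (simp flip: scaleC_add_left)

lemma scaleR_scaleC_commute: "r *\<^sub>R c *\<^sub>C x = c *\<^sub>C r *\<^sub>R (x::'a::chilbert_space)"
  by (simp add: scaleR_scaleC scaleC_scaleC mult.commute)

lemma cinner_add_right: "cinner x (y + z) = cinner x y + cinner x (z::'a::chilbert_space)"
  using cinner_commute[of x "y + z"] cinner_commute[of x y] cinner_commute[of x z]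
  by (simp add: cinner_add_left)

lemma cinner_scaleC_right: "cinner x (c *\<^sub>C y) = cnj c * cinner x (y::'a::chilbert_space)"
  using cinner_commute[of x "c *\<^sub>C y"] cinner_commute[of x y] by (simp add: cinner_scaleC_left)

lemma cinner_zero_right: "cinner x 0 = 0" for x :: "'a::chilbert_space"
  using cinner_scaleC_right[of x 0 0] by simp

lemma cinner_minus_left: "cinner (- x) y = - cinner x (y::'a::chilbert_space)"
  using cinner_scaleC_left[of "-1" x y] by simp

lemma cinner_minus_right: "cinner x (- y) = - cinner x (y::'a::chilbert_space)"
  using cinner_scaleC_right[of x "-1" y] by simp

lemma cinner_diff_right: "cinner x (y - z) = cinner x y - cinner x (z::'a::chilbert_space)"
  using cinner_add_right[of x "y - z" z] by simp

lemma cinner_scaleR_left: "cinner (r *\<^sub>R x) y = of_real r * cinner x (y::'a::chilbert_space)"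
  by (simp add: scaleR_scaleC cinner_scaleC_left)

lemma cinner_scaleR_right: "cinner x (r *\<^sub>R y) = of_real r * cinner x (y::'a::chilbert_space)"
  by (simp add: scaleR_scaleC cinner_scaleC_right)

lemmas cinner_simps = cinner_add_left cinner_add_right cinner_diff_left cinner_diff_right
  cinner_minus_left cinner_minus_right cinner_scaleC_left cinner_scaleC_right
  cinner_scaleR_left cinner_scaleR_right cinner_zero_left cinner_zero_right

lemma cinner_self: "cinner x x = of_real ((norm x)\<^sup>2)" for x :: "'a::chilbert_space"
proof (rule complex_eqI)
  show "Re (cinner x x) = Re (of_real ((norm x)\<^sup>2))"
    using inner_cinner[of x x] by (simp add: power2_norm_eq_inner)
  show "Im (cinner x x) = Im (of_real ((norm x)\<^sup>2))"
    using arg_cong[OF cinner_commute[of x x], of Im] by simp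
qed

lemma cinner_self_eq_0 [simp]: "cinner x x = 0 \<longleftrightarrow> x = 0" for x :: "'a::chilbert_space"
  by (simp add: cinner_self)

lemma cinner_eq_0_commute: "cinner x y = 0 \<longleftrightarrow> cinner y x = 0" for x y :: "'a::chilbert_space"
  using cinner_commute[of x y] by simp

lemma norm_scaleC: "norm (c *\<^sub>C x) = cmod c * norm x" for x :: "'a::chilbert_space"
proof -
  have "complex_of_real ((norm (c *\<^sub>C x))\<^sup>2) = of_real ((cmod c)\<^sup>2 * (norm x)\<^sup>2)"
    unfolding cinner_self[symmetric] cinner_scaleC_left cinner_scaleC_right
    by (simp add: complex_norm_square[of c] cinner_self ac_simps del: of_real_power)
  then have "(norm (c *\<^sub>C x))\<^sup>2 = (cmod c * norm x)\<^sup>2"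
    by (simp only: of_real_eq_iff power_mult_distrib)
  then show ?thesis by simp
qed

lemma norm_plus_sq: "(norm (x + y))\<^sup>2 = (norm x)\<^sup>2 + (norm y)\<^sup>2 + 2 * Re (cinner x y)"
  for x y :: "'a::chilbert_space"
  using power2_norm_eq_inner[of "x + y"] power2_norm_eq_inner[of x] power2_norm_eq_inner[of y]
  by (simp add: inner_add_left inner_add_right inner_commute inner_cinner[of x y])

lemma norm_cinner_le: "cmod (cinner x y) \<le> norm x * norm y" for x y :: "'a::chilbert_space"
proof (cases "cinner x y = 0")
  case False
  \<comment> \<open>A phase that makes the inner product real and nonnegative; the rest is the real
    Cauchy-Schwarz inequality.\<close>
  define c where "c = cnj (cinner x y) / cmod (cinner x y)"
  have c: "cmod c = 1" "c * cinner x y = of_real (cmod (cinner x y))"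
    using False complex_norm_square[of "cinner x y"]
    by (simp_all add: c_def norm_divide power2_eq_square mult.commute[of "cnj _"] field_simps)
  have "cmod (cinner x y) = inner (c *\<^sub>C x) y"
    by (simp add: inner_cinner cinner_scaleC_left c(2))
  also have "\<dots> \<le> norm (c *\<^sub>C x) * norm y" by (rule norm_cauchy_schwarz)
  finally show ?thesis by (simp add: norm_scaleC c(1))
qed auto

lemma bounded_linear_scaleC: "bounded_linear ((*\<^sub>C) c :: 'a::chilbert_space \<Rightarrow> 'a)"
  by (rule bounded_linear_intro[where K = "cmod c"])
    (simp_all add: scaleC_add_right scaleR_scaleC_commute norm_scaleC mult.commute)

lemma bounded_linear_cinner_left: "bounded_linear (\<lambda>x::'a::chilbert_space. cinner x y)"
proof (rule bounded_linear_intro[where K = "norm y"])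
  show "norm (cinner x y) \<le> norm x * norm y" for x by (rule norm_cinner_le)
qed (simp_all add: cinner_simps scaleR_conv_of_real)

lemma continuous_on_scaleC [continuous_intros]:
  "continuous_on S f \<Longrightarrow> continuous_on S (\<lambda>x. c *\<^sub>C (f x :: 'a::chilbert_space))"
  by (rule bounded_linear.continuous_on[OF bounded_linear_scaleC])

lemma csubspace_scaleR: "csubspace S \<Longrightarrow> x \<in> S \<Longrightarrow> r *\<^sub>R x \<in> S"
  by (simp add: scaleR_scaleC complex_vector.subspace_scale)

lemma csubspace_imp_subspace: "csubspace S \<Longrightarrow> subspace S"
  by (simp add: subspace_def complex_vector.subspace_0 complex_vector.subspace_add csubspace_scaleR)

lemma ortho_compl_UNIV [simp]: "ortho_compl UNIV = {0::'a::chilbert_space}"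
  using cinner_self_eq_0 by (fastforce simp: ortho_compl_def cinner_zero_left)

lemma closed_ortho_compl: "closed (ortho_compl S)"
proof -
  have "ortho_compl S = (\<Inter>y\<in>S. (\<lambda>x. cinner x y) -` {0})"
    by (auto simp: ortho_compl_def)
  moreover have "closed ((\<lambda>x. cinner x y) -` {0})" for y :: 'a
    by (rule continuous_closed_vimage)
      (auto intro: linear_continuous_at bounded_linear_cinner_left)
  ultimately show ?thesis by auto
qed

lemma closed_csubspace_eq_UNIV:
  assumes "csubspace S" "closed S" "ortho_compl S \<subseteq> {0}"
  shows "S = UNIV"
proof -
  have "x \<in> S" for x
    using orth_decomposition[OF assms(1,2), of x] assms(3) by auto
  then show ?thesis by auto
qed

lemma ortho_compl_ortho_compl:
  assumes "csubspace S" "closed S"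
  shows "ortho_compl (ortho_compl S) = S"
proof
  show "S \<subseteq> ortho_compl (ortho_compl S)"
    by (auto simp: ortho_compl_def cinner_eq_0_commute)
  show "ortho_compl (ortho_compl S) \<subseteq> S"
  proof
    fix x assume x: "x \<in> ortho_compl (ortho_compl S)"
    obtain y where y: "y \<in> S" "x - y \<in> ortho_compl S"
      using orth_decomposition[OF assms] by blast
    have "cinner x (x - y) = 0" "cinner y (x - y) = 0"
      using x y cinner_eq_0_commute by (fastforce simp: ortho_compl_def)+
    then have "cinner (x - y) (x - y) = 0" by (simp add: cinner_diff_left)
    then show "x \<in> S" using y by simp
  qed
qed

lemma norm_plus_sq_orth:
  "cinner x y = 0 \<Longrightarrow> (norm (x + y))\<^sup>2 = (norm x)\<^sup>2 + (norm (y::'a::chilbert_space))\<^sup>2"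
  by (simp add: norm_plus_sq)

section \<open>Complex-linear bounded operators\<close>

definition cblin :: "('a::chilbert_space \<Rightarrow>\<^sub>L 'b::chilbert_space) \<Rightarrow> bool" where
  "cblin u \<longleftrightarrow> (\<forall>c x. u (c *\<^sub>C x) = c *\<^sub>C u x)"

lemma cblinD: "cblin u \<Longrightarrow> u (c *\<^sub>C x) = c *\<^sub>C u x"
  by (simp add: cblin_def)

lemma cblin_id [simp]: "cblin id_blinfun" by (simp add: cblin_def)
lemma cblin_zero [simp]: "cblin 0" by (simp add: cblin_def)
lemma cblin_compose: "cblin u \<Longrightarrow> cblin v \<Longrightarrow> cblin (u o\<^sub>L v)" by (simp add: cblin_def)
lemma cblin_add: "cblin u \<Longrightarrow> cblin v \<Longrightarrow> cblin (u + v)"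
  by (simp add: cblin_def blinfun.add_left scaleC_add_right)
lemma cblin_minus: "cblin u \<Longrightarrow> cblin (- u)"
  by (simp add: cblin_def blinfun.minus_left)
lemma cblin_diff: "cblin u \<Longrightarrow> cblin v \<Longrightarrow> cblin (u - v)"
  by (simp add: cblin_def blinfun.diff_left complex_vector.scale_right_diff_distrib)
lemma cblin_scaleR: "cblin u \<Longrightarrow> cblin (r *\<^sub>R u)"
  by (simp add: cblin_def blinfun.scaleR_left scaleR_scaleC_commute)
lemmas cblin_intros = cblin_id cblin_zero cblin_compose cblin_add cblin_minus cblin_diff
    cblin_scaleR

definition scaleC_blinfun :: "complex \<Rightarrow> 'a::chilbert_space \<Rightarrow>\<^sub>L 'a" where
  "scaleC_blinfun c = Blinfun ((*\<^sub>C) c)"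

lemma scaleC_blinfun_apply [simp]: "scaleC_blinfun c x = c *\<^sub>C x"
  by (simp add: scaleC_blinfun_def bounded_linear_Blinfun_apply[OF bounded_linear_scaleC])

lemma cblin_scaleC [simp]: "cblin (scaleC_blinfun c)"
  by (simp add: cblin_def scaleC_scaleC mult.commute)

lemma continuous_scaleC_blinfun:
    "continuous_on UNIV (scaleC_blinfun :: complex \<Rightarrow> 'a::chilbert_space \<Rightarrow>\<^sub>L 'a)"
proof -
  have "scaleC_blinfun c = Re c *\<^sub>R (id_blinfun :: 'a \<Rightarrow>\<^sub>L 'a) + Im c *\<^sub>R scaleC_blinfun \<i>" for c
  proof (rule blinfun_eqI)
    fix x :: 'a
    have "c *\<^sub>C x = (of_real (Re c) + of_real (Im c) * \<i>) *\<^sub>C x"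
      using complex_eq[of c] by (simp add: mult.commute)
    then show "scaleC_blinfun c x = (Re c *\<^sub>R (id_blinfun :: 'a \<Rightarrow>\<^sub>L 'a) + Im c *\<^sub>R scaleC_blinfun \<i>) x"
      by (simp add: blinfun.add_left blinfun.scaleR_left scaleR_scaleC scaleC_add_left
          scaleC_scaleC)
  qed
  then have "scaleC_blinfun = (\<lambda>c. Re c *\<^sub>R (id_blinfun :: 'a \<Rightarrow>\<^sub>L 'a) + Im c *\<^sub>R scaleC_blinfun \<i>)"
    by blast
  moreover have
      "continuous_on UNIV (\<lambda>c. Re c *\<^sub>R (id_blinfun :: 'a \<Rightarrow>\<^sub>L 'a) + Im c *\<^sub>R scaleC_blinfun \<i>)"
    by (intro continuous_intros)
  ultimately show ?thesis by metis
qed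

lemma orth_projection:
  assumes S: "csubspace S" "closed S"
  shows orth_projection_in: "orth_projection S x \<in> S"
    and orth_projection_diff: "x - orth_projection S x \<in> ortho_compl S"
    and cblin_orth_projection: "cblin (orth_projection S)"
proof -
  define p where "p x = (THE y. y \<in> S \<and> x - y \<in> ortho_compl S)" for x
  have eq: "p x = y" if "y \<in> S" "x - y \<in> ortho_compl S" for x y
    unfolding p_def using that orth_decomposition_unique[OF S(1)] by blast
  have p: "p x \<in> S" "x - p x \<in> ortho_compl S" for x
    using orth_decomposition[OF S, of x] eq by metis+
  have add: "p (x + y) = p x + p y" for x y
  proof (rule eq)
    show "p x + p y \<in> S" using p S(1) complex_vector.subspace_add by blast
    have "(x - p x) + (y - p y) \<in> ortho_compl S"
      using p csubspace_ortho_compl complex_vector.subspace_add by blast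
    then show "x + y - (p x + p y) \<in> ortho_compl S" by (simp add: algebra_simps)
  qed
  have scale: "p (c *\<^sub>C x) = c *\<^sub>C p x" for c x
  proof (rule eq)
    show "c *\<^sub>C p x \<in> S" using p S(1) complex_vector.subspace_scale by blast
    have "c *\<^sub>C (x - p x) \<in> ortho_compl S"
      using p csubspace_ortho_compl complex_vector.subspace_scale by blast
    then show "c *\<^sub>C x - c *\<^sub>C p x \<in> ortho_compl S"
      by (simp add: complex_vector.scale_right_diff_distrib)
  qed
  have "norm (p x) \<le> norm x" for x
  proof -
    have "cinner (p x) (x - p x) = 0"
      using p[of x] by (auto simp: ortho_compl_def cinner_eq_0_commute[of "p x"])
    then have "(norm x)\<^sup>2 = (norm (p x))\<^sup>2 + (norm (x - p x))\<^sup>2"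
      using norm_plus_sq_orth[of "p x" "x - p x"] by simp
    then show ?thesis by (simp add: power2_le_imp_le)
  qed
  then have "bounded_linear p"
    by (intro bounded_linear_intro[where K = 1]) (simp_all add: add scale scaleR_scaleC)
  then have *: "blinfun_apply (orth_projection S) = p"
    by (simp add: orth_projection_def p_def[abs_def] bounded_linear_Blinfun_apply)
  show "orth_projection S x \<in> S" "x - orth_projection S x
      \<in> ortho_compl S" "cblin (orth_projection S)"
    by (simp_all add: * p cblin_def scale)
qed

lemma orth_projection_eq:
  assumes "csubspace S" "closed S" "y \<in> S" "x - y \<in> ortho_compl S"
  shows "orth_projection S x = y"
  using orth_decomposition_unique[OF assms(1) orth_projection_in[OF assms(1,2)] assms(3)
      orth_projection_diff[OF assms(1,2)] assms(4)] .

lemma orth_projection_id: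
  assumes "csubspace S" "closed S" "x \<in> S"
  shows "orth_projection S x = x"
  using assms by (intro orth_projection_eq) (simp_all add: ortho_compl_def cinner_zero_left)

lemma orth_projection_zero:
  assumes "csubspace S" "closed S" "x \<in> ortho_compl S"
  shows "orth_projection S x = 0"
  using assms by (intro orth_projection_eq) (simp_all add: complex_vector.subspace_0)

lemma orth_projection_sym:
  assumes "csubspace S" "closed S"
  shows "cinner (orth_projection S x) y = cinner x (orth_projection S y)"
proof -
  let ?p = "orth_projection S"
  have "cinner (?p x) (y - ?p y) = 0" "cinner (x - ?p x) (?p y) = 0"
    using orth_projection_in[OF assms] orth_projection_diff[OF assms]
    by (auto simp: ortho_compl_def cinner_eq_0_commute[of "?p x"])
  then show ?thesis by (simp add: cinner_simps)
qed

text \<open>The lower bound makes the range complete, hence closed, and the operator injective; the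
  trivial orthogonal complement then makes the range everything.\<close>

lemma bounded_below_inverse:
  fixes T :: "'a::chilbert_space \<Rightarrow>\<^sub>L 'b::chilbert_space"
  assumes T: "cblin T" and e: "e > 0" and bb: "\<And>x. e * norm x \<le> norm (T x)"
    and oc: "\<And>z. (\<And>x. cinner (T x) z = 0) \<Longrightarrow> z = 0"
  shows "\<exists>S. cblin S \<and> S o\<^sub>L T = id_blinfun \<and> T o\<^sub>L S = id_blinfun \<and> norm S \<le> 1 / e"
proof -
  have "complete (range T)"
    by (rule complete_isometric_image[OF e _ blinfun.bounded_linear_right])
      (use bb in \<open>auto simp: complete_UNIV\<close>)
  then have cl: "closed (range T)" by (rule complete_imp_closed)
  have sub: "csubspace (range T)"
    unfolding complex_vector.subspace_def
    by (auto simp: image_iff simp flip: cblinD[OF T] blinfun.add_right)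
      (metis blinfun.zero_right)
  have "ortho_compl (range T) \<subseteq> {0}"
    using oc by (fastforce simp: ortho_compl_def cinner_eq_0_commute)
  then have surj: "range T = UNIV" by (rule closed_csubspace_eq_UNIV[OF sub cl])
  have inj: "inj (blinfun_apply T)"
  proof (rule injI)
    fix x y assume "T x = T y"
    then have "e * norm (x - y) \<le> 0" using bb[of "x - y"] by (simp add: blinfun.diff_right)
    then show "x = y" using e by (simp add: mult_le_0_iff)
  qed
  define S where "S = inv (blinfun_apply T)"
  have TS: "T (S y) = y" for y using surj by (simp add: S_def surj_f_inv_f)
  have ST: "S (T x) = x" for x using inj by (simp add: S_def)
  have nS: "norm (S y) \<le> 1 / e * norm y" for y
    using bb[of "S y"] e by (simp add: TS field_simps)
  have scS: "S (c *\<^sub>C y) = c *\<^sub>C S y" for c y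
    by (metis ST TS T cblinD)
  have "bounded_linear S"
  proof (rule bounded_linear_intro[where K = "1/e"])
    show "S (x + y) = S x + S y" for x y by (metis ST TS blinfun.add_right)
    show "S (r *\<^sub>R x) = r *\<^sub>R S x" for r x by (simp add: scaleR_scaleC scS)
    show "norm (S x) \<le> norm x * (1/e)" for x using nS[of x] by simp
  qed
  then have *: "blinfun_apply (Blinfun S) = S" by (rule bounded_linear_Blinfun_apply)
  show ?thesis
    by (rule exI[of _ "Blinfun S"])
      (use e nS in \<open>auto intro!: blinfun_eqI norm_blinfun_bound simp: * TS ST cblin_def scS\<close>)
qed

section \<open>Unitary operators\<close>

lemma unitaries_UNIV:
  "u \<in> unitaries UNIV \<longleftrightarrow> cblin u \<and> (\<forall>x. norm (u x) = norm x) \<and> range u = UNIV"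
  by (auto simp: unitaries_def cblin_def)

text \<open>Polarization. It is stated for maps linear on a subspace because it is applied to
  \<open>\<gamma>\<close> composed with \<open>fst\<close> and to \<open>shift_op\<close> on a
  graph.\<close>

lemma isometry_cinner:
  fixes f :: "'a::chilbert_space \<Rightarrow> 'b::chilbert_space"
  assumes S: "csubspace S"
    and add: "\<And>x y. x \<in> S \<Longrightarrow> y \<in> S \<Longrightarrow> f (x + y) = f x + f y"
    and scale: "\<And>c x. x \<in> S \<Longrightarrow> f (c *\<^sub>C x) = c *\<^sub>C f x"
    and nrm: "\<And>x. x \<in> S \<Longrightarrow> norm (f x) = norm x"
    and xy: "x \<in> S" "y \<in> S"
  shows "cinner (f x) (f y) = cinner x y"
proof -
  have re: "Re (cinner (f x) (f y)) = Re (cinner x y)" if "x \<in> S" "y \<in> S" for x y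
    using norm_plus_sq[of x y] norm_plus_sq[of "f x" "f y"] that
    by (simp add: nrm complex_vector.subspace_add[OF S] flip: add)
  have iy: "\<i> *\<^sub>C y \<in> S" using xy S by (simp add: complex_vector.subspace_scale)
  show ?thesis
  proof (rule complex_eqI)
    show "Im (cinner (f x) (f y)) = Im (cinner x y)"
      using re[OF xy(1) iy] xy by (simp add: scale cinner_scaleC_right)
  qed (use re xy in simp)
qed

lemma unitary_cinner: "u \<in> unitaries UNIV \<Longrightarrow> cinner (u x) (u y) = cinner x y"
  by (rule isometry_cinner[where S = UNIV])
    (auto simp: unitaries_UNIV blinfun.add_right cblinD)

lemma unitaries_compose: "u \<in> unitaries UNIV \<Longrightarrow> v \<in> unitaries UNIV \<Longrightarrow> u o\<^sub>L v \<in> unitaries UNIV"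
  unfolding unitaries_UNIV
    by (simp add: cblin_compose) (metis (no_types, lifting) surj_def blinfun_apply_blinfun_compose)

lemma unitaries_scaleC: "cmod c = 1 \<Longrightarrow> scaleC_blinfun c \<in> unitaries UNIV"
proof -
  assume c: "cmod c = 1"
  have "y = c *\<^sub>C (inverse c *\<^sub>C y)" for y :: 'a
    using c by (cases "c = 0") (auto simp: scaleC_scaleC)
  then have "range ((*\<^sub>C) c :: 'a \<Rightarrow> 'a) = UNIV" by blast
  then show ?thesis using c by (simp add: unitaries_UNIV norm_scaleC)
qed

text \<open>For a unitary this is also the adjoint, see \<open>unitary_adjoint\<close>.\<close>

definition inv_blinfun :: "('a::chilbert_space \<Rightarrow>\<^sub>L 'b::chilbert_space) \<Rightarrow> 'b \<Rightarrow>\<^sub>L 'a" where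
  "inv_blinfun u = Blinfun (inv (blinfun_apply u))"

lemma inv_unitary:
  assumes u: "u \<in> unitaries UNIV"
  shows inv_unitary_left [simp]: "inv_blinfun u (u x) = x"
    and inv_unitary_right [simp]: "u (inv_blinfun u x) = x"
    and inv_unitary_unitary: "inv_blinfun u \<in> unitaries UNIV"
proof -
  have *: "cblin u" "\<And>x. norm (u x) = norm x" "range u = UNIV"
    using u by (auto simp: unitaries_UNIV)
  have "z = 0" if "\<And>x. cinner (u x) z = 0" for z
    using that *(3) by (metis cinner_self_eq_0 surjD)
  then obtain s where s: "cblin s" "s o\<^sub>L u = id_blinfun" "u o\<^sub>L s = id_blinfun"
    using bounded_below_inverse[OF *(1), of 1] *(2) by auto
  have su: "s (u x) = x" "u (s x) = x" for x
    using s by (metis blinfun_apply_blinfun_compose blinfun_apply_id_blinfun)+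
  have "inv (blinfun_apply u) = blinfun_apply s"
    by (rule inv_equality) (rule su)+
  then have eq: "inv_blinfun u = s"
    by (simp add: inv_blinfun_def blinfun_apply_inverse)
  show "inv_blinfun u (u x) = x" "u (inv_blinfun u x) = x" by (simp_all add: eq su)
  have "norm (s x) = norm x" for x using *(2)[of "s x"] by (simp add: su)
  moreover have "range s = UNIV" by (metis su(1) surjI)
  ultimately show "inv_blinfun u \<in> unitaries UNIV" using s by (simp add: unitaries_UNIV eq)
qed

lemma unitary_adjoint: "u \<in> unitaries UNIV \<Longrightarrow> cinner (u x) y = cinner x (inv_blinfun u y)"
  by (metis inv_unitary_right unitary_cinner)

lemma unitary_adjoint': "u \<in> unitaries UNIV \<Longrightarrow> cinner x (u y) = cinner (inv_blinfun u x) y"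
  by (metis inv_unitary_right unitary_cinner)

lemma unitary_norm: "u \<in> unitaries UNIV \<Longrightarrow> norm (u x) = norm x"
  by (simp add: unitaries_UNIV)

lemma unitary_cblin: "u \<in> unitaries UNIV \<Longrightarrow> cblin u"
  by (simp add: unitaries_UNIV)

text \<open>Inversion does not increase distances: v^-1 - u^-1 = - v^-1 (v - u) u^-1, and both
  inverses are isometric.\<close>

lemma continuous_on_inv_unitary: "continuous_on (unitaries UNIV) inv_blinfun"
proof (rule continuous_on_iff[THEN iffD2], intro ballI allI impI)
  fix u :: "'a \<Rightarrow>\<^sub>L 'a" and e :: real assume u: "u \<in> unitaries UNIV" and e: "e > 0"
  have "dist (inv_blinfun v) (inv_blinfun u) \<le> dist v u" if v: "v \<in> unitaries UNIV" for v
  proof -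
    have "norm ((inv_blinfun v - inv_blinfun u) x) \<le> norm (v - u) * norm x" for x
    proof -
      have "norm ((inv_blinfun v - inv_blinfun u) x) = norm (v ((inv_blinfun v - inv_blinfun u) x))"
        using unitary_norm[OF v] by simp
      also have "v ((inv_blinfun v - inv_blinfun u) x) = - ((v - u) (inv_blinfun u x))"
        using u v by (simp add: blinfun.diff_left blinfun.diff_right)
      also have "norm \<dots> \<le> norm (v - u) * norm (inv_blinfun u x)"
        using norm_blinfun by auto
      finally show ?thesis using unitary_norm[OF inv_unitary_unitary[OF u]] by simp
    qed
    then show ?thesis by (simp add: dist_norm norm_blinfun_bound)
  qed
  then show "\<exists>d>0. \<forall>v\<in>unitaries UNIV. dist v u < d \<longrightarrow> dist (inv_blinfun v) (inv_blinfun u) < e"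
    using e by (meson le_less_trans)
qed

lemma inv_blinfun_eqI:
  "S o\<^sub>L T = id_blinfun \<Longrightarrow> T o\<^sub>L S = id_blinfun \<Longrightarrow> inv_blinfun T = S"
  unfolding inv_blinfun_def
  by (metis (no_types, lifting) blinfun_apply_blinfun_compose blinfun_apply_id_blinfun
      blinfun_apply_inverse inv_equality)

section \<open>Skew-adjoint operators, their resolvents and Cayley paths\<close>

definition skew :: "('a::chilbert_space \<Rightarrow>\<^sub>L 'a) \<Rightarrow> bool" where
  "skew Y \<longleftrightarrow> cblin Y \<and> (\<forall>x y. cinner (Y x) y = - cinner x (Y y))"

lemma skew_Re:
  assumes "skew Y"
  shows "Re (cinner x (Y x)) = 0"
proof -
  have "Re (cinner (Y x) x) = - Re (cinner x (Y x))" using assms by (simp add: skew_def)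
  moreover have "Re (cinner (Y x) x) = Re (cinner x (Y x))" using cinner_commute[of x "Y x"] by simp
  ultimately show ?thesis by simp
qed

lemma skew_norm: "skew Y \<Longrightarrow> (norm (x + t *\<^sub>R Y x))\<^sup>2 = (norm x)\<^sup>2 + (norm (t *\<^sub>R Y x))\<^sup>2"
  by (simp add: norm_plus_sq cinner_scaleR_right skew_Re)

lemma skew_norm_ge: "skew Y \<Longrightarrow> norm x \<le> norm (x + t *\<^sub>R Y x)"
  by (rule power2_le_imp_le) (simp_all add: skew_norm)

text \<open>By Pythagoras 1 - t Y is bounded below by 1, and so is its adjoint 1 + t Y, which is
  therefore injective. The bound 1 / 1 has the shape of the one in
  \<open>bounded_below_inverse\<close>.\<close>

lemma skew_resolvent:
  assumes Y: "skew Y"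
  shows "\<exists>R. cblin R \<and> R o\<^sub>L (id_blinfun - t *\<^sub>R Y) = id_blinfun \<and>
    (id_blinfun - t *\<^sub>R Y) o\<^sub>L R = id_blinfun \<and> norm R \<le> 1 / 1"
proof (rule bounded_below_inverse)
  have *: "(id_blinfun - t *\<^sub>R Y) x = x + (- t) *\<^sub>R Y x" for x
    by (simp add: blinfun.diff_left blinfun.scaleR_left)
  show "cblin (id_blinfun - t *\<^sub>R Y)" using Y by (simp add: skew_def cblin_intros)
  show "1 * norm x \<le> norm ((id_blinfun - t *\<^sub>R Y) x)" for x
    unfolding * using skew_norm_ge[OF Y, of x "-t"] by simp
  show "z = 0" if "\<And>x. cinner ((id_blinfun - t *\<^sub>R Y) x) z = 0" for z
  proof -
    have "cinner x (z + t *\<^sub>R Y z) = 0" for x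
      using that[of x] Y by (simp add: * cinner_simps skew_def)
    then have "z + t *\<^sub>R Y z = 0" by (metis cinner_self_eq_0)
    then show "z = 0" using skew_norm_ge[OF Y, of z t] by simp
  qed
qed simp

definition resolvent :: "('a::chilbert_space \<Rightarrow>\<^sub>L 'a) \<Rightarrow> real \<Rightarrow> 'a \<Rightarrow>\<^sub>L 'a" where
  "resolvent Y t = inv_blinfun (id_blinfun - t *\<^sub>R Y)"

lemma resolvent:
  assumes "skew Y"
  shows cblin_resolvent: "cblin (resolvent Y t)"
    and resolvent_left: "resolvent Y t (x - t *\<^sub>R Y x) = x"
    and resolvent_right: "resolvent Y t x - t *\<^sub>R Y (resolvent Y t x) = x"
    and norm_resolvent: "norm (resolvent Y t) \<le> 1"
proof -
  obtain R where R: "cblin R" "R o\<^sub>L (id_blinfun - t *\<^sub>R Y) = id_blinfun"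
    "(id_blinfun - t *\<^sub>R Y) o\<^sub>L R = id_blinfun" "norm R \<le> 1"
    using skew_resolvent[OF assms] by auto
  have eq: "resolvent Y t = R" unfolding resolvent_def by (rule inv_blinfun_eqI) (rule R)+
  show "cblin (resolvent Y t)" "norm (resolvent Y t) \<le> 1" using R eq by simp_all
  show "resolvent Y t (x - t *\<^sub>R Y x) = x"
    using arg_cong[OF R(2), of "\<lambda>u. blinfun_apply u x"]
    by (simp add: eq blinfun.diff_left blinfun.scaleR_left)
  show "resolvent Y t x - t *\<^sub>R Y (resolvent Y t x) = x"
    using arg_cong[OF R(3), of "\<lambda>u. blinfun_apply u x"]
    by (simp add: eq blinfun.diff_left blinfun.scaleR_left)
qed

lemma resolvent_commute:
  assumes Y: "skew Y"
  shows "resolvent Y t (Y x) = Y (resolvent Y t x)"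
proof -
  have "Y x = Y (resolvent Y t x) - t *\<^sub>R Y (Y (resolvent Y t x))"
    by (subst resolvent_right[OF Y, of t x, symmetric])
      (simp add: blinfun.diff_right blinfun.scaleR_right)
  then show ?thesis using resolvent_left[OF Y] by metis
qed

text \<open>The resolvent identity R(s) - R(t) = (s - t) R(s) Y R(t), with both resolvents of norm
  at most 1, makes \<open>norm Y\<close> a Lipschitz constant.\<close>

lemma continuous_on_resolvent:
  assumes Y: "skew Y"
  shows "continuous_on UNIV (resolvent Y)"
proof (rule continuous_on_iff[THEN iffD2], intro ballI allI impI)
  fix t e :: real assume e: "e > 0"
  have bound: "dist (resolvent Y s) (resolvent Y t) \<le> dist s t * norm Y" for s
  proof -
    have "norm ((resolvent Y s - resolvent Y t) x) \<le> (\<bar>s - t\<bar> * norm Y) * norm x" for x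
    proof -
      define y where "y = resolvent Y t x"
      have x: "x = y - t *\<^sub>R Y y" using resolvent_right[OF Y, of t x] by (simp add: y_def)
      then have "x = (y - s *\<^sub>R Y y) + (s - t) *\<^sub>R Y y" by (simp add: algebra_simps)
      then have "resolvent Y s x = y + (s - t) *\<^sub>R resolvent Y s (Y y)"
        by (simp only: blinfun.add_right resolvent_left[OF Y] blinfun.scaleR_right)
      then have "(resolvent Y s - resolvent Y t) x = (s - t) *\<^sub>R resolvent Y s (Y y)"
        by (simp add: blinfun.diff_left y_def)
      moreover have "norm (resolvent Y s (Y y)) \<le> 1 * (norm Y * (1 * norm x))"
      proof -
        have "norm y \<le> 1 * norm x"
          unfolding y_def
            by (rule order_trans[OF norm_blinfun mult_right_mono[OF norm_resolvent[OF Y]]]) simp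
        then have "norm (Y y) \<le> norm Y * (1 * norm x)"
          by (rule order_trans[OF norm_blinfun mult_left_mono]) simp
        moreover have "norm (resolvent Y s (Y y)) \<le> 1 * norm (Y y)"
          by (rule order_trans[OF norm_blinfun mult_right_mono[OF norm_resolvent[OF Y]]]) simp
        ultimately show ?thesis by simp
      qed
      ultimately show ?thesis
        by (simp add: mult.assoc mult_left_mono)
    qed
    then show ?thesis
      by (simp add: dist_norm norm_blinfun_bound)
  qed
  show "\<exists>d>0. \<forall>s\<in>UNIV. dist s t < d \<longrightarrow> dist (resolvent Y s) (resolvent Y t) < e"
  \<comment> \<open>The added 1 covers the case that \<open>Y\<close> is zero.\<close>
  proof (intro exI[of _ "e / (norm Y + 1)"] conjI ballI impI)
    show "0 < e / (norm Y + 1)" using e by (simp add: add_nonneg_pos)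
    fix s assume "dist s t < e / (norm Y + 1)"
    then have "dist s t * (norm Y + 1) < e" by (simp add: pos_less_divide_eq add_nonneg_pos)
    moreover have "dist s t * norm Y \<le> dist s t * (norm Y + 1)" by (rule mult_left_mono) auto
    ultimately show "dist (resolvent Y s) (resolvent Y t) < e" using bound[of s] by linarith
  qed
qed

definition cayley_path :: "('a::chilbert_space \<Rightarrow>\<^sub>L 'a) \<Rightarrow> real \<Rightarrow> 'a \<Rightarrow>\<^sub>L 'a" where
  "cayley_path Y t = (id_blinfun + t *\<^sub>R Y) o\<^sub>L resolvent Y t"

lemma cayley_path_0: "skew Y \<Longrightarrow> cayley_path Y 0 = id_blinfun"
  using resolvent_right[of Y 0] by (auto intro!: blinfun_eqI simp: cayley_path_def)

lemma cayley_path_apply: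
  "skew Y \<Longrightarrow> cayley_path Y t (x - t *\<^sub>R Y x) = x + t *\<^sub>R Y x"
  by (simp add: cayley_path_def resolvent_left blinfun.add_left blinfun.scaleR_left)

lemma continuous_on_cayley_path: "skew Y \<Longrightarrow> continuous_on UNIV (cayley_path Y)"
  unfolding cayley_path_def
  by (intro bounded_bilinear.continuous_on[OF bounded_bilinear_blinfun_compose]
      continuous_intros continuous_on_resolvent)

lemma cayley_path_unitary:
  assumes Y: "skew Y"
  shows "cayley_path Y t \<in> unitaries UNIV"
proof -
  have ex: "\<exists>y. x = y + t *\<^sub>R Y y" for x t
    using resolvent_right[OF Y, of "-t" x] by (metis diff_minus_eq_add scaleR_minus_left)
  have "norm (cayley_path Y t x) = norm x" for x
  proof -
    obtain y where x: "x = y - t *\<^sub>R Y y" using ex[of x "-t"] by auto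
    have "(norm (y + t *\<^sub>R Y y))\<^sup>2 = (norm (y - t *\<^sub>R Y y))\<^sup>2"
      using skew_norm[OF Y, of y t] skew_norm[OF Y, of y "-t"] by simp
    then show ?thesis by (simp add: x cayley_path_apply[OF Y])
  qed
  moreover have "x \<in> range (cayley_path Y t)" for x
    using ex[of x t] cayley_path_apply[OF Y] by (metis rangeI)
  moreover have "cblin (cayley_path Y t)"
    using Y by (simp add: cayley_path_def skew_def cblin_intros cblin_resolvent[OF Y])
  ultimately show ?thesis by (auto simp: unitaries_UNIV)
qed

text \<open>1 - 2 (w + 1)^-1 equals (w - 1) (w + 1)^-1, the inverse Cayley transform of
  \<open>w\<close>. Skewness is checked on vectors w a + a and w b + b, which exhaust the
  space.\<close>

lemma cayley_path_1:
  assumes w: "w \<in> unitaries UNIV" and G: "cblin G"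
    "G o\<^sub>L (w + id_blinfun) = id_blinfun" "(w + id_blinfun) o\<^sub>L G = id_blinfun"
  defines "Y \<equiv> id_blinfun - 2 *\<^sub>R G"
  shows "skew Y" "cayley_path Y 1 = w"
proof -
  have G1: "G (w x + x) = x" and G2: "w (G x) + G x = x" for x
    using arg_cong[OF G(2), of "\<lambda>u. blinfun_apply u x"] arg_cong[OF G(3), of
        "\<lambda>u. blinfun_apply u x"]
    by (simp_all add: blinfun.add_left)
  have Y: "Y (w x + x) = w x - x" for x
    by (simp add: Y_def blinfun.diff_left blinfun.add_left G1 scaleR_2)
  show sk: "skew Y"
    unfolding skew_def
  proof (intro conjI allI)
    show "cblin Y" using G by (simp add: Y_def cblin_intros)
    fix x y
    define a b where "a = G x" and "b = G y"
    have x: "x = w a + a" and y: "y = w b + b" using G2 by (simp_all add: a_def b_def)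
    show "cinner (Y x) y = - cinner x (Y y)"
      unfolding x y Y by (simp add: cinner_simps unitary_cinner[OF w])
  qed
  have "cayley_path Y 1 x = w x" for x
  proof -
    have "Y (G x + w (G x)) = w (G x) - G x" using Y[of "G x"] by (simp add: add.commute)
    then have *: "Y (w x + x) = w x - x" using Y by simp
    have "(w x + x) - 1 *\<^sub>R Y (w x + x) = 2 *\<^sub>R x" "(w x + x) + 1 *\<^sub>R Y (w x + x) = 2 *\<^sub>R w x"
      by (simp_all add: * scaleR_2)
    then have "cayley_path Y 1 (2 *\<^sub>R x) = 2 *\<^sub>R w x"
      using cayley_path_apply[OF sk, of 1 "w x + x"] by simp
    then show ?thesis by (simp add: blinfun.scaleR_right)
  qed
  then show "cayley_path Y 1 = w" by (rule blinfun_eqI)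
qed

text \<open>A vector z orthogonal to the range of w + 1 satisfies Re <w z, z> = - |z|^2, the case of
  equality in the Cauchy-Schwarz inequality; hence w z = - z, and the lower bound forces z =
  0.\<close>

lemma unitary_plus_one_inverse:
  assumes w: "w \<in> unitaries UNIV" and e: "e > 0" and bb: "\<And>x. e * norm x \<le> norm (w x + x)"
  shows "\<exists>G. cblin G \<and> G o\<^sub>L (w + id_blinfun) = id_blinfun \<and> (w + id_blinfun) o\<^sub>L G = id_blinfun"
proof -
  have "\<exists>G. cblin G \<and> G o\<^sub>L (w + id_blinfun) = id_blinfun \<and> (w + id_blinfun) o\<^sub>L G = id_blinfun \<and>
    norm G \<le> 1 / e"
  proof (rule bounded_below_inverse[OF _ e])
    show "cblin (w + id_blinfun)" using w by (simp add: unitary_cblin cblin_intros)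
    show "e * norm x \<le> norm ((w + id_blinfun) x)" for x
      using bb by (simp add: blinfun.add_left)
    show "z = 0" if "\<And>x. cinner ((w + id_blinfun) x) z = 0" for z
    proof -
      have "cinner (w z + z) z = 0" using that[of z] by (simp add: blinfun.add_left)
      then have "Re (cinner (w z) z) = - (norm z)\<^sup>2"
        by (simp add: cinner_add_left cinner_self complex_eq_iff)
      then have "(norm (w z + z))\<^sup>2 = 0" by (simp add: norm_plus_sq unitary_norm[OF w])
      then have "e * norm z \<le> 0" using bb[of z] by simp
      then show "z = 0" using e by (simp add: mult_le_0_iff)
    qed
  qed
  then show ?thesis by blast
qed



section \<open>Square roots of positive operators by iteration\<close>

definition hermitian :: "('a::chilbert_space \<Rightarrow>\<^sub>L 'a) \<Rightarrow> bool" where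
  "hermitian S \<longleftrightarrow> cblin S \<and> (\<forall>x y. cinner (S x) y = cinner x (S y))"

lemma blinfun_compose_simps:
  "(a + b) o\<^sub>L c = (a o\<^sub>L c) + (b o\<^sub>L c)" "a o\<^sub>L (b + c) = (a o\<^sub>L b) + (a o\<^sub>L c)"
  "(a - b) o\<^sub>L c = (a o\<^sub>L c) - (b o\<^sub>L c)" "a o\<^sub>L (b - c) = (a o\<^sub>L b) - (a o\<^sub>L c)"
  "(r *\<^sub>R a) o\<^sub>L c = r *\<^sub>R (a o\<^sub>L c)" "a o\<^sub>L (r *\<^sub>R c) = r *\<^sub>R (a o\<^sub>L c)"
  "id_blinfun o\<^sub>L c = c" "c o\<^sub>L id_blinfun = c" "(a o\<^sub>L b) o\<^sub>L c = a o\<^sub>L (b o\<^sub>L c)"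
  by (rule blinfun_eqI; simp add: blinfun.bilinear_simps)+

text \<open>This iteration converges to $1 - \sqrt{1 - X}$. Its increments are dominated by those of the
  scalar iteration for $X = 1$, which gives convergence in norm.\<close>

primrec sqrt_iter :: "('a::real_normed_vector \<Rightarrow>\<^sub>L 'a) \<Rightarrow> nat \<Rightarrow> ('a \<Rightarrow>\<^sub>L 'a)" where
  "sqrt_iter X 0 = 0"
| "sqrt_iter X (Suc n) = (1/2) *\<^sub>R (X + (sqrt_iter X n o\<^sub>L sqrt_iter X n))"

primrec sqrt_iter_bound :: "nat \<Rightarrow> real" where
  "sqrt_iter_bound 0 = 0"
| "sqrt_iter_bound (Suc n) = (1 + (sqrt_iter_bound n)\<^sup>2) / 2"

lemma sqrt_iter_bound_01: "0 \<le> sqrt_iter_bound n" "sqrt_iter_bound n \<le> 1"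
proof -
  have "0 \<le> sqrt_iter_bound n \<and> sqrt_iter_bound n \<le> 1"
    by (induction n) (auto simp: power_le_one)
  then show "0 \<le> sqrt_iter_bound n" "sqrt_iter_bound n \<le> 1" by auto
qed

lemma sqrt_iter_bound_mono: "incseq sqrt_iter_bound"
proof (rule incseq_SucI)
  fix n
  have "0 \<le> (1 - sqrt_iter_bound n)\<^sup>2" by simp
  then show "sqrt_iter_bound n \<le> sqrt_iter_bound (Suc n)" by (simp add: power2_diff)
qed

text \<open>The iterates are polynomials in \<open>X\<close>. This serves twice: to factor
  differences of squares of iterates, and to pass commutation with \<open>X\<close> on to the
  limit.\<close>

lemma sqrt_iter_commute:
  "T o\<^sub>L X = X o\<^sub>L T \<Longrightarrow> T o\<^sub>L sqrt_iter X n = sqrt_iter X n o\<^sub>L T"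
proof (induction n)
  case (Suc n)
  then have "T o\<^sub>L (sqrt_iter X n o\<^sub>L sqrt_iter X n) = sqrt_iter X n o\<^sub>L (sqrt_iter X n o\<^sub>L T)"
    by (metis blinfun_compose_simps(9))
  then show ?case using Suc.prems by (simp add: blinfun_compose_simps)
qed (simp add: blinfun_eqI)

lemma norm_sqrt_iter:
  assumes "norm X \<le> 1"
  shows "norm (sqrt_iter X n) \<le> sqrt_iter_bound n"
proof (induction n)
  case (Suc n)
  have "norm (X + (sqrt_iter X n o\<^sub>L sqrt_iter X n)) \<le> 1 + sqrt_iter_bound n * sqrt_iter_bound n"
    by (intro norm_triangle_le add_mono assms order_trans[OF norm_blinfun_compose] mult_mono Suc
        sqrt_iter_bound_01) simp
  then show ?case by (simp add: power2_eq_square)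
qed simp

lemma sqrt_iter_increment:
  assumes "norm X \<le> 1"
  shows "norm (sqrt_iter X (Suc n) - sqrt_iter X n) \<le> sqrt_iter_bound (Suc n) - sqrt_iter_bound n"
proof (induction n)
  case 0
  show ?case using assms by simp
next
  case (Suc n)
  let ?a = "sqrt_iter X n" and ?b = "sqrt_iter X (Suc n)"
  let ?r = "sqrt_iter_bound n" and ?s = "sqrt_iter_bound (Suc n)"
  have comm: "?a o\<^sub>L ?b = ?b o\<^sub>L ?a"
    by (intro sqrt_iter_commute) (simp add: sqrt_iter_commute)
  \<comment> \<open>Difference of squares, valid because the two iterates commute. The scalar
    iteration obeys the same identity, so the bounds match.\<close>
  have "sqrt_iter X (Suc (Suc n)) - ?b = (1/2) *\<^sub>R ((?b + ?a) o\<^sub>L (?b - ?a))"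
    by (simp only: blinfun_compose_simps comm) (simp add: algebra_simps)
  also have "norm \<dots> \<le> (1/2) * ((?s + ?r) * (?s - ?r))"
    using Suc
      by (auto intro!: order_trans[OF norm_blinfun_compose] mult_mono norm_triangle_le add_mono
        norm_sqrt_iter[OF assms] add_nonneg_nonneg sqrt_iter_bound_01 simp del: sqrt_iter.simps
            sqrt_iter_bound.simps)
  also have "\<dots> = sqrt_iter_bound (Suc (Suc n)) - ?s"
    by (simp add: power2_eq_square field_simps)
  finally show ?case .
qed

lemma sqrt_iter_convergent:
  fixes X :: "'a::banach \<Rightarrow>\<^sub>L 'a"
  assumes X: "norm X \<le> 1"
  shows "convergent (sqrt_iter X)"
proof -
  have le: "norm (sqrt_iter X (n + k) - sqrt_iter X n)
      \<le> sqrt_iter_bound (n + k) - sqrt_iter_bound n" for n k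
  proof (induction k)
    case (Suc k)
    then show ?case
      using sqrt_iter_increment[OF X, of "n + k"]
        norm_triangle_ineq[of "sqrt_iter X (Suc (n + k)) - sqrt_iter X (n + k)"
            "sqrt_iter X (n + k) - sqrt_iter X n"]
      by (simp del: sqrt_iter.simps sqrt_iter_bound.simps)
  qed simp
  have "convergent sqrt_iter_bound"
    by (rule Bseq_mono_convergent)
      (use sqrt_iter_bound_01 sqrt_iter_bound_mono in
          \<open>auto intro!: BseqI'[of _ 1] simp: abs_of_nonneg incseq_def\<close>)
  then have C: "Cauchy sqrt_iter_bound" by (rule convergent_Cauchy)
  have "Cauchy (sqrt_iter X)"
  proof (rule metric_CauchyI)
    fix e :: real assume "e > 0"
    then obtain M where M: "\<And>m n. m \<ge> M \<Longrightarrow> n \<ge> M \<Longrightarrow> dist (sqrt_iter_bound m) (sqrt_iter_bound n) < e"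
      using metric_CauchyD[OF C] by blast
    have *: "dist (sqrt_iter X m) (sqrt_iter X n) < e" if "n \<le> m" "m \<ge> M" "n \<ge> M" for m n
    proof -
      have "dist (sqrt_iter X m) (sqrt_iter X n) \<le> sqrt_iter_bound m - sqrt_iter_bound n"
        using le[of n "m - n"] that by (simp add: dist_norm)
      also have "\<dots> < e" using M[OF that(2,3)] by (simp add: dist_real_def)
      finally show ?thesis .
    qed
    have "dist (sqrt_iter X m) (sqrt_iter X n) < e" if "m \<ge> M" "n \<ge> M" for m n
      using *[of n m] *[of m n] that by (cases "n \<le> m") (auto simp: dist_commute)
    then show "\<exists>M. \<forall>m\<ge>M. \<forall>n\<ge>M. dist (sqrt_iter X m) (sqrt_iter X n) < e" by blast
  qed
  then show ?thesis by (rule Cauchy_convergent)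
qed

text \<open>\<open>D\<close> is the absolute value of \<open>S\<close>: the limit L of the iteration
  for X = 1 - S^2 satisfies 2 L = X + L^2, that is (1 - L)^2 = S^2. Positivity of 1 - L comes from
  |L| \<le> 1, and the last clause from L being a limit of polynomials in S^2.\<close>

lemma hermitian_sqrt:
  fixes S :: "'a::chilbert_space \<Rightarrow>\<^sub>L 'a"
  assumes S: "hermitian S" and X: "norm (id_blinfun - (S o\<^sub>L S)) \<le> 1"
  shows "\<exists>D. hermitian D \<and> D o\<^sub>L D = S o\<^sub>L S \<and> (\<forall>x. 0 \<le> Re (cinner (D x) x)) \<and>
    (\<forall>T. T o\<^sub>L S = S o\<^sub>L T \<longrightarrow> T o\<^sub>L D = D o\<^sub>L T)"
proof -
  define X where "X = id_blinfun - (S o\<^sub>L S)"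
  have X1: "norm X \<le> 1" using X by (simp add: X_def)
  obtain L where L: "sqrt_iter X \<longlonglongrightarrow> L"
    using sqrt_iter_convergent[OF X1] by (auto simp: convergent_def)
  note tc = bounded_bilinear.tendsto[OF bounded_bilinear_blinfun_compose]
  have "(\<lambda>n. (1/2) *\<^sub>R (X + (sqrt_iter X n o\<^sub>L sqrt_iter X n))) \<longlonglongrightarrow> (1/2) *\<^sub>R (X + (L o\<^sub>L L))"
    by (intro tendsto_intros tc L)
  moreover have "(\<lambda>n. sqrt_iter X (Suc n)) \<longlonglongrightarrow> L" using L by (rule LIMSEQ_Suc)
  ultimately have L_eq: "L = (1/2) *\<^sub>R (X + (L o\<^sub>L L))" using LIMSEQ_unique by simp
  have "norm L \<le> 1"
    by (rule LIMSEQ_le_const2[OF tendsto_norm[OF L]])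
      (use norm_sqrt_iter[OF X1] sqrt_iter_bound_01 order_trans in blast)
  have hX: "hermitian X" using S
    by (simp add: X_def hermitian_def cblin_intros blinfun.diff_left cinner_simps)
  have hn: "hermitian (sqrt_iter X n)" for n
    by (induction n) (use hX in
        \<open>simp_all add: hermitian_def cblin_intros blinfun.bilinear_simps cinner_simps\<close>)
  have ap: "(\<lambda>n. sqrt_iter X n x) \<longlonglongrightarrow> L x" for x
    by (intro bounded_bilinear.tendsto[OF bounded_bilinear_blinfun_apply] L tendsto_const)
  have "hermitian L"
    unfolding hermitian_def cblin_def
  proof (intro conjI allI)
    fix c x
    have "(\<lambda>n. sqrt_iter X n (c *\<^sub>C x)) \<longlonglongrightarrow> c *\<^sub>C L x"
      using bounded_linear.tendsto[OF bounded_linear_scaleC ap] hn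
      by (simp add: hermitian_def cblinD)
    then show "L (c *\<^sub>C x) = c *\<^sub>C L x" using LIMSEQ_unique ap by blast
  next
    fix x y
    have 1: "(\<lambda>n. cinner (sqrt_iter X n u) v) \<longlonglongrightarrow> cinner (L u) v" for u v
      by (rule bounded_linear.tendsto[OF bounded_linear_cinner_left ap])
    have "(\<lambda>n. cnj (cinner (sqrt_iter X n y) x)) \<longlonglongrightarrow> cnj (cinner (L y) x)"
      by (intro tendsto_intros 1)
    moreover have "cnj (cinner (sqrt_iter X n y) x) = cinner (sqrt_iter X n x) y" for n
      using hn[of n] cinner_commute by (metis hermitian_def)
    ultimately have "cnj (cinner (L y) x) = cinner (L x) y"
      using LIMSEQ_unique[OF 1[of x y]] by simp
    then show "cinner (L x) y = cinner x (L y)" using cinner_commute[of x "L y"] by simp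
  qed
  have LL: "L o\<^sub>L L = 2 *\<^sub>R L - X"
  proof -
    have "2 *\<^sub>R L = X + (L o\<^sub>L L)" by (subst L_eq) simp
    then show ?thesis by simp
  qed
  define D where "D = id_blinfun - L"
  have "D o\<^sub>L D = S o\<^sub>L S"
    by (simp add: D_def blinfun_compose_simps LL) (simp add: X_def scaleR_2)
  moreover have "hermitian D"
    using \<open>hermitian L\<close>
      by (simp add: D_def hermitian_def cblin_intros blinfun.diff_left cinner_simps)
  moreover have "0 \<le> Re (cinner (D x) x)" for x
  proof -
    have "Re (cinner (L x) x) \<le> norm (L x) * norm x"
      using complex_Re_le_cmod norm_cinner_le order_trans by blast
    also have "norm (L x) \<le> 1 * norm x"
      using norm_blinfun[of L x] \<open>norm L \<le> 1\<close> mult_right_mono[of "norm L" 1 "norm x"] by simp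
    finally show ?thesis
      by (simp add: D_def blinfun.diff_left cinner_diff_left cinner_self power2_eq_square
          mult_right_mono)
  qed
  moreover have "T o\<^sub>L D = D o\<^sub>L T" if T: "T o\<^sub>L S = S o\<^sub>L T" for T
  proof -
    have "T o\<^sub>L (S o\<^sub>L S) = (S o\<^sub>L S) o\<^sub>L T"
      using T by (metis blinfun_compose_simps(9))
    then have "T o\<^sub>L sqrt_iter X n = sqrt_iter X n o\<^sub>L T" for n
      by (intro sqrt_iter_commute) (simp add: X_def blinfun_compose_simps)
    moreover have "(\<lambda>n. T o\<^sub>L sqrt_iter X n) \<longlonglongrightarrow> (T o\<^sub>L L)"
      "(\<lambda>n. sqrt_iter X n o\<^sub>L T) \<longlonglongrightarrow> (L o\<^sub>L T)"
      by (intro tc L tendsto_const)+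
    ultimately have "T o\<^sub>L L = L o\<^sub>L T" using LIMSEQ_unique by simp
    then show ?thesis by (simp add: D_def blinfun_compose_simps)
  qed
  ultimately show ?thesis by blast
qed

section \<open>Path connectedness of the unitary group\<close>

text \<open>Multiplication by \<open>c\<close> on \<open>S\<close> and the identity on its
  complement.\<close>

definition phase :: "'a::chilbert_space set \<Rightarrow> complex \<Rightarrow> 'a \<Rightarrow>\<^sub>L 'a" where
  "phase S c = id_blinfun + (scaleC_blinfun (c - 1) o\<^sub>L orth_projection S)"

lemma phase_apply: "phase S c x = x + (c - 1) *\<^sub>C orth_projection S x"
  by (simp add: phase_def blinfun.add_left)

lemma phase_1 [simp]: "phase S 1 = id_blinfun"
  by (rule blinfun_eqI) (simp add: phase_apply)

lemma continuous_on_phase [continuous_intros]: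
  assumes "continuous_on T f"
  shows "continuous_on T (\<lambda>t. phase S (f t))"
  unfolding phase_def
  by (intro bounded_bilinear.continuous_on[OF bounded_bilinear_blinfun_compose]
      continuous_intros assms continuous_on_compose2[OF continuous_scaleC_blinfun]) auto

lemma phase_phase:
  assumes S: "csubspace S" "closed S"
  shows "phase S c (phase S d x) = phase S (c * d) x"
proof -
  let ?P = "orth_projection S"
  have "?P (x + (d - 1) *\<^sub>C ?P x) = ?P x + (d - 1) *\<^sub>C ?P x"
    by (simp add: blinfun.add_right cblinD[OF cblin_orth_projection[OF S]]
        orth_projection_id[OF S orth_projection_in[OF S]])
  then show ?thesis
    by (simp add: phase_apply scaleC_add_right scaleC_scaleC algebra_simps
        complex_vector.scale_left_diff_distrib)
qed

lemma phase_unitary: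
  assumes S: "csubspace S" "closed S" and c: "cmod c = 1"
  shows "phase S c \<in> unitaries UNIV"
  unfolding unitaries_UNIV
proof (intro conjI allI)
  let ?P = "orth_projection S"
  show "cblin (phase S c)"
    by (simp add: phase_def cblin_intros cblin_orth_projection[OF S])
  fix x
  have orth: "cinner (?P x) (x - ?P x) = 0"
    using orth_projection_in[OF S, of x] orth_projection_diff[OF S, of x]
    by (auto simp: ortho_compl_def cinner_eq_0_commute[of "?P x"])
  have "phase S c x = c *\<^sub>C ?P x + (x - ?P x)"
    by (simp add: phase_apply complex_vector.scale_left_diff_distrib)
  then have "(norm (phase S c x))\<^sup>2 = (norm (?P x))\<^sup>2 + (norm (x - ?P x))\<^sup>2"
    using norm_plus_sq_orth[of "c *\<^sub>C ?P x" "x - ?P x"] orth c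
    by (simp add: cinner_scaleC_left norm_scaleC)
  also have "\<dots> = (norm x)\<^sup>2"
    using norm_plus_sq_orth[OF orth] by simp
  finally show "norm (phase S c x) = norm x" by simp
next
  have "c \<noteq> 0" using c by auto
  then have "phase S c (phase S (inverse c) y) = y" for y
    by (simp add: phase_phase[OF S])
  then show "range (phase S c) = UNIV" by (rule surjI)
qed

text \<open>Write $g = c + i s$ with commuting hermitian $c$, $s$, and let $\sigma$ be the sign of $s$,
  obtained from the projection to the kernel of $s - |s|$. Then $v = - i \sigma g$ has nonnegative
  real part, so that $v$ is joined to $1$ by a Cayley path, and $g = i \sigma v$.\<close>

lemma unitary_path:
  fixes g :: "'a::chilbert_space \<Rightarrow>\<^sub>L 'a"
  assumes g: "g \<in> unitaries UNIV"
  shows "\<exists>p. continuous_on {0..1::real} p \<and> p ` {0..1} \<subseteq> unitaries UNIV \<and> p 0 = id_blinfun \<and> p 1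
      = g"
proof -
  define h where "h = inv_blinfun g"
  have hg: "h (g x) = x" "g (h x) = x" for x using g by (simp_all add: h_def)
  have h: "h \<in> unitaries UNIV" using g by (simp add: h_def inv_unitary_unitary)
  have cg: "g (c *\<^sub>C x) = c *\<^sub>C g x" "h (c *\<^sub>C x) = c *\<^sub>C h x" for c x
    using g h by (simp_all add: unitary_cblin cblinD)
  have adj: "cinner (g x) y = cinner x (h y)" "cinner (h x) y = cinner x (g y)" for x y
    using unitary_adjoint[OF g] unitary_adjoint'[OF g] by (simp_all add: h_def)
  \<comment> \<open>The imaginary part (g - g^-1) / 2i of \<open>g\<close>.\<close>
  define S where "S = (1/2) *\<^sub>R (scaleC_blinfun (- \<i>) o\<^sub>L (g - h))"
  have S_apply: "S x = (1/2) *\<^sub>R (- \<i>) *\<^sub>C (g x - h x)" for x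
    by (simp add: S_def blinfun.scaleR_left blinfun.diff_left)
  have "hermitian S"
    unfolding hermitian_def
  proof (intro conjI allI)
    show "cblin S" using g h by (simp add: S_def cblin_intros unitary_cblin)
    show "cinner (S x) y = cinner x (S y)" for x y
      by (simp add: S_apply cinner_simps adj algebra_simps)
  qed
  \<comment> \<open>1 - S^2 is (2 + g^2 + g^-2) / 4, a combination of isometries with total weight
    1.\<close>
  moreover have "norm (id_blinfun - (S o\<^sub>L S)) \<le> 1"
  proof (rule norm_blinfun_bound)
    fix x
    have "S (S x) = (1/4) *\<^sub>R (2 *\<^sub>R x - g (g x) - h (h x))"
      by (simp add: S_apply blinfun.diff_right blinfun.scaleR_right cg hg blinfun.minus_right
          scaleR_scaleC scaleC_scaleC complex_vector.scale_right_diff_distrib)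
        (simp add: scaleC_add_left[symmetric])
    moreover have "x - (1/4) *\<^sub>R (2 *\<^sub>R x - a - b) = (1/4) *\<^sub>R (2 *\<^sub>R x + (a + b))" for a b
    proof -
      define y where "y = (1/4) *\<^sub>R x"
      have "x = 4 *\<^sub>R y" by (simp add: y_def)
      then show ?thesis by (simp add: algebra_simps flip: scaleR_add_left)
    qed
    ultimately have "(id_blinfun - (S o\<^sub>L S)) x = (1/4) *\<^sub>R (2 *\<^sub>R x + (g (g x) + h (h x)))"
      by (simp add: blinfun.diff_left)
    also have "norm \<dots> \<le> (1/4) * (2 * norm x + (norm x + norm x))"
      by (auto intro!: norm_triangle_le add_mono simp: unitary_norm[OF g] unitary_norm[OF h])
    finally show "norm ((id_blinfun - (S o\<^sub>L S)) x) \<le> 1 * norm x" by simp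
  qed simp
  ultimately obtain D where D: "hermitian D" "D o\<^sub>L D = S o\<^sub>L S" "\<And>x. 0 \<le> Re (cinner (D x) x)"
    "\<And>T. T o\<^sub>L S = S o\<^sub>L T \<Longrightarrow> T o\<^sub>L D = D o\<^sub>L T"
    using hermitian_sqrt by blast
  have comm: "T (D x) = D (T x)" if "\<And>x. T (S x) = S (T x)" for T :: "'a \<Rightarrow>\<^sub>L 'a" and x
  proof -
    have "T o\<^sub>L S = S o\<^sub>L T" using that by (auto intro: blinfun_eqI)
    then have "T o\<^sub>L D = D o\<^sub>L T" by (rule D(4))
    then show ?thesis by (metis blinfun_apply_blinfun_compose)
  qed
  have gS: "g (S x) = S (g x)" "h (S x) = S (h x)" for x
    by (simp_all add: S_apply blinfun.diff_right blinfun.scaleR_right blinfun.minus_right cg hg)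
  have gD: "g (D x) = D (g x)" "h (D x) = D (h x)" for x
    by (rule comm, rule gS)+
  have SD: "S (D x) = D (S x)" for x by (rule comm) simp
  have DD: "D (D x) = S (S x)" for x using D(2) by (metis blinfun_apply_blinfun_compose)
  have cSD: "cblin S" "cblin D" using \<open>hermitian S\<close> D(1) by (simp_all add: hermitian_def)
  define K where "K = {x. S x = D x}"
  have K1: "csubspace K"
    by (simp add: complex_vector.subspace_def K_def blinfun.add_right cblinD[OF cSD(1)] cblinD[OF
        cSD(2)])
  have K2: "closed K"
    unfolding K_def by (intro closed_Collect_eq continuous_intros)
  let ?P = "orth_projection K"
  \<comment> \<open>If \<open>u\<close> and its adjoint \<open>v\<close> both commute with
    \<open>S\<close> and \<open>D\<close>, both preserve \<open>K\<close>, so \<open>u\<close> also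
    preserves the complement and commutes with the projection.\<close>
  have gP: "?P (u x) = u (?P x)"
    if u: "\<And>x. u (S x) = S (u x)" "\<And>x. u (D x) = D (u x)"
      and v: "\<And>x. v (S x) = S (v x)" "\<And>x. v (D x) = D (v x)"
      and uv: "\<And>x y. cinner (u x) y = cinner x (v y)" for u v :: "'a \<Rightarrow>\<^sub>L 'a" and x
  proof (rule orth_projection_eq[OF K1 K2])
    have "?P x \<in> K" by (rule orth_projection_in[OF K1 K2])
    then show "u (?P x) \<in> K" by (simp add: K_def flip: u)
    have "cinner (u (x - ?P x)) k = 0" if "k \<in> K" for k
    proof -
      have "v k \<in> K" using that by (simp add: K_def flip: v)
      then show ?thesis
        using orth_projection_diff[OF K1 K2, of x] by (simp add: uv ortho_compl_def)
    qed
    then show "u x - u (?P x) \<in> ortho_compl K"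
      by (simp add: ortho_compl_def blinfun.diff_right)
  qed
  have Pg: "?P (g x) = g (?P x)" "?P (h x) = h (?P x)" for x
    by (rule gP[of _ h], (simp_all add: gS gD adj)[5]) (rule gP[of _ g], simp_all add: gS gD adj)
  \<comment> \<open>(S - D) (S + D) = 0, so the range of S + D lies in \<open>K\<close>; a vector
    orthogonal to it is killed by the hermitian operator S + D.\<close>
  have K_perp: "S y = - D y" if "y \<in> ortho_compl K" for y
  proof -
    have "S z + D z \<in> K" for z by (simp add: K_def blinfun.add_right SD DD)
    then have "cinner (S y + D y) z = 0" for z
      using that \<open>hermitian S\<close> D(1)
      by (simp add: hermitian_def ortho_compl_def cinner_add_left flip: cinner_add_right)
    then have "S y + D y = 0" by (metis cinner_self_eq_0)
    then show ?thesis by (simp add: eq_neg_iff_add_eq_0)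
  qed
  define s where "s x = 2 *\<^sub>R ?P x - x" for x
  have sS: "s (S x) = D x" for x
  proof -
    have "?P (S x) = S (?P x)"
      by (simp add: S_apply blinfun.diff_right blinfun.scaleR_right blinfun.minus_right
          cblinD[OF cblin_orth_projection[OF K1 K2]] Pg)
    then have "s (S x) = S (?P x) - S (x - ?P x)"
      by (simp add: s_def scaleR_2 blinfun.diff_right)
    also have "\<dots> = D (?P x) + D (x - ?P x)"
      using K_perp[OF orth_projection_diff[OF K1 K2, of x]] orth_projection_in[OF K1 K2, of x]
      by (simp add: K_def)
    finally show ?thesis by (simp add: blinfun.diff_right)
  qed
  define v where "v = scaleC_blinfun \<i> o\<^sub>L (phase K (-1) o\<^sub>L g)"
  have v: "v \<in> unitaries UNIV"
    unfolding v_def by (intro unitaries_compose unitaries_scaleC phase_unitary K1 K2 g) auto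
  have phase_s: "phase K (-1) x = - s x" for x
    by (simp add: phase_apply s_def scaleR_scaleC)
  have s_adj: "cinner (s x) y = cinner x (s y)" for x y
    by (simp add: s_def cinner_simps orth_projection_sym[OF K1 K2])
  have s_lin: "s (x - y) = s x - s y" "s (c *\<^sub>C x) = c *\<^sub>C s x" "s (r *\<^sub>R x) = r *\<^sub>R s x" for x y c r
    by (simp_all add: s_def blinfun.diff_right blinfun.scaleR_right algebra_simps
        cblinD[OF cblin_orth_projection[OF K1 K2]] complex_vector.scale_right_diff_distrib
        scaleR_scaleC_commute)
  have s_h: "s (h x) = h (s x)" for x
    by (simp add: s_def Pg blinfun.diff_right blinfun.scaleR_right)
  \<comment> \<open>\<open>v\<close> plus its adjoint is - i s (g - g^-1) = 2 s S = 2 D.\<close>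
  have v_Re: "0 \<le> Re (cinner (v x) x)" for x
  proof -
    have vx: "v x = (- \<i>) *\<^sub>C s (g x)"
      by (simp add: v_def phase_s)
    have "cinner x (v x) = \<i> * cinner x (s (g x))"
      by (simp add: vx cinner_scaleC_right cinner_minus_right)
    also have "cinner x (s (g x)) = cinner (s (h x)) x"
      using adj(2)[of "s x" x] s_adj[of x "g x"] by (simp add: s_h)
    finally have "cinner (v x) x + cinner x (v x) = cinner (s ((- \<i>) *\<^sub>C (g x - h x))) x"
      by (simp add: vx s_lin cinner_simps algebra_simps)
    also have "(- \<i>) *\<^sub>C (g x - h x) = 2 *\<^sub>R S x" by (simp add: S_apply)
    also have "cinner (s (2 *\<^sub>R S x)) x = 2 * cinner (D x) x"
      by (simp only: s_lin sS) (simp add: cinner_simps)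
    finally have "Re (cinner (v x) x) + Re (cinner x (v x)) = 2 * Re (cinner (D x) x)"
      by (metis plus_complex.simps(1) mult_2)
    moreover have "Re (cinner x (v x)) = Re (cinner (v x) x)" using cinner_commute[of x "v x"]
      by simp
    ultimately show ?thesis using D(3)[of x] by simp
  qed
  have "1 * norm x \<le> norm (v x + x)" for x
  proof -
    have "(norm x)\<^sup>2 \<le> (norm (v x + x))\<^sup>2"
      unfolding norm_plus_sq unitary_norm[OF v] using v_Re[of x] by simp
    then show ?thesis by (simp add: power2_le_iff_abs_le)
  qed
  then obtain G
    where G: "cblin G" "G o\<^sub>L (v + id_blinfun) = id_blinfun" "(v + id_blinfun) o\<^sub>L G = id_blinfun"
    using unitary_plus_one_inverse[OF v, of 1] by auto
  define Y where "Y = id_blinfun - 2 *\<^sub>R G"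
  have Y: "skew Y" "cayley_path Y 1 = v" using cayley_path_1[OF v G] by (simp_all add: Y_def)
  \<comment> \<open>At t = 1 the scalar is -i and the phase is the reflection: the inverses of the
    two factors in front of \<open>g\<close> in \<open>v\<close>.\<close>
  define p where "p t
      = scaleC_blinfun (cis (- pi * t / 2)) o\<^sub>L (phase K (cis (pi * t)) o\<^sub>L cayley_path Y t)" for t
  have "continuous_on {0..1} p"
    unfolding p_def
    by (intro bounded_bilinear.continuous_on[OF bounded_bilinear_blinfun_compose] continuous_intros
        continuous_on_compose2[OF continuous_scaleC_blinfun]
        continuous_on_subset[OF continuous_on_cayley_path[OF Y(1)]]) auto
  moreover have "p t \<in> unitaries UNIV" for t
    unfolding p_def
      by (intro unitaries_compose unitaries_scaleC phase_unitary K1 K2 cayley_path_unitary Y) auto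
  moreover have "p 0 = id_blinfun"
    by (rule blinfun_eqI) (simp add: p_def cayley_path_0[OF Y(1)])
  moreover have "p 1 = g"
  proof (rule blinfun_eqI)
    fix x
    have "cis (- (pi / 2)) = - \<i>" by (simp add: complex_eq_iff)
    then show "p 1 x = g x"
      using phase_phase[OF K1 K2, of "-1" "-1" "g x"]
      by (simp add: p_def Y(2) v_def cblinD[OF unitary_cblin[OF phase_unitary[OF K1 K2]]]
          scaleC_scaleC)
  qed
  ultimately show ?thesis by blast
qed

section \<open>Fredholm operators\<close>

definition fredholm_map :: "('a::chilbert_space \<Rightarrow> 'b::chilbert_space) \<Rightarrow> bool" where
  "fredholm_map f \<longleftrightarrow> closed (range f) \<and> finite_dim {x. f x = 0} \<and> finite_codim_in UNIV (range f)"

lemma unitaries_F_UNIV: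
  "u \<in> unitaries_F UNIV \<longleftrightarrow> u \<in> unitaries UNIV \<and> fredholm_map (\<lambda>x. u x + x)"
proof -
  have "Range {(x, u x + x) |x. x \<in> UNIV} = range (\<lambda>x. u x + x)" by auto
  moreover have "op_ker {(x, u x + x) |x. x \<in> UNIV} = {x. u x + x = 0}" by (auto simp: op_ker_def)
  ultimately show ?thesis by (simp add: unitaries_F_def fredholm_in_def fredholm_map_def)
qed

lemma cblin_span_image:
  assumes T: "cblin T"
  shows "T ` complex_vector.span B \<subseteq> complex_vector.span (T ` B)"
proof
  fix y assume "y \<in> T ` complex_vector.span B"
  then obtain x where x: "x \<in> complex_vector.span B" "y = T x" by blast
  have "T x \<in> complex_vector.span (T ` B)"
    using x(1)
  proof (induction rule: complex_vector.span_induct_alt)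
    case base
    show ?case by (simp add: blinfun.zero_right complex_vector.span_zero)
  next
    case (step c b z)
    then show ?case
      by (simp add: blinfun.add_right cblinD[OF T] complex_vector.span_add
          complex_vector.span_scale complex_vector.span_base)
  qed
  then show "y \<in> complex_vector.span (T ` B)" using x by simp
qed

lemma finite_dim_image: "finite_dim S \<Longrightarrow> cblin T \<Longrightarrow> finite_dim (T ` S)"
  unfolding finite_dim_def using cblin_span_image by (metis finite_imageI image_mono order_trans)

lemma finite_dim_subset: "finite_dim S \<Longrightarrow> T \<subseteq> S \<Longrightarrow> finite_dim T"
  unfolding finite_dim_def by blast

lemma finite_codim_mono: "finite_codim_in W S \<Longrightarrow> S \<subseteq> T \<Longrightarrow> finite_codim_in W T"
  unfolding finite_codim_in_def
  by (meson Un_mono complex_vector.span_mono order_refl order_trans)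

lemma finite_codim_image:
  assumes "finite_codim_in UNIV S" "cblin T" "surj (blinfun_apply T)"
  shows "finite_codim_in UNIV (T ` S)"
proof -
  obtain B where B: "finite B" "UNIV \<subseteq> complex_vector.span (S \<union> B)"
    using assms(1) by (auto simp: finite_codim_in_def)
  have "UNIV \<subseteq> T ` complex_vector.span (S \<union> B)" using B(2) assms(3) by blast
  also have "\<dots> \<subseteq> complex_vector.span (T ` S \<union> T ` B)"
    using cblin_span_image[OF assms(2), of "S \<union> B"] by (simp add: image_Un)
  finally show ?thesis using B(1) by (auto simp: finite_codim_in_def)
qed

definition ciso :: "('a::chilbert_space \<Rightarrow>\<^sub>L 'b::chilbert_space) \<Rightarrow> bool" where
  "ciso T \<longleftrightarrow> cblin T \<and> (\<exists>S. cblin S \<and> (\<forall>x. S (T x) = x) \<and> (\<forall>y. T (S y) = y))"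

lemma cisoI: "cblin T \<Longrightarrow> cblin S \<Longrightarrow> (\<And>x. S (T x) = x) \<Longrightarrow> (\<And>y. T (S y) = y) \<Longrightarrow> ciso T"
  by (auto simp: ciso_def)

lemma fredholm_map_ciso:
  assumes f: "fredholm_map f" and R: "ciso R" and S: "ciso S"
  shows "fredholm_map (\<lambda>x. R (f (S x)))"
proof -
  obtain R' where R': "cblin R" "cblin R'" "\<And>x. R' (R x) = x" "\<And>y. R (R' y) = y"
    using R by (auto simp: ciso_def)
  obtain S' where S': "cblin S" "cblin S'" "\<And>x. S' (S x) = x" "\<And>y. S (S' y) = y"
    using S by (auto simp: ciso_def)
  have ran: "range (\<lambda>x. R (f (S x))) = R ` range f"
    by (auto simp: image_iff) (metis S'(4))
  also have "\<dots> = R' -` range f" using R' by (auto simp: image_iff) metis+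
  finally have "closed (range (\<lambda>x. R (f (S x))))"
    using f by (simp add: fredholm_map_def closed_vimage[OF _ linear_continuous_on[OF
        blinfun.bounded_linear_right]])
  moreover have "{x. R (f (S x)) = 0} \<subseteq> S' ` {x. f x = 0}"
    using R' S' by (auto simp: image_iff) (metis blinfun.zero_right)
  then have "finite_dim {x. R (f (S x)) = 0}"
    using f S' finite_dim_image finite_dim_subset by (metis fredholm_map_def)
  moreover have "finite_codim_in UNIV (range (\<lambda>x. R (f (S x))))"
    unfolding ran using f R' by (auto simp: fredholm_map_def intro!: finite_codim_image surjI)
  ultimately show ?thesis by (simp add: fredholm_map_def)
qed

text \<open>With respect to the decomposition into \<^term>\<open>R\<close> and its complement, \<^term>\<open>q + id_blinfun\<close> is
  $2 \oplus (p + 1)$ and \<^term>\<open>Y o\<^sub>L (q - id_blinfun)\<close> maps the complement to \<^term>\<open>R\<close>. Hence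
  $V_t q + 1$, where $V_t = (1 + t Y) (1 - t Y)^{-1}$, differs from $q + 1$ only by an
  invertible factor on the left and a unipotent factor on the right.\<close>

lemma fredholm_cayley_path:
  fixes Y q :: "'a::chilbert_space \<Rightarrow>\<^sub>L 'a"
  assumes Y: "skew Y" and YR: "\<And>x. x \<in> ortho_compl R \<Longrightarrow> Y x \<in> R"
    and q: "q \<in> unitaries UNIV" and qR: "\<And>x. x \<in> R \<Longrightarrow> q x = x" and R: "csubspace R"
    and fred: "fredholm_map (\<lambda>x. cayley_path Y 1 (q x) + x)"
  shows "fredholm_map (\<lambda>x. cayley_path Y t (q x) + x)"
proof -
  define X where "X t = (t/2) *\<^sub>R (Y o\<^sub>L (q - id_blinfun))" for t
  have X_apply: "X t x = (t/2) *\<^sub>R Y (q x - x)" for t x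
    by (simp add: X_def blinfun.scaleR_left blinfun.diff_left)
  \<comment> \<open>\<open>q\<close> is unitary and fixes \<open>R\<close> pointwise, so q x - x is
    orthogonal to \<open>R\<close>.\<close>
  have YqR: "Y (q x - x) \<in> R" for x
  proof (rule YR)
    have "cinner (q x - x) r = 0" if "r \<in> R" for r
      using unitary_cinner[OF q, of x r] qR[OF that] by (simp add: cinner_diff_left)
    then show "q x - x \<in> ortho_compl R" by (simp add: ortho_compl_def)
  qed
  then have qX: "q (X t x) = X t x" for t x
    by (simp add: X_apply blinfun.scaleR_right qR)
  have XX: "X s (X t x) = 0" for s t x
    by (subst X_apply) (simp add: qX)
  have cX: "cblin (X t)" for t
    using Y q by (simp add: X_def cblin_intros skew_def unitary_cblin)
  have isoX: "ciso (id_blinfun + X t)" "ciso (id_blinfun - X t)" for t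
    by (rule cisoI[where S = "id_blinfun - X t"] cisoI[where S = "id_blinfun + X t"];
        simp add: cX cblin_intros blinfun.bilinear_simps XX)+
  let ?A = "\<lambda>t. id_blinfun - t *\<^sub>R Y"
  have A_apply: "?A t x = x - t *\<^sub>R Y x" for t x by (simp add: blinfun.diff_left blinfun.scaleR_left)
  have cA: "cblin (?A t)" for t using Y by (simp add: cblin_intros skew_def)
  have isoA: "ciso (?A t)" "ciso (resolvent Y t)" for t
    by (rule cisoI[where S = "?A t"] cisoI[where S = "resolvent Y t"];
        simp add: cA cblin_resolvent[OF Y] resolvent_left[OF Y] resolvent_right[OF Y] A_apply)+
  \<comment> \<open>(1 + t Y) q + (1 - t Y) = q + 1 + t Y (q - 1), and t Y (q - 1) = 2 X t = (q + 1)
    X t because \<open>q\<close> fixes the range of \<open>X t\<close>. The resolvent commutes with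
    \<open>Y\<close> and can be pulled out on the left.\<close>
  have key: "cayley_path Y t (q x) + x
      = resolvent Y t (q ((id_blinfun + X t) x) + (id_blinfun + X t) x)" for t x
  proof -
    have "cayley_path Y t (q x) = resolvent Y t (q x + t *\<^sub>R Y (q x))"
      by (simp add: cayley_path_def blinfun.bilinear_simps resolvent_commute[OF Y])
    moreover have "x = resolvent Y t (x - t *\<^sub>R Y x)" by (simp add: resolvent_left[OF Y])
    ultimately have "cayley_path Y t (q x) + x
        = resolvent Y t ((q x + t *\<^sub>R Y (q x)) + (x - t *\<^sub>R Y x))"
      by (simp only: blinfun.add_right)
    also have "(q x + t *\<^sub>R Y (q x)) + (x - t *\<^sub>R Y x) = q x + x + (X t x + X t x)"
      by (simp add: X_apply blinfun.diff_right algebra_simps flip: scaleR_add_left)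
    also have "\<dots> = q ((id_blinfun + X t) x) + (id_blinfun + X t) x"
      by (simp add: blinfun.bilinear_simps qX)
    finally show ?thesis .
  qed
  \<comment> \<open>The factorization at t = 1 is solved for q + 1, then read at arbitrary
    \<open>t\<close>.\<close>
  have "fredholm_map (\<lambda>x. q x + x)"
  proof -
    have "q x + x = ?A 1 (cayley_path Y 1 (q ((id_blinfun - X 1) x)) + (id_blinfun - X 1) x)" for x
    proof -
      have "(id_blinfun + X 1) ((id_blinfun - X 1) x) = x"
        by (simp add: blinfun.bilinear_simps XX)
      then show ?thesis unfolding key A_apply resolvent_right[OF Y] by simp
    qed
    then show ?thesis using fredholm_map_ciso[OF fred isoA(1)[of 1] isoX(2)[of 1]] by simp
  qed
  from fredholm_map_ciso[OF this isoA(2)[of t] isoX(1)[of t]] show ?thesis by (simp add: key)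
qed

text \<open>\<open>K\<close> lies in the kernel of q + 1 and is orthogonal to its range. The phase
  adds multiplication by 1 - c on \<open>K\<close>; for c different from 1 this enlarges the range
  by \<open>K\<close> and takes \<open>K\<close> out of the kernel.\<close>

lemma fredholm_phase:
  fixes q :: "'a::chilbert_space \<Rightarrow>\<^sub>L 'a"
  assumes K: "csubspace K" "closed K" and q: "q \<in> unitaries UNIV" and qK: "\<And>x. x \<in> K \<Longrightarrow> q x = - x"
    and fred: "fredholm_map (\<lambda>x. q x + x)"
  shows "fredholm_map (\<lambda>x. q (phase K c x) + x)"
proof (cases "c = 1")
  case True
  then show ?thesis using fred by simp
next
  case False
  let ?P = "orth_projection K"
  note P = orth_projection_in[OF K] cblinD[OF cblin_orth_projection[OF K]]
  have f: "q (phase K c x) + x = (q x + x) + (1 - c) *\<^sub>C ?P x" for x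
    using qK[OF P(1)[of x]]
    by (simp add: phase_apply blinfun.add_right blinfun.diff_right cblinD[OF unitary_cblin[OF q]]
        complex_vector.scale_left_diff_distrib)
  have "q x + x \<in> ortho_compl K" for x
  proof -
    have "cinner (q x + x) k = 0" if "k \<in> K" for k
      using unitary_cinner[OF q, of x k] qK[OF that]
        by (simp add: cinner_add_left cinner_minus_right eq_neg_iff_add_eq_0)
        (metis add.commute add.left_inverse minus_minus)
    then show ?thesis by (simp add: ortho_compl_def)
  qed
  then have P0: "?P (q x + x) = 0" for x by (rule orth_projection_zero[OF K])
  have PP: "?P (?P x) = ?P x" for x by (rule orth_projection_id[OF K P(1)])
  have Pf: "?P (q (phase K c x) + x) = (1 - c) *\<^sub>C ?P x" for x
    by (simp only: f blinfun.add_right[of _ "q x + x"] P0) (simp add: P PP)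
  \<comment> \<open>As a preimage under the projection off \<open>K\<close>, the range is visibly
    closed.\<close>
  have ran: "range (\<lambda>x. q (phase K c x) + x) = (\<lambda>y. y - ?P y) -` range (\<lambda>x. q x + x)"
  proof (intro equalityI subsetI)
    fix y assume "y \<in> range (\<lambda>x. q (phase K c x) + x)"
    then obtain x where y: "y = q (phase K c x) + x" by blast
    have "y - ?P y = q x + x" unfolding y Pf unfolding f by simp
    then show "y \<in> (\<lambda>y. y - ?P y) -` range (\<lambda>x. q x + x)" by simp
  next
    fix y assume "y \<in> (\<lambda>y. y - ?P y) -` range (\<lambda>x. q x + x)"
    then obtain x where y: "y - ?P y = q x + x" by auto
    \<comment> \<open>The component of \<open>x\<close> in \<open>K\<close>, invisible to q + 1, is
      replaced by the one that 1 - c carries to the component of \<open>y\<close>.\<close>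
    define z where "z = x - ?P x + inverse (1 - c) *\<^sub>C ?P y"
    have "q (phase K c z) + z = y"
    proof -
      have qP: "q (?P u) = - ?P u" for u by (rule qK[OF P(1)])
      have "q z + z = q x + x"
        by (simp add: z_def blinfun.bilinear_simps cblinD[OF unitary_cblin[OF q]] qP)
      moreover have "(1 - c) *\<^sub>C ?P z = ?P y"
        using False by (simp add: z_def blinfun.bilinear_simps P PP scaleC_scaleC)
      ultimately show ?thesis using y by (simp add: f) (metis diff_add_cancel)
    qed
    then show "y \<in> range (\<lambda>x. q (phase K c x) + x)" by (intro image_eqI[of _ _ z]) simp_all
  qed
  have "closed (range (\<lambda>x. q (phase K c x) + x))"
    unfolding ran using fred
    by (intro closed_vimage) (auto simp: fredholm_map_def intro!: continuous_intros)
  moreover have "{x. q (phase K c x) + x = 0} \<subseteq> {x. q x + x = 0}"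
  proof safe
    fix x assume x: "q (phase K c x) + x = 0"
    then have *: "(1 - c) *\<^sub>C ?P x = 0" using Pf[of x] by (metis blinfun.zero_right)
    show "q x + x = 0" using x unfolding f * by simp
  qed
  then have "finite_dim {x. q (phase K c x) + x = 0}"
    using fred finite_dim_subset by (auto simp: fredholm_map_def)
  moreover have "range (\<lambda>x. q x + x) \<subseteq> range (\<lambda>x. q (phase K c x) + x)"
    unfolding ran using P0 by auto
  then have "finite_codim_in UNIV (range (\<lambda>x. q (phase K c x) + x))"
    using fred finite_codim_mono by (auto simp: fredholm_map_def)
  ultimately show ?thesis by (simp add: fredholm_map_def)
qed

section \<open>Orthonormal bases\<close>

locale orthonormal_seq =
  fixes e :: "nat \<Rightarrow> 'a::chilbert_space"
  assumes cinner_e: "cinner (e m) (e n) = (if m = n then 1 else 0)"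
begin

lemma norm_e [simp]: "norm (e n) = 1"
  using cinner_self[of "e n"] cinner_e[of n n]
    by (metis norm_of_real of_real_eq_1_iff abs_norm_cancel
      norm_one one_power2 power2_eq_iff_nonneg norm_ge_zero zero_le_one)

lemma norm_sum_sq: "finite F \<Longrightarrow> (norm (\<Sum>n\<in>F. c n *\<^sub>C e n))\<^sup>2 = (\<Sum>n\<in>F. (cmod (c n))\<^sup>2)"
proof (induction F rule: finite_induct)
  case (insert a F)
  have "cinner (\<Sum>n\<in>G. c n *\<^sub>C e n) (e a) = 0" if "finite G" "a \<notin> G" for G
    using that by (induction G rule: finite_induct) (auto simp: cinner_simps cinner_e)
  then have "cinner (c a *\<^sub>C e a) (\<Sum>n\<in>F. c n *\<^sub>C e n) = 0"
    using insert by (simp add: cinner_scaleC_left cinner_eq_0_commute[of "e a"])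
  then show ?case
    using insert by (simp add: norm_plus_sq_orth norm_scaleC)
qed simp

lemma summable_scaleC:
  assumes "summable (\<lambda>n. (cmod (c n))\<^sup>2)"
  shows "summable (\<lambda>n. c n *\<^sub>C e n)"
  unfolding summable_Cauchy
proof (intro allI impI)
  fix r :: real assume r: "r > 0"
  obtain N where N: "\<And>m n. m \<ge> N \<Longrightarrow> norm (\<Sum>k = m..<n. (cmod (c k))\<^sup>2) < r\<^sup>2"
    using assms r unfolding summable_Cauchy by (metis zero_less_power)
  have "norm (\<Sum>k = m..<n. c k *\<^sub>C e k) < r" if "m \<ge> N" for m n
  proof (rule power_less_imp_less_base[of _ 2])
    show "(norm (\<Sum>k = m..<n. c k *\<^sub>C e k))\<^sup>2 < r\<^sup>2"
      using N[OF that, of n] by (simp add: norm_sum_sq sum_nonneg)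
  qed (use r in simp)
  then show "\<exists>N. \<forall>m\<ge>N. \<forall>n. norm (\<Sum>k = m..<n. c k *\<^sub>C e k) < r" by blast
qed

lemma norm_suminf_sq:
  assumes "summable (\<lambda>n. (cmod (c n))\<^sup>2)"
  shows "(norm (\<Sum>n. c n *\<^sub>C e n))\<^sup>2 = (\<Sum>n. (cmod (c n))\<^sup>2)"
proof -
  have "(\<lambda>N. (norm (\<Sum>n<N. c n *\<^sub>C e n))\<^sup>2) \<longlonglongrightarrow> (norm (\<Sum>n. c n *\<^sub>C e n))\<^sup>2"
    by (intro tendsto_intros summable_LIMSEQ summable_scaleC assms)
  moreover have "(\<lambda>N. (norm (\<Sum>n<N. c n *\<^sub>C e n))\<^sup>2) \<longlonglongrightarrow> (\<Sum>n. (cmod (c n))\<^sup>2)"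
    by (simp add: norm_sum_sq summable_LIMSEQ assms)
  ultimately show ?thesis by (rule LIMSEQ_unique)
qed

lemma cinner_suminf:
  assumes "summable (\<lambda>n. (cmod (c n))\<^sup>2)"
  shows "cinner (\<Sum>n. c n *\<^sub>C e n) (e m) = c m"
proof -
  have "(\<lambda>n. cinner (c n *\<^sub>C e n) (e m)) sums cinner (\<Sum>n. c n *\<^sub>C e n) (e m)"
    by (rule bounded_linear.sums[OF bounded_linear_cinner_left])
      (simp add: summable_sums summable_scaleC assms)
  moreover have "(\<lambda>n. cinner (c n *\<^sub>C e n) (e m)) = (\<lambda>n. if n = m then c n else 0)"
    by (auto simp: cinner_scaleC_left cinner_e)
  ultimately show ?thesis using sums_single[of m c] sums_unique2 by metis
qed

lemma bessel: "summable (\<lambda>n. (cmod (cinner x (e n)))\<^sup>2)"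
proof (rule bounded_imp_summable)
  fix N
  define s where "s = (\<Sum>n\<le>N. cinner x (e n) *\<^sub>C e n)"
  have "cinner s (e m) = (if m \<le> N then cinner x (e m) else 0)" for m
  proof -
    have "cinner s (e m) = (\<Sum>n\<le>N. if n = m then cinner x (e m) else 0)"
      unfolding s_def by (induction N) (auto simp: cinner_simps cinner_e)
    then show ?thesis by simp
  qed
  then have a: "cinner (x - s) (e m) = 0" if "m \<le> N" for m
    using that by (simp add: cinner_diff_left)
  have b: "cinner (x - s) (\<Sum>n\<in>F. c n *\<^sub>C e n) = 0"
    if "finite F" "\<And>m. m \<in> F \<Longrightarrow> cinner (x - s) (e m) = 0" for F c
    using that by (induction F rule: finite_induct) (simp_all add: cinner_simps)
  have "cinner (x - s) s = 0"
    using b[of "{..N}" "\<lambda>n. cinner x (e n)"] a by (simp add: s_def[symmetric])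
  then have "(norm x)\<^sup>2 = (norm (x - s))\<^sup>2 + (norm s)\<^sup>2"
    using norm_plus_sq_orth[of "x - s" s] by simp
  then show "(\<Sum>n\<le>N. (cmod (cinner x (e n)))\<^sup>2) \<le> (norm x)\<^sup>2"
    by (simp add: s_def norm_sum_sq)
qed simp

lemma suminf_in:
  assumes W: "csubspace W" "closed W" and e: "\<And>n. e n \<in> W" and "summable (\<lambda>n. (cmod (c n))\<^sup>2)"
  shows "(\<Sum>n. c n *\<^sub>C e n) \<in> W"
proof (rule closed_sequentially[OF W(2)])
  show "(\<lambda>N. \<Sum>n<N. c n *\<^sub>C e n) \<longlonglongrightarrow> (\<Sum>n. c n *\<^sub>C e n)"
    by (intro summable_LIMSEQ summable_scaleC assms)
  show "(\<Sum>n<N. c n *\<^sub>C e n) \<in> W" for N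
    by (intro complex_vector.subspace_sum complex_vector.subspace_scale W e)
qed

end

definition onb_of :: "'a::chilbert_space set \<Rightarrow> (nat \<Rightarrow> 'a) \<Rightarrow> bool" where
  "onb_of W e \<longleftrightarrow> orthonormal_seq e \<and> range e \<subseteq> W \<and> (\<forall>x\<in>W. (\<forall>n. cinner x (e n) = 0) \<longrightarrow> x = 0)"

lemma onb_expansion:
  assumes W: "csubspace W" "closed W" and e: "onb_of W e" and x: "x \<in> W"
  shows "(\<Sum>n. cinner x (e n) *\<^sub>C e n) = x"
proof -
  interpret orthonormal_seq e using e by (simp add: onb_of_def)
  define y where "y = (\<Sum>n. cinner x (e n) *\<^sub>C e n)"
  have "y \<in> W" unfolding y_def using e by (intro suminf_in W bessel) (auto simp: onb_of_def)
  then have "x - y \<in> W" using x W by (simp add: complex_vector.subspace_diff)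
  moreover have "cinner (x - y) (e m) = 0" for m
    by (simp add: cinner_diff_left y_def cinner_suminf[OF bessel])
  ultimately show ?thesis using e by (auto simp: onb_of_def y_def)
qed

lemma unitary_iso_onb:
  fixes W :: "'w::chilbert_space set" and f :: "nat \<Rightarrow> 'a::chilbert_space"
  assumes W: "csubspace W" "closed W" and e: "onb_of W e" and f: "onb_of UNIV f"
  shows "\<exists>\<Phi> :: 'w \<Rightarrow> 'a. unitary_iso W \<Phi>"
proof -
  interpret e: orthonormal_seq e using e by (simp add: onb_of_def)
  interpret f: orthonormal_seq f using f by (simp add: onb_of_def)
  define \<Phi> where "\<Phi> x = (\<Sum>n. cinner x (e n) *\<^sub>C f n)" for x
  have sums: "(\<lambda>n. cinner x (e n) *\<^sub>C f n) sums \<Phi> x" for x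
    unfolding \<Phi>_def by (rule summable_sums, rule f.summable_scaleC, rule e.bessel)
  have "\<Phi> (x + y) = \<Phi> x + \<Phi> y" for x y
    using sums_add[OF sums[of x] sums[of y]] sums[of "x + y"]
    by (simp add: cinner_add_left scaleC_add_left sums_unique2)
  moreover have "\<Phi> (c *\<^sub>C x) = c *\<^sub>C \<Phi> x" for c x
    using bounded_linear.sums[OF bounded_linear_scaleC sums[of x], of c] sums[of "c *\<^sub>C x"]
    by (simp add: cinner_scaleC_left scaleC_scaleC sums_unique2)
  moreover have "norm (\<Phi> x) = norm x" if "x \<in> W" for x
  proof -
    have "(norm (\<Phi> x))\<^sup>2 = (norm x)\<^sup>2"
      unfolding \<Phi>_def f.norm_suminf_sq[OF e.bessel]
      by (subst (2) onb_expansion[OF W e that, symmetric]) (simp add: e.norm_suminf_sq[OF e.bessel])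
    then show ?thesis by simp
  qed
  moreover have "y \<in> \<Phi> ` W" for y
  proof
    show "(\<Sum>n. cinner y (f n) *\<^sub>C e n) \<in> W"
      using e by (intro e.suminf_in W f.bessel) (auto simp: onb_of_def)
    show "y = \<Phi> (\<Sum>n. cinner y (f n) *\<^sub>C e n)"
      unfolding \<Phi>_def e.cinner_suminf[OF f.bessel]
      by (rule onb_expansion[symmetric]) (use f in auto)
  qed
  ultimately show ?thesis unfolding unitary_iso_def by blast
qed

text \<open>A maximal orthonormal subset of \<open>W\<close> is total in \<open>W\<close>. It is
  infinite since finitely many vectors do not span \<open>W\<close>, and countable since its
  elements have mutual distance sqrt 2 in a separable space.\<close>

lemma onb_exists:
  fixes W :: "'w::chilbert_space set"
  assumes sep: "separable_space (euclidean :: 'w topology)"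
    and W: "csubspace W" and inf: "\<not> finite_dim W"
  shows "\<exists>e. onb_of W e"
proof -
  define ons where "ons = {B. B \<subseteq> W \<and> (\<forall>x\<in>B. norm x = 1) \<and> (\<forall>x\<in>B. \<forall>y\<in>B. x \<noteq> y \<longrightarrow> cinner x y = 0)}"
  have "\<exists>B\<in>ons. \<forall>C\<in>ons. B \<subseteq> C \<longrightarrow> C = B"
  proof (rule subset_Zorn_nonempty)
    have "{} \<in> ons" by (simp add: ons_def)
    then show "ons \<noteq> {}" by blast
    fix \<C> assume C: "\<C> \<noteq> {}" "subset.chain ons \<C>"
    then have sub: "\<C> \<subseteq> ons" and ch: "\<And>A B. A \<in> \<C> \<Longrightarrow> B \<in> \<C> \<Longrightarrow> A \<subseteq> B \<or> B \<subseteq> A"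
      by (auto simp: subset_chain_def)
    have orth: "cinner x y = 0" if "A \<in> \<C>" "x \<in> A" "B \<in> \<C>" "y \<in> B" "x \<noteq> y" for A B x y
    proof -
      have *: "cinner x y = 0" if "E \<in> ons" "x \<in> E" "y \<in> E" for E
        using that \<open>x \<noteq> y\<close> by (simp add: ons_def)
      from ch[OF that(1,3)] show ?thesis
      proof
        assume "A \<subseteq> B"
        then show ?thesis using that sub by (intro *[of B]) auto
      next
        assume "B \<subseteq> A"
        then show ?thesis using that sub by (intro *[of A]) auto
      qed
    qed
    show "\<Union>\<C> \<in> ons"
      unfolding ons_def
    proof (intro CollectI conjI ballI impI)
      have *: "E \<subseteq> W" "\<And>x. x \<in> E \<Longrightarrow> norm x = 1" if "E \<in> \<C>" for E
        using that sub by (auto simp: ons_def)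
      show "\<Union>\<C> \<subseteq> W" using *(1) by (rule Union_least)
      show "norm x = 1" if "x \<in> \<Union>\<C>" for x using that *(2) by (elim UnionE)
      show "cinner x y = 0" if xy: "x \<in> \<Union>\<C>" "y \<in> \<Union>\<C>" "x \<noteq> y" for x y
      proof -
        obtain E where E: "E \<in> \<C>" "x \<in> E" using xy(1) by (rule UnionE)
        obtain F where F: "F \<in> \<C>" "y \<in> F" using xy(2) by (rule UnionE)
        show ?thesis by (rule orth[OF E F xy(3)])
      qed
    qed
  qed
  then obtain B where B: "B \<in> ons" and max: "\<And>C. C \<in> ons \<Longrightarrow> B \<subseteq> C \<Longrightarrow> C = B" by blast
  have BW: "B \<subseteq> W" and B1: "\<And>x. x \<in> B \<Longrightarrow> norm x = 1"
    and B0: "\<And>x y. x \<in> B \<Longrightarrow> y \<in> B \<Longrightarrow> x \<noteq> y \<Longrightarrow> cinner x y = 0"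
    using B by (auto simp: ons_def)
  have total: "x = 0" if x: "x \<in> W" "\<And>b. b \<in> B \<Longrightarrow> cinner x b = 0" for x
  proof (rule ccontr)
    assume "x \<noteq> 0"
    define u where "u = inverse (norm x) *\<^sub>R x"
    have u1: "norm u = 1" and uW: "u \<in> W"
      using \<open>x \<noteq> 0\<close> csubspace_scaleR[OF W x(1)] by (simp_all add: u_def)
    have u0: "cinner u b = 0" "cinner b u = 0" if "b \<in> B" for b
      using x(2)[OF that] cinner_eq_0_commute[of x b] by (simp_all add: u_def cinner_simps)
    have "insert u B \<in> ons" using B u1 uW u0 by (auto simp: ons_def)
    then have "u \<in> B" using max by blast
    then have "cinner u u = 0" using u0 by blast
    then show False using u1 by (simp add: cinner_self)
  qed
  have "infinite B"
  proof
    assume fin: "finite B"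
    have "W \<subseteq> complex_vector.span B"
    proof
      fix x assume x: "x \<in> W"
      define s where "s = (\<Sum>b\<in>B. cinner x b *\<^sub>C b)"
      have s: "s \<in> complex_vector.span B"
        unfolding s_def
          by (intro complex_vector.span_sum complex_vector.span_scale complex_vector.span_base)
      have "s \<in> W"
        unfolding s_def using BW
          by (intro complex_vector.subspace_sum complex_vector.subspace_scale W) auto
      moreover have "cinner s b = cinner x b" if "b \<in> B" for b
      proof -
        have "cinner (\<Sum>b\<in>F. g b) z = (\<Sum>b\<in>F. cinner (g b) z)" if "finite F" for F :: "'w set"
          and g :: "'w \<Rightarrow> 'w" and z
          using that by (induction F rule: finite_induct) (simp_all add: cinner_simps)
        then have "cinner s b = (\<Sum>c\<in>B. cinner x c * cinner c b)"
          using fin by (simp add: s_def cinner_scaleC_left)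
        also have "\<dots> = (\<Sum>c\<in>B. if c = b then cinner x b else 0)"
          by (rule sum.cong) (use that B0 B1 in \<open>auto simp: cinner_self\<close>)
        finally show ?thesis using fin that by simp
      qed
      ultimately have "x - s = 0"
        using x W by (intro total) (simp_all add: complex_vector.subspace_diff cinner_diff_left)
      then show "x \<in> complex_vector.span B" using s by simp
    qed
    then show False using fin inf by (auto simp: finite_dim_def)
  qed
  moreover have "countable B"
  proof -
    obtain U :: "'w set" where U: "countable U" "closure U = UNIV"
      using sep by (auto simp: separable_space_def)
    have "\<exists>d\<in>U. dist d b < 1/2" for b
      using U(2) closure_approachable[of b U] by (metis UNIV_I half_gt_zero zero_less_one)
    then obtain d where d: "\<And>b. d b \<in> U" "\<And>b. dist (d b) b < 1/2" by metis
    have "inj_on d B"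
    proof (rule inj_onI, rule ccontr)
      fix b c assume bc: "b \<in> B" "c \<in> B" "d b = d c" "b \<noteq> c"
      have "dist b c \<le> dist (d b) b + dist (d c) c"
        using dist_triangle[of b c "d b"] bc by (simp add: dist_commute)
      then have "norm (b - c) < 1" using d(2)[of b] d(2)[of c] by (simp add: dist_norm)
      then have "(norm (b - c))\<^sup>2 < 1" by (simp add: power_less_one_iff)
      moreover have "(norm (b + (- c)))\<^sup>2 = (norm b)\<^sup>2 + (norm (- c))\<^sup>2"
        by (rule norm_plus_sq_orth) (use B0 bc in \<open>simp add: cinner_minus_right\<close>)
      ultimately show False using B1 bc by simp
    qed
    then show ?thesis using U(1) d(1)
      by (metis countable_image_inj_on countable_subset image_subsetI)
  qed
  ultimately have bij: "bij_betw (from_nat_into B) UNIV B" by (rule bij_betw_from_nat_into[rotated])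
  let ?e = "from_nat_into B"
  have e: "?e n \<in> B" "?e m = ?e n \<longleftrightarrow> m = n" for m n
    using bij by (auto simp: bij_betw_def inj_on_def)
  have "orthonormal_seq ?e"
    by unfold_locales (use e B0 B1 in \<open>auto simp: cinner_self\<close>)
  moreover have "x = 0" if "x \<in> W" "\<And>n. cinner x (?e n) = 0" for x
    using total[OF that(1)] that(2) bij by (metis UNIV_I bij_betw_def imageE)
  ultimately have "onb_of W ?e" using e BW by (auto simp: onb_of_def)
  then show ?thesis by blast
qed

lemma csubspace_Times: "csubspace S \<Longrightarrow> csubspace T \<Longrightarrow> csubspace (S \<times> T)"
  by (auto simp: complex_vector.subspace_def scaleC_prod_def zero_prod_def)

lemma separable_space_prod:
  assumes "separable_space (euclidean :: 'a::metric_space topology)"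
  shows "separable_space (euclidean :: ('a \<times> 'a) topology)"
proof -
  obtain U :: "'a set" where "countable U" "closure U = UNIV"
    using assms by (auto simp: separable_space_def)
  then have "countable (U \<times> U)" "closure (U \<times> U) = UNIV" by (simp_all add: closure_Times)
  then show ?thesis by (auto simp: separable_space_def)
qed

text \<open>\<open>S\<close> may be finite-dimensional, even zero; the second factor makes the
  product infinite-dimensional. This supplies both the identification with the auxiliary space and
  the absorption of the summand on which \<open>q\<^sub>0\<close> is trivial.\<close>

lemma unitary_iso_Times_UNIV:
  fixes S :: "'a::chilbert_space set"
  assumes sep: "separable_space (euclidean :: 'a topology)" and inf: "\<not> finite_dim (UNIV :: 'a set)"
    and S: "csubspace S" "closed S"
  shows "\<exists>\<Phi> :: 'a \<times> 'a \<Rightarrow> 'a. unitary_iso (S \<times> UNIV) \<Phi>"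
proof -
  have cs: "csubspace (S \<times> (UNIV :: 'a set))" using S by (simp add: csubspace_Times)
  have "\<not> finite_dim (S \<times> (UNIV :: 'a set))"
  proof
    assume "finite_dim (S \<times> (UNIV :: 'a set))"
    moreover have "cblin (snd_blinfun :: ('a \<times> 'a) \<Rightarrow>\<^sub>L 'a)" by (simp add: cblin_def scaleC_prod_def)
    ultimately have "finite_dim ((snd_blinfun :: ('a \<times> 'a) \<Rightarrow>\<^sub>L 'a) ` (S \<times> UNIV))"
      by (rule finite_dim_image)
    moreover have "(snd_blinfun :: ('a \<times> 'a) \<Rightarrow>\<^sub>L 'a) ` (S \<times> UNIV) = UNIV"
      using complex_vector.subspace_0[OF S(1)] by force
    ultimately show False using inf by simp
  qed
  then obtain e where e: "onb_of (S \<times> (UNIV :: 'a set)) e"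
    using onb_exists[OF separable_space_prod[OF sep] cs] by blast
  obtain f where f: "onb_of (UNIV :: 'a set) f"
    using onb_exists[OF sep _ inf] by auto
  show ?thesis by (rule unitary_iso_onb[OF cs closed_Times[OF S(2) closed_UNIV] e f])
qed

section \<open>The index as a single homotopy class\<close>

lemma plus_one_apply [simp]: "plus_one u (x, y) = (u x, y)"
proof -
  have eq: "(\<lambda>(x, y). (blinfun_apply u x, y)) = (\<lambda>z. (blinfun_apply u (fst z), snd z))" by auto
  have bl: "bounded_linear (\<lambda>z. (blinfun_apply u (fst z), snd z))"
    by (intro bounded_linear_Pair bounded_linear_compose[OF blinfun.bounded_linear_right]
        bounded_linear_fst bounded_linear_snd)
  show ?thesis unfolding plus_one_def eq bounded_linear_Blinfun_apply[OF bl] by simp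
qed

lemma cblin_plus_one: "cblin u \<Longrightarrow> cblin (plus_one u)"
  by (auto simp: cblin_def scaleC_prod_def)

lemma unitary_isoD:
  assumes "unitary_iso S \<Phi>"
  shows "\<And>x y. x \<in> S \<Longrightarrow> y \<in> S \<Longrightarrow> \<Phi> (x + y) = \<Phi> x + \<Phi> y"
    and "\<And>c x. x \<in> S \<Longrightarrow> \<Phi> (c *\<^sub>C x) = c *\<^sub>C \<Phi> x"
    and "\<And>x. x \<in> S \<Longrightarrow> norm (\<Phi> x) = norm x"
    and "\<Phi> ` S = UNIV"
  using assms by (auto simp: unitary_iso_def)

lemma unitary_iso_inj:
  assumes S: "csubspace S" and \<Phi>: "unitary_iso S \<Phi>"
  shows "inj_on \<Phi> S"
proof (rule inj_onI)
  fix x y assume xy: "x \<in> S" "y \<in> S" "\<Phi> x = \<Phi> y"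
  then have "\<Phi> (x + (-1) *\<^sub>C y) = \<Phi> x + (-1) *\<^sub>C \<Phi> y"
    using unitary_isoD[OF \<Phi>] S by (metis complex_vector.subspace_scale)
  then have "norm (x - y) = 0"
    using unitary_isoD(3)[OF \<Phi>, of "x - y"] complex_vector.subspace_diff[OF S xy(1,2)] xy(3) by simp
  then show "x = y" by simp
qed

lemma unitary_iso_inv:
  assumes S: "csubspace S" and \<Phi>: "unitary_iso S \<Phi>"
  shows unitary_iso_inv_in: "inv_into S \<Phi> y \<in> S"
    and unitary_iso_inv_right: "\<Phi> (inv_into S \<Phi> y) = y"
    and unitary_iso_inv_left: "x \<in> S \<Longrightarrow> inv_into S \<Phi> (\<Phi> x) = x"
    and norm_unitary_iso_inv: "norm (inv_into S \<Phi> y) = norm y"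
    and unitary_iso_inv_add: "inv_into S \<Phi> (y + z) = inv_into S \<Phi> y + inv_into S \<Phi> z"
    and unitary_iso_inv_scaleC: "inv_into S \<Phi> (c *\<^sub>C y) = c *\<^sub>C inv_into S \<Phi> y"
proof -
  note D = unitary_isoD[OF \<Phi>]
  show 1: "inv_into S \<Phi> y \<in> S" for y using D(4) by (metis UNIV_I inv_into_into)
  show 2: "\<Phi> (inv_into S \<Phi> y) = y" for y using D(4) by (metis UNIV_I f_inv_into_f)
  show 3: "x \<in> S \<Longrightarrow> inv_into S \<Phi> (\<Phi> x) = x" for x
    using unitary_iso_inj[OF S \<Phi>] by simp
  show "norm (inv_into S \<Phi> y) = norm y" by (metis 1 2 D(3))
  show "inv_into S \<Phi> (y + z) = inv_into S \<Phi> y + inv_into S \<Phi> z"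
    by (metis 1 2 3 D(1) S complex_vector.subspace_add)
  show "inv_into S \<Phi> (c *\<^sub>C y) = c *\<^sub>C inv_into S \<Phi> y"
    by (metis 1 2 3 D(2) S complex_vector.subspace_scale)
qed

lemma transport_apply:
  assumes S: "csubspace S" and \<Phi>: "unitary_iso S \<Phi>"
    and U: "\<And>x. x \<in> S \<Longrightarrow> blinfun_apply U x \<in> S" "cblin U"
  shows "blinfun_apply (transport S \<Phi> U) y = \<Phi> (U (inv_into S \<Phi> y))"
    and "cblin (transport S \<Phi> U)"
proof -
  note D = unitary_isoD[OF \<Phi>] and I = unitary_iso_inv[OF S \<Phi>]
  let ?f = "\<lambda>y. \<Phi> (U (inv_into S \<Phi> y))"
  have sc: "?f (c *\<^sub>C y) = c *\<^sub>C ?f y" for c y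
    by (simp add: I U D cblinD)
  have "bounded_linear ?f"
  proof (rule bounded_linear_intro[where K = "norm U"])
    show "norm (?f y) \<le> norm y * norm U" for y
      using norm_blinfun[of U "inv_into S \<Phi> y"] by (simp add: D U I mult.commute)
  qed (simp_all add: I D U blinfun.add_right cblinD scaleR_scaleC)
  then have *: "blinfun_apply (transport S \<Phi> U) = ?f"
    by (simp add: transport_def bounded_linear_Blinfun_apply)
  then show "blinfun_apply (transport S \<Phi> U) y = ?f y" by simp
  show "cblin (transport S \<Phi> U)" by (simp add: cblin_def * sc)
qed

lemma conj_unitaries_F:
  assumes u: "u \<in> unitaries_F UNIV" and p: "p \<in> unitaries UNIV"
  shows "p o\<^sub>L (u o\<^sub>L inv_blinfun p) \<in> unitaries_F UNIV"
  unfolding unitaries_F_UNIV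
proof
  show "p o\<^sub>L (u o\<^sub>L inv_blinfun p) \<in> unitaries UNIV"
    using u p by (intro unitaries_compose inv_unitary_unitary) (auto simp: unitaries_F_def)
  have iso: "ciso v" if "v \<in> unitaries UNIV" for v :: "'a \<Rightarrow>\<^sub>L 'a"
    by (rule cisoI[where S = "inv_blinfun v"])
      (use that in \<open>simp_all add: unitary_cblin inv_unitary_unitary\<close>)
  have "fredholm_map (\<lambda>x. p (u (inv_blinfun p x) + inv_blinfun p x))"
    using u p by (intro fredholm_map_ciso[where f = "\<lambda>x. u x + x"] iso inv_unitary_unitary)
      (auto simp: unitaries_F_UNIV)
  then show "fredholm_map (\<lambda>x. (p o\<^sub>L (u o\<^sub>L inv_blinfun p)) x + x)"
    using p by (simp add: blinfun.add_right)
qed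

lemma continuous_map_blinfun_compose:
  assumes "continuous_map X euclidean f" "continuous_map X euclidean g"
  shows "continuous_map X euclidean (\<lambda>x. f x o\<^sub>L g x)"
proof -
  have "continuous_on UNIV (\<lambda>p. fst p o\<^sub>L snd p)"
    by (intro bounded_bilinear.continuous_on[OF bounded_bilinear_blinfun_compose] continuous_intros)
  then have "continuous_map (prod_topology euclidean euclidean) euclidean (\<lambda>p. fst p o\<^sub>L snd p)"
    by (simp add: euclidean_product_topology)
  from continuous_map_compose[OF continuous_map_pairedI[OF assms] this] show ?thesis
    by (simp add: o_def)
qed

lemma htpy_class_eq:
  assumes "homotopic_with (\<lambda>_. True) X Y f g"
  shows "htpy_class X Y f = htpy_class X Y g"
  using assms unfolding htpy_class_def
  by (blast intro: homotopic_with_trans homotopic_with_symD)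

lemma htpy_class_cong:
  assumes "continuous_map X Y f" "\<And>x. x \<in> topspace X \<Longrightarrow> f x = g x"
  shows "htpy_class X Y f = htpy_class X Y g"
  by (rule htpy_class_eq, rule homotopic_with_equal) (use assms in auto)

text \<open>Multiplication by a path on either side covers the homotopies constructed below:
  conjugation, left multiplication by a Cayley path, right multiplication by a phase.\<close>

lemma homotopic_compose:
  fixes F :: "'x \<Rightarrow> 'a::chilbert_space \<Rightarrow>\<^sub>L 'a"
  assumes F: "continuous_map X euclidean F"
    and p: "continuous_on {0..1::real} p" and r: "continuous_on {0..1::real} r"
    and U: "\<And>t x. t \<in> {0..1} \<Longrightarrow> x \<in> topspace X \<Longrightarrow> p t o\<^sub>L (F x o\<^sub>L r t) \<in> U"
  shows "homotopic_with (\<lambda>_. True) X (top_of_set U)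
    (\<lambda>x. p 0 o\<^sub>L (F x o\<^sub>L r 0)) (\<lambda>x. p 1 o\<^sub>L (F x o\<^sub>L r 1))"
proof -
  let ?h = "\<lambda>(t, x). p t o\<^sub>L (F x o\<^sub>L r t)"
  let ?Z = "prod_topology (top_of_set {0..1::real}) X"
  have "continuous_map ?Z euclidean (\<lambda>z. p (fst z))" "continuous_map ?Z euclidean (\<lambda>z. r (fst z))"
    using p r continuous_map_compose[OF continuous_map_fst, of "top_of_set {0..1}" euclidean]
    by (auto simp: o_def)
  moreover have "continuous_map ?Z euclidean (\<lambda>z. F (snd z))"
    using F continuous_map_compose[OF continuous_map_snd, of X euclidean F] by (simp add: o_def)
  ultimately have "continuous_map ?Z euclidean (\<lambda>z. p (fst z) o\<^sub>L (F (snd z) o\<^sub>L r (fst z)))"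
    by (intro continuous_map_blinfun_compose)
  then have "continuous_map ?Z (top_of_set U) ?h"
    using U by (auto simp: continuous_map_in_subtopology case_prod_unfold)
  then show ?thesis
    unfolding homotopic_with_def by (intro exI[of _ ?h]) auto
qed

lemma homotopic_conj:
  fixes F :: "'x \<Rightarrow> 'a::chilbert_space \<Rightarrow>\<^sub>L 'a"
  assumes F: "continuous_map X (top_of_set (unitaries_F UNIV)) F" and g: "g \<in> unitaries UNIV"
  shows "homotopic_with (\<lambda>_. True) X (top_of_set (unitaries_F UNIV)) F (\<lambda>x. g o\<^sub>L (F x o\<^sub>L inv_blinfun
      g))"
proof -
  obtain p where p: "continuous_on {0..1::real} p" "p ` {0..1} \<subseteq> unitaries UNIV" "p 0
      = id_blinfun" "p 1 = g"
    using unitary_path[OF g] by blast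
  have inv_id: "inv_blinfun (id_blinfun :: 'a \<Rightarrow>\<^sub>L 'a) = id_blinfun"
    by (rule inv_blinfun_eqI) (auto intro: blinfun_eqI)
  have "homotopic_with (\<lambda>_. True) X (top_of_set (unitaries_F UNIV))
      (\<lambda>x. p 0 o\<^sub>L (F x o\<^sub>L inv_blinfun (p 0))) (\<lambda>x. p 1 o\<^sub>L (F x o\<^sub>L inv_blinfun (p 1)))"
  proof (rule homotopic_compose[OF _ p(1)])
    show "continuous_map X euclidean F" using F by (simp add: continuous_map_in_subtopology)
    show "continuous_on {0..1} (\<lambda>t. inv_blinfun (p t))"
      by (rule continuous_on_compose2[OF continuous_on_inv_unitary p(1,2)])
    fix t x assume "t \<in> {0..1::real}" "x \<in> topspace X"
    then show "p t o\<^sub>L (F x o\<^sub>L inv_blinfun (p t)) \<in> unitaries_F UNIV"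
      using p(2) F by (intro conj_unitaries_F) (auto simp: continuous_map_in_subtopology)
  qed
  then show ?thesis by (simp add: p(3,4) inv_id blinfun_compose_simps)
qed

text \<open>Another identification differs from \<open>\<Phi>\<^sub>0\<close> by a unitary g of the
  target, so the two transported families are conjugate under g, and hence homotopic by
  \<open>homotopic_conj\<close>. All members of the union in \<open>K1_index\<close> are therefore
  the same class.\<close>

lemma K1_index_eq:
  fixes f :: "'x \<Rightarrow> 'w::chilbert_space \<Rightarrow>\<^sub>L 'w" and \<Phi>\<^sub>0 :: "'w \<times> 'a::chilbert_space \<Rightarrow> 'a"
  assumes W: "csubspace W" and \<Phi>\<^sub>0: "unitary_iso (W \<times> UNIV) \<Phi>\<^sub>0"
    and f: "\<And>x. x \<in> topspace X \<Longrightarrow> cblin (f x) \<and> blinfun_apply (f x) ` W \<subseteq> W"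
    and F: "continuous_map X (top_of_set (unitaries_F UNIV)) (\<lambda>x. transport (W \<times> UNIV) \<Phi>\<^sub>0 (plus_one
        (f x)))"
  shows "(K1_index X W f :: ('x \<Rightarrow> ('a \<Rightarrow>\<^sub>L 'a)) set) = htpy_class X (top_of_set (unitaries_F UNIV))
    (\<lambda>x. transport (W \<times> UNIV) \<Phi>\<^sub>0 (plus_one (f x)))"
proof -
  let ?S = "W \<times> (UNIV :: 'a set)"
  have S: "csubspace ?S" by (simp add: csubspace_Times W complex_vector.subspace_UNIV)
  have "htpy_class X (top_of_set (unitaries_F UNIV)) (\<lambda>x. transport ?S \<Phi> (plus_one (f x))) =
      htpy_class X (top_of_set (unitaries_F UNIV)) (\<lambda>x. transport ?S \<Phi>\<^sub>0 (plus_one (f x)))"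
    if \<Phi>: "unitary_iso ?S \<Phi>" for \<Phi>
  proof -
    note D = unitary_isoD[OF \<Phi>] and I = unitary_iso_inv[OF S \<Phi>]
    note D0 = unitary_isoD[OF \<Phi>\<^sub>0] and I0 = unitary_iso_inv[OF S \<Phi>\<^sub>0]
    define g where "g = Blinfun (\<lambda>y. \<Phi> (inv_into ?S \<Phi>\<^sub>0 y))"
    have "bounded_linear (\<lambda>y. \<Phi> (inv_into ?S \<Phi>\<^sub>0 y))"
      by (rule bounded_linear_intro[where K = 1]) (simp_all only: I0 D scaleR_scaleC mult_1_right
          order_refl)
    then have g: "blinfun_apply g = (\<lambda>y. \<Phi> (inv_into ?S \<Phi>\<^sub>0 y))"
      by (simp add: g_def bounded_linear_Blinfun_apply)
    have "range g = UNIV"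
      by (rule surjI[where f = "\<lambda>y. \<Phi>\<^sub>0 (inv_into ?S \<Phi> y)"]) (simp only: g I0 I)
    moreover have "cblin g" unfolding cblin_def g by (simp only: I0 D) simp
    moreover have "norm (g x) = norm x" for x unfolding g by (simp only: I0 D)
    ultimately have gU: "g \<in> unitaries UNIV" by (simp add: unitaries_UNIV)
    have "g o\<^sub>L (transport ?S \<Phi>\<^sub>0 (plus_one (f x)) o\<^sub>L inv_blinfun g)
        = transport ?S \<Phi> (plus_one (f x))"
      if x: "x \<in> topspace X" for x
    proof (rule blinfun_eqI)
      fix y
      have U: "plus_one (f x) z \<in> ?S" if "z \<in> ?S" for z using f[OF x] that by auto
      have U': "cblin (plus_one (f x))" using f[OF x] cblin_plus_one by blast
      define z where "z = inv_into ?S \<Phi> y"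
      have z: "z \<in> ?S" "y = g (\<Phi>\<^sub>0 z)"
        unfolding z_def g by (simp_all only: I I0)
      then have "inv_blinfun g y = \<Phi>\<^sub>0 z" using gU by simp
      then have "transport ?S \<Phi>\<^sub>0 (plus_one (f x)) (inv_blinfun g y) = \<Phi>\<^sub>0 (plus_one (f x) z)"
        using transport_apply(1)[OF S \<Phi>\<^sub>0 U U', of "\<Phi>\<^sub>0 z"] I0(3)[OF z(1)] by simp
      then show "(g o\<^sub>L (transport ?S \<Phi>\<^sub>0 (plus_one (f x)) o\<^sub>L inv_blinfun g)) y
          = transport ?S \<Phi> (plus_one (f x)) y"
        using transport_apply(1)[OF S \<Phi> U U', of y] I0(3)[OF U[OF z(1)]]
        by (simp add: z_def[symmetric]) (simp add: g)
    qed
    then have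
        "htpy_class X (top_of_set (unitaries_F UNIV)) (\<lambda>x. g o\<^sub>L (transport ?S \<Phi>\<^sub>0 (plus_one (f x)) o\<^sub>L
            inv_blinfun g)) =
      htpy_class X (top_of_set (unitaries_F UNIV)) (\<lambda>x. transport ?S \<Phi> (plus_one (f x)))"
      using homotopic_with_imp_continuous_maps[OF homotopic_conj[OF F gU]]
      by (intro htpy_class_cong) auto
    then show ?thesis using htpy_class_eq[OF homotopic_conj[OF F gU]] by simp
  qed
  then show ?thesis using \<Phi>\<^sub>0 unfolding K1_index_def by blast
qed

text \<open>On the auxiliary summand the operator is 1 + 1 = 2, which is invertible; kernel and
  cokernel come from u + 1 alone.\<close>

lemma fredholm_map_plus_one:
  assumes "fredholm_map (\<lambda>x. blinfun_apply u x + x)"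
  shows "fredholm_map (\<lambda>z. plus_one u z + (z :: 'a::chilbert_space \<times> 'b::chilbert_space))"
proof -
  let ?f = "\<lambda>x. blinfun_apply u x + x"
  have i: "cblin (Blinfun (\<lambda>x::'a. (x, 0::'b)))" "\<And>x. Blinfun (\<lambda>x::'a. (x, 0::'b)) x = (x, 0)"
  proof -
    have "bounded_linear (\<lambda>x::'a. (x, 0::'b))"
      by (intro bounded_linear_Pair bounded_linear_ident bounded_linear_zero)
    then show *: "\<And>x. Blinfun (\<lambda>x::'a. (x, 0::'b)) x = (x, 0)"
      by (simp add: bounded_linear_Blinfun_apply)
    show "cblin (Blinfun (\<lambda>x::'a. (x, 0::'b)))" by (simp add: cblin_def * scaleC_prod_def)
  qed
  let ?i = "Blinfun (\<lambda>x::'a. (x, 0::'b))"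
  have ran: "range (\<lambda>z. plus_one u z + (z :: 'a \<times> 'b)) = range ?f \<times> UNIV"
  proof (intro equalityI subsetI)
    fix p assume "p \<in> range ?f \<times> (UNIV :: 'b set)"
    then obtain x y where "p = (?f x, y)" by auto
    then have "p = plus_one u (x, (1/2) *\<^sub>C y) + (x, (1/2) *\<^sub>C y)" by simp
    then show "p \<in> range (\<lambda>z. plus_one u z + (z :: 'a \<times> 'b))" by blast
  qed auto
  have "closed (range ?f \<times> (UNIV :: 'b set))"
    using assms by (intro closed_Times) (auto simp: fredholm_map_def)
  moreover have "{z. plus_one u z + (z :: 'a \<times> 'b) = 0} \<subseteq> ?i ` {x. ?f x = 0}"
  proof
    fix z assume "z \<in> {z. plus_one u z + (z :: 'a \<times> 'b) = 0}"
    moreover obtain x y where z: "z = (x, y)" by force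
    ultimately have "?f x = 0" "2 *\<^sub>R y = 0" by (auto simp: zero_prod_def scaleR_2)
    then show "z \<in> ?i ` {x. ?f x = 0}" by (auto simp: z i)
  qed
  then have "finite_dim {z. plus_one u z + (z :: 'a \<times> 'b) = 0}"
    using assms
      by (intro finite_dim_subset[OF finite_dim_image[OF _ i(1)]]) (auto simp: fredholm_map_def)
  moreover have "finite_codim_in UNIV (range ?f \<times> (UNIV :: 'b set))"
  proof -
    obtain B where B: "finite B" "UNIV \<subseteq> complex_vector.span (range ?f \<union> B)"
      using assms by (auto simp: fredholm_map_def finite_codim_in_def)
    let ?T = "range ?f \<times> (UNIV :: 'b set) \<union> ?i ` B"
    have 0: "0 \<in> range ?f" by (intro image_eqI[of _ _ 0]) (simp_all add: blinfun.zero_right)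
    have "p \<in> complex_vector.span ?T" for p
    proof -
      obtain x y where p: "p = (x, y)" by force
      have "x \<in> complex_vector.span (range ?f \<union> B)" using B(2) by blast
      then have "?i x \<in> complex_vector.span (?i ` (range ?f \<union> B))"
        using cblin_span_image[OF i(1)] by blast
      also have "\<dots> \<subseteq> complex_vector.span ?T"
        by (rule complex_vector.span_mono) (auto simp: i)
      finally have "(x, 0) \<in> complex_vector.span ?T" by (simp add: i)
      moreover have "(0, y) \<in> complex_vector.span ?T"
        using 0 by (intro complex_vector.span_base) auto
      ultimately have "(x, 0) + (0, y) \<in> complex_vector.span ?T" by (rule complex_vector.span_add)
      then show ?thesis by (simp add: p)
    qed
    then show ?thesis unfolding finite_codim_in_def using B(1) by (intro exI[of _ "?i ` B"]) auto
  qed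
  ultimately show ?thesis by (simp add: fredholm_map_def ran)
qed

lemma transport_unitaries_F:
  fixes \<Phi> :: "'a::chilbert_space \<times> 'a \<Rightarrow> 'a"
  assumes \<Phi>': "unitary_iso (UNIV \<times> UNIV) \<Phi>" and u: "u \<in> unitaries_F UNIV"
  shows "transport (UNIV \<times> UNIV) \<Phi> (plus_one u) \<in> unitaries_F UNIV"
proof -
  let ?S = "UNIV :: ('a \<times> 'a) set"
  have \<Phi>: "unitary_iso ?S \<Phi>" using \<Phi>' by simp
  have S: "csubspace ?S" by simp
  have uU: "u \<in> unitaries UNIV" using u by (simp add: unitaries_F_def)
  note D = unitary_isoD[OF \<Phi>] and I = unitary_iso_inv[OF S \<Phi>]
  note T = transport_apply[OF S \<Phi> _ cblin_plus_one[OF unitary_cblin[OF uU]]]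
  have i1: "bounded_linear \<Phi>"
    by (rule bounded_linear_intro[where K = 1]) (simp_all add: D scaleR_scaleC)
  have i2: "bounded_linear (inv_into ?S \<Phi>)"
    by (rule bounded_linear_intro[where K = 1]) (simp_all only: I scaleR_scaleC mult_1_right
        order_refl)
  have iso: "ciso (Blinfun \<Phi>)"
    by (rule cisoI[where S = "Blinfun (inv_into ?S \<Phi>)"])
      (simp_all only: cblin_def bounded_linear_Blinfun_apply[OF i1] bounded_linear_Blinfun_apply[OF
          i2] I D UNIV_I, simp_all)
  have iso': "ciso (Blinfun (inv_into ?S \<Phi>))"
    by (rule cisoI[where S = "Blinfun \<Phi>"])
      (simp_all only: cblin_def bounded_linear_Blinfun_apply[OF i1] bounded_linear_Blinfun_apply[OF
          i2] I D UNIV_I, simp_all)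
  have "fredholm_map (\<lambda>y. \<Phi> (plus_one u (inv_into ?S \<Phi> y) + inv_into ?S \<Phi> y))"
    using fredholm_map_ciso[OF fredholm_map_plus_one iso iso', of u] u
    by (simp add: unitaries_F_UNIV bounded_linear_Blinfun_apply[OF i1]
        bounded_linear_Blinfun_apply[OF i2])
  then have "fredholm_map (\<lambda>y. transport ?S \<Phi> (plus_one u) y + y)"
    using T(1) D(1) I(2) by simp
  moreover have "norm (transport ?S \<Phi> (plus_one u) y) = norm y" for y
  proof -
    obtain a b where ab: "inv_into ?S \<Phi> y = (a, b)" by force
    have "norm (transport ?S \<Phi> (plus_one u) y) = norm (u a, b)" using T(1)[of y] ab D(3) by simp
    also have "\<dots> = norm (a, b)" using unitary_norm[OF uU, of a] by (simp add: norm_Pair)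
    also have "\<dots> = norm y" using I(4)[of y] ab by simp
    finally show ?thesis .
  qed
  moreover have "range (transport ?S \<Phi> (plus_one u)) = UNIV"
  proof (rule surjI[where f =
      "\<lambda>y. \<Phi> (inv_blinfun u (fst (inv_into ?S \<Phi> y)), snd (inv_into ?S \<Phi> y))"])
    fix y
    obtain a b where ab: "inv_into ?S \<Phi> y = (a, b)" by force
    show "transport ?S \<Phi> (plus_one u) (\<Phi> (inv_blinfun u (fst (inv_into ?S \<Phi> y)), snd (inv_into ?S \<Phi>
        y))) = y"
      using T(1) I(3) uU I(2)[of y] ab by simp
  qed
  moreover have "cblin (transport ?S \<Phi> (plus_one u))" using T(2) by simp
  ultimately show ?thesis unfolding UNIV_Times_UNIV by (simp add: unitaries_F_UNIV unitaries_UNIV)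
qed

lemma continuous_transport:
  fixes \<Phi> :: "'a::chilbert_space \<times> 'a \<Rightarrow> 'a"
  assumes \<Phi>': "unitary_iso (UNIV \<times> UNIV) \<Phi>"
  shows "continuous_map (top_of_set (unitaries_F UNIV)) (top_of_set (unitaries_F UNIV))
    (\<lambda>u. transport (UNIV \<times> UNIV) \<Phi> (plus_one u))"
proof -
  let ?S = "UNIV :: ('a \<times> 'a) set"
  have \<Phi>: "unitary_iso ?S \<Phi>" using \<Phi>' by simp
  have S: "csubspace ?S" by simp
  note D = unitary_isoD[OF \<Phi>] and I = unitary_iso_inv[OF S \<Phi>]
  have "dist (transport ?S \<Phi> (plus_one u)) (transport ?S \<Phi> (plus_one v)) \<le> dist u v"
    if uv: "u \<in> unitaries UNIV" "v \<in> unitaries UNIV" for u v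
    unfolding dist_norm
  proof (rule norm_blinfun_bound)
    fix y
    obtain a b where ab: "inv_into ?S \<Phi> y = (a, b)" by force
    have T: "transport ?S \<Phi> (plus_one w) y = \<Phi> (w a, b)" if "w \<in> unitaries UNIV" for w
      using transport_apply(1)[OF S \<Phi> _ cblin_plus_one[OF unitary_cblin[OF that]]] ab by simp
    have "\<Phi> (u a, b) = \<Phi> ((u a - v a, 0) + (v a, b))" by simp
    then have "\<Phi> (u a, b) - \<Phi> (v a, b) = \<Phi> (u a - v a, 0)" by (simp only: D UNIV_I) simp
    then have "norm ((transport ?S \<Phi> (plus_one u) - transport ?S \<Phi> (plus_one v)) y)
        = norm ((u - v) a)"
      by (simp add: T uv blinfun.diff_left D norm_Pair)
    also have "\<dots> \<le> norm (u - v) * norm a" by (rule norm_blinfun)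
    also have "norm a \<le> norm y" using I(4)[of y] ab norm_fst_le[of a b] by simp
    finally show "norm ((transport ?S \<Phi> (plus_one u) - transport ?S \<Phi> (plus_one v)) y)
        \<le> norm (u - v) * norm y"
      by (simp add: mult_left_mono)
  qed simp
  then have "continuous_on (unitaries_F UNIV) (\<lambda>u. transport ?S \<Phi> (plus_one u))"
    unfolding continuous_on_iff unitaries_F_def
      by (metis (no_types, lifting) le_less_trans mem_Collect_eq)
  then show ?thesis
    using transport_unitaries_F[OF \<Phi>'] unfolding UNIV_Times_UNIV
    by (auto simp: continuous_map_in_subtopology)
qed

section \<open>A quantitative open mapping theorem\<close>

text \<open>Baire's theorem yields approximate preimages of controlled norm, and a geometric series
  of corrections turns them into exact ones. The map is restricted to \<open>S\<close> and need not
  be onto, so the category argument takes place in the subspace topology of the closed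
  range.\<close>

lemma open_mapping_bound:
  fixes f :: "'a::banach \<Rightarrow> 'b::banach"
  assumes f: "bounded_linear f" and S: "subspace S" "closed S" and R: "closed (f ` S)"
  shows "\<exists>C>0. \<forall>y\<in>f ` S. \<exists>x\<in>S. f x = y \<and> norm x \<le> C * norm y"
proof -
  interpret f: bounded_linear f by (rule f)
  define R where "R = f ` S"
  have R0: "0 \<in> R" using S(1) by (metis R_def f.zero image_eqI subspace_0)
  interpret M: Submetric UNIV dist R by unfold_locales simp
  have complete: "M.sub.mcomplete"
    using R by (intro M.closedin_mcomplete_imp_mcomplete) (auto simp: R_def complete_UNIV)
  have top: "M.sub.mtopology = top_of_set R" by (simp add: M.mtopology_submetric)
  \<comment> \<open>These relatively closed sets exhaust the range, so one of them has an interior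
    point relative to it.\<close>
  define T where "T n = R \<inter> closure (f ` (S \<inter> cball 0 (real n)))" for n
  have "R \<subseteq> \<Union>(range T)"
  proof
    fix y assume "y \<in> R"
    then obtain x where x: "x \<in> S" "y = f x" by (auto simp: R_def)
    obtain n where "norm x \<le> real n" using real_arch_simple by blast
    then have "y \<in> T n" using x closure_subset[of "f ` (S \<inter> cball 0 (real n))"]
      by (auto simp: T_def R_def)
    then show "y \<in> \<Union>(range T)" by blast
  qed
  then have UT: "\<Union>(range T) = R" by (auto simp: T_def)
  have ne: "top_of_set R interior_of R \<noteq> {}" using R0
    by (simp add: interior_of_topspace[of "top_of_set R", simplified]) blast
  have "\<exists>n. top_of_set R interior_of (T n) \<noteq> {}"
  proof (rule ccontr)
    assume neg: "\<not> ?thesis"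
    have "M.sub.mtopology interior_of \<Union>(range T) = {}"
    proof (rule M.sub.metric_Baire_category_alt[OF complete])
      fix S assume "S \<in> range T"
      then obtain n where "S = T n" by blast
      then show "closedin M.sub.mtopology S \<and> M.sub.mtopology interior_of S = {}"
        using neg unfolding top by (simp add: T_def closedin_closed_Int)
    qed simp
    then show False using ne by (simp only: UT top)
  qed
  then obtain n where n: "top_of_set R interior_of (T n) \<noteq> {}" by blast
  then obtain U y0 where U: "openin (top_of_set R) U" "U \<subseteq> T n" "y0 \<in> U"
    by (auto simp: interior_of_def)
  then obtain r where r: "r > 0" "ball y0 r \<inter> R \<subseteq> T n"
    unfolding openin_contains_ball by (metis order_trans)
  have y0: "y0 \<in> R" using U by (auto simp: T_def)
  have sub: "subspace R" unfolding R_def by (rule linear_subspace_image[OF f.linear S(1)])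
  \<comment> \<open>\<open>y\<close> is the difference of y0 + y and y0, both in \<open>T n\<close>;
    subtracting their approximate preimages doubles the bound \<open>n\<close>.\<close>
  have small: "\<exists>x\<in>S. norm x \<le> 2 * real n \<and> norm (y - f x) \<le> e" if y: "y \<in> R" "norm y < r"
    and e: "e > 0" for y e
  proof -
    have near: "\<exists>u\<in>S. norm u \<le> n \<and> dist (f u) w < e/2" if "w \<in> T n" for w
    proof -
      have "w \<in> closure (f ` (S \<inter> cball 0 (real n)))" using that by (simp add: T_def)
      then have "\<forall>d>0. \<exists>p\<in>f ` (S \<inter> cball 0 (real n)). dist p w < d"
        by (simp only: closure_approachable)
      then obtain p where "p \<in> f ` (S \<inter> cball 0 (real n))" "dist p w < e/2"
        using half_gt_zero[OF e] by blast
      then show ?thesis by auto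
    qed
    have "y0 + y \<in> T n"
      by (rule subsetD[OF r(2)]) (use y y0 sub in \<open>simp add: dist_norm subspace_add\<close>)
    then obtain u where u: "u \<in> S" "norm u \<le> n" "dist (f u) (y0 + y) < e/2"
      using near by blast
    have "y0 \<in> T n" by (rule subsetD[OF r(2)]) (use r y0 in simp)
    then obtain v where v: "v \<in> S" "norm v \<le> n" "dist (f v) y0 < e/2"
      using near by blast
    have "norm (y - f (u - v)) \<le> norm (f u - (y0 + y)) + norm (f v - y0)"
      using norm_triangle_ineq4[of "f v - y0" "f u - (y0 + y)"] by (simp add: f.diff algebra_simps)
    then have "norm (y - f (u - v)) \<le> e" using u v by (simp add: dist_norm)
    moreover have "norm (u - v) \<le> 2 * real n" using norm_triangle_ineq4[of u v] u v by simp
    ultimately show ?thesis using u v S(1) subspace_diff by blast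
  qed
  define M where "M = 4 * real n / r"
  have approx: "\<exists>x\<in>S. norm x \<le> M * norm y \<and> norm (y - f x) \<le> e" if y: "y \<in> R" and e: "e > 0" for y e
  proof (cases "y = 0")
    case True
    then show ?thesis using S(1) e by (intro bexI[of _ 0]) (auto simp: f.zero subspace_0)
  next
    case False
    \<comment> \<open>Scales \<open>y\<close> to norm r/2, inside the ball; undoing the scaling
      turns the bound 2 n into \<open>M * norm y\<close>.\<close>
    define c where "c = r / (2 * norm y)"
    have c: "c > 0" using False r by (simp add: c_def)
    have "norm (c *\<^sub>R y) < r" using False r c by (simp add: c_def)
    then obtain x where x: "x \<in> S" "norm x \<le> 2 * real n" "norm (c *\<^sub>R y - f x) \<le> c * e"
      using small[of "c *\<^sub>R y" "c * e"] y sub c e by (auto simp: subspace_scale)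
    have "norm (inverse c *\<^sub>R x) \<le> M * norm y"
      using x(2) c r False by (simp add: c_def M_def field_simps)
    moreover have "norm (y - f (inverse c *\<^sub>R x)) = inverse c * norm (c *\<^sub>R y - f x)"
    proof -
      have "y - f (inverse c *\<^sub>R x) = inverse c *\<^sub>R (c *\<^sub>R y - f x)"
        using c by (simp add: f.scaleR scaleR_diff_right)
      then show ?thesis using c by simp
    qed
    then have "norm (y - f (inverse c *\<^sub>R x)) \<le> inverse c * (c * e)"
      using x(3) c by (simp add: mult_left_mono del: mult_cancel_left)
    then have "norm (y - f (inverse c *\<^sub>R x)) \<le> e" using c by (simp flip: mult.assoc)
    ultimately show ?thesis using x(1) S(1) by (meson subspace_scale)
  qed
  \<comment> \<open>The geometric series costs the factor 2; the added 1 keeps the constant positive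
    even when \<open>n\<close> is 0.\<close>
  have "\<exists>x\<in>S. f x = y \<and> norm x \<le> (2 * M + 1) * norm y" if y: "y \<in> R" for y
  proof (cases "y = 0")
    case True
    then show ?thesis using S(1) by (intro bexI[of _ 0]) (auto simp: f.zero subspace_0)
  next
    case False
    obtain g where g: "\<And>z e. z \<in> R \<Longrightarrow> e > 0 \<Longrightarrow> g z e \<in> S \<and> norm (g z e) \<le> M * norm z
        \<and> norm (z - f (g z e)) \<le> e"
      using approx by metis
    define e where "e k = norm y / 2 ^ k" for k :: nat
    have e0: "e k > 0" for k using False by (simp add: e_def)
    define z where "z = rec_nat y (\<lambda>k u. u - f (g u (e (Suc k))))"
    have z: "z 0 = y" "z (Suc k) = z k - f (g (z k) (e (Suc k)))" for k by (simp_all add: z_def)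
    define x where "x k = g (z k) (e (Suc k))" for k
    have zR: "z k \<in> R \<and> norm (z k) \<le> e k" for k
    proof (induction k)
      case (Suc k)
      then have "f (x k) \<in> R" using g e0 by (auto simp: R_def x_def)
      then have "z (Suc k) \<in> R" using Suc sub by (simp add: z x_def subspace_diff)
      then show ?case using g[of "z k" "e (Suc k)"] Suc e0 by (simp add: z)
    qed (use y in \<open>simp add: z e_def\<close>)
    have M0: "M \<ge> 0" using r by (simp add: M_def)
    have xS: "x k \<in> S" and xn: "norm (x k) \<le> M * norm y * (1/2) ^ k" for k
    proof -
      show "x k \<in> S" using g zR e0 by (simp add: x_def)
      have "norm (x k) \<le> M * norm (z k)" using g zR e0 by (simp add: x_def)
      also have "\<dots> \<le> M * e k" using zR M0 by (simp add: mult_left_mono)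
      finally show "norm (x k) \<le> M * norm y * (1/2) ^ k" by (simp add: e_def power_divide)
    qed
    have sg: "summable (\<lambda>k. M * norm y * (1/2) ^ k)"
      by (intro summable_mult summable_geometric) simp
    have sn: "summable (\<lambda>k. norm (x k))"
      by (rule summable_comparison_test[OF _ sg]) (use xn in auto)
    then have sx: "summable x" by (rule summable_norm_cancel)
    have "suminf x \<in> S"
    proof (rule closed_sequentially[OF S(2)])
      show "(\<lambda>N. \<Sum>k<N. x k) \<longlonglongrightarrow> suminf x" by (rule summable_LIMSEQ[OF sx])
      show "(\<Sum>k<N. x k) \<in> S" for N using xS S(1) by (simp add: subspace_sum)
    qed
    moreover have "f (suminf x) = y"
    proof -
      have "(\<Sum>k<N. f (x k)) = y - z N" for N by (induction N) (simp_all add: z x_def)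
      moreover have "z \<longlonglongrightarrow> 0"
      proof (rule Lim_null_comparison)
        show "\<forall>\<^sub>F k in sequentially. norm (z k) \<le> norm y * (1/2) ^ k"
          using zR by (simp add: e_def power_divide)
        show "(\<lambda>k. norm y * (1/2) ^ k) \<longlonglongrightarrow> 0"
          by (intro tendsto_mult_right_zero LIMSEQ_power_zero) simp
      qed
      ultimately have "(\<lambda>N. \<Sum>k<N. f (x k)) \<longlonglongrightarrow> y - 0"
        by (simp only:) (intro tendsto_intros)
      moreover have "(\<lambda>N. \<Sum>k<N. f (x k)) \<longlonglongrightarrow> f (suminf x)"
        using f.tendsto[OF summable_LIMSEQ[OF sx]] by (simp add: f.sum)
      ultimately show ?thesis using LIMSEQ_unique by fastforce
    qed
    moreover have "norm (suminf x) \<le> (2 * M + 1) * norm y"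
    proof -
      have "norm (suminf x) \<le> (\<Sum>k. norm (x k))" by (rule summable_norm[OF sn])
      also have "\<dots> \<le> (\<Sum>k. M * norm y * (1/2) ^ k)" by (rule suminf_le[OF xn sn sg])
      also have "\<dots> = 2 * M * norm y" by (subst suminf_mult) (simp_all add: suminf_geometric)
      finally have "norm (suminf x) \<le> 2 * M * norm y" .
      moreover have "(2 * M + 1) * norm y = 2 * M * norm y + norm y" by (simp add: distrib_right)
      ultimately show ?thesis using norm_ge_zero[of y] by linarith
    qed
    ultimately show ?thesis by blast
  qed
  moreover have "2 * M + 1 > 0" using r by (simp add: M_def add_nonneg_pos)
  ultimately show ?thesis unfolding R_def by blast
qed

section \<open>Self-adjoint operators and their Cayley transforms\<close>

text \<open>Seen as an orthogonal complement, the graph of the adjoint is at once linear and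
  closed.\<close>

lemma adjoint_op_eq_ortho_compl: "adjoint_op A = ortho_compl ((\<lambda>(\<xi>, \<xi>'). (\<xi>', - \<xi>)) ` A)"
proof -
  have "cinner \<xi>' \<eta> = cinner \<xi> \<eta>' \<longleftrightarrow> cinner \<eta> \<xi>' = cinner \<eta>' \<xi>" for \<xi> \<xi>' \<eta> \<eta>' :: 'a
    using cinner_commute[of \<xi>' \<eta>] cinner_commute[of \<xi> \<eta>'] by auto
  then show ?thesis
    unfolding adjoint_op_def ortho_compl_def by (auto simp: cinner_prod_def cinner_minus_right)
qed

lemma csubspace_adjoint_op: "csubspace (adjoint_op A)"
  by (simp add: adjoint_op_eq_ortho_compl csubspace_ortho_compl)

lemma closed_adjoint_op: "closed (adjoint_op A)"
  by (simp add: adjoint_op_eq_ortho_compl closed_ortho_compl)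

lemma adjoint_opD: "(\<xi>, \<xi>') \<in> A \<Longrightarrow> (\<eta>, \<eta>') \<in> adjoint_op A \<Longrightarrow> cinner \<xi>' \<eta> = cinner \<xi> \<eta>'"
  by (auto simp: adjoint_op_def)

lemma op_add: "csubspace B \<Longrightarrow> (a, a') \<in> B \<Longrightarrow> (b, b') \<in> B \<Longrightarrow> (a + b, a' + b') \<in> B"
  using complex_vector.subspace_add[of B "(a, a')" "(b, b')"] by simp

lemma op_diff: "csubspace B \<Longrightarrow> (a, a') \<in> B \<Longrightarrow> (b, b') \<in> B \<Longrightarrow> (a - b, a' - b') \<in> B"
  using complex_vector.subspace_diff[of B "(a, a')" "(b, b')"] by simp

lemma op_scale: "csubspace B \<Longrightarrow> (a, a') \<in> B \<Longrightarrow> (c *\<^sub>C a, c *\<^sub>C a') \<in> B"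
  using complex_vector.subspace_scale[of B "(a, a')" c] by (simp add: scaleC_prod_def)

text \<open>On the graph of an operator A this is A + s, yet it is bounded and defined on the whole
  product.\<close>

definition shift_op :: "complex \<Rightarrow> ('a::chilbert_space \<times> 'a) \<Rightarrow>\<^sub>L 'a" where
  "shift_op s = snd_blinfun + (scaleC_blinfun s o\<^sub>L fst_blinfun)"

lemma shift_op_apply [simp]: "shift_op s (x, y) = y + s *\<^sub>C x"
  by (simp add: shift_op_def blinfun.add_left)

lemma cblin_shift_op: "cblin (shift_op s)"
  by (auto simp: cblin_def scaleC_prod_def scaleC_add_right scaleC_scaleC mult.commute)

lemma csubspace_image: "cblin T \<Longrightarrow> csubspace S \<Longrightarrow> csubspace (T ` S)"
  unfolding complex_vector.subspace_def
  by (auto simp: image_iff blinfun.zero_right simp flip: blinfun.add_right cblinD intro: bexI[of _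
      0])

text \<open>For (x, y) in a symmetric operator <y, x> is real, so the cross term of y and s x has no
  real part. Thus A + s is isometric for the graph norm, which gives closed ranges.\<close>

lemma norm_shift_op:
  assumes B: "B \<subseteq> adjoint_op B" and p: "p \<in> B" and s: "s = \<i> \<or> s = - \<i>"
  shows "norm (shift_op s p) = norm p"
proof -
  obtain x y where xy: "p = (x, y)" by force
  then have "cinner y x = cinner x y" using p B by (intro adjoint_opD) auto
  then have "Im (cinner y x) = 0" using cinner_commute[of x y] by (simp add: complex_eq_iff)
  then have "(norm (y + s *\<^sub>C x))\<^sup>2 = (norm y)\<^sup>2 + (norm x)\<^sup>2"
    using s by (auto simp: norm_plus_sq norm_scaleC cinner_scaleC_right)
  then show ?thesis by (simp add: xy norm_Pair add.commute real_sqrt_unique)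
qed

lemma closed_isometric_image:
  assumes "closed S" "csubspace S" "\<And>x. x \<in> S \<Longrightarrow> norm (blinfun_apply f x) = norm x"
  shows "closed (blinfun_apply f ` S)"
  by (rule complete_imp_closed, rule complete_isometric_image[where e = 1])
    (use assms in
        \<open>auto simp: complete_eq_closed csubspace_imp_subspace blinfun.bounded_linear_right\<close>)

text \<open>The complement of the range of A + s is the kernel of the adjoint plus the conjugate of
  s, and that conjugate is - s.\<close>

lemma ortho_compl_range_shift:
  assumes s: "s = \<i> \<or> s = - \<i>"
  shows "n \<in> ortho_compl (shift_op s ` A) \<longleftrightarrow> (n, s *\<^sub>C n) \<in> adjoint_op A"
proof -
  have "cinner n (y + s *\<^sub>C x) = 0 \<longleftrightarrow> cinner y n = cinner x (s *\<^sub>C n)" for x y :: 'a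
    unfolding cinner_eq_0_commute[of n] using s
    by (elim disjE; hypsubst) (simp_all add: cinner_simps eq_neg_iff_add_eq_0)
  then show ?thesis by (auto simp: ortho_compl_def adjoint_op_def)
qed

locale self_adjoint_op =
  fixes B :: "'a::chilbert_space operator"
  assumes adjoint_eq: "adjoint_op B = B"
begin

lemma csub: "csubspace B" using csubspace_adjoint_op[of B] by (simp add: adjoint_eq)
lemma clos: "closed B" using closed_adjoint_op[of B] by (simp add: adjoint_eq)

lemma norm_shift: "p \<in> B \<Longrightarrow> s = \<i> \<or> s = - \<i> \<Longrightarrow> norm (shift_op s p) = norm p"
  by (rule norm_shift_op) (simp_all add: adjoint_eq)

lemma range_shift:
  assumes s: "s = \<i> \<or> s = - \<i>"
  shows "shift_op s ` B = UNIV"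
proof (rule closed_csubspace_eq_UNIV)
  show "csubspace (shift_op s ` B)" by (intro csubspace_image cblin_shift_op csub)
  show "closed (shift_op s ` B)" using s by (intro closed_isometric_image clos csub norm_shift)
  show "ortho_compl (shift_op s ` B) \<subseteq> {0}"
  proof
    fix n assume "n \<in> ortho_compl (shift_op s ` B)"
    then have n: "(n, s *\<^sub>C n) \<in> B" using ortho_compl_range_shift[OF s] adjoint_eq by auto
    then have "cinner (s *\<^sub>C n) n = cinner n (s *\<^sub>C n)" by (rule adjoint_opD) (simp add: n adjoint_eq)
    then show "n \<in> {0}" using s by (auto simp: cinner_simps)
  qed
qed

lemma cayley_ex: obtains \<xi> \<xi>' where "(\<xi>, \<xi>') \<in> B" "y = \<xi>' + \<i> *\<^sub>C \<xi>"
  using range_shift[of \<i>] by (metis UNIV_I imageE shift_op_apply surj_pair)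

lemma cayley:
  shows cayley_apply: "(\<xi>, \<xi>') \<in> B \<Longrightarrow> cayley B (\<xi>' + \<i> *\<^sub>C \<xi>) = \<xi>' - \<i> *\<^sub>C \<xi>"
    and cayley_unitary: "cayley B \<in> unitaries UNIV"
proof -
  define k where "k y = (THE z. \<exists>(\<xi>, \<xi>')\<in>B. y = \<xi>' + \<i> *\<^sub>C \<xi> \<and> z = \<xi>' - \<i> *\<^sub>C \<xi>)" for y
  have k: "k (\<xi>' + \<i> *\<^sub>C \<xi>) = \<xi>' - \<i> *\<^sub>C \<xi>" if "(\<xi>, \<xi>') \<in> B" for \<xi> \<xi>'
    unfolding k_def
  proof (rule the_equality)
    show "\<exists>(\<eta>, \<eta>')\<in>B. \<xi>' + \<i> *\<^sub>C \<xi> = \<eta>' + \<i> *\<^sub>C \<eta> \<and> \<xi>' - \<i> *\<^sub>C \<xi> = \<eta>' - \<i> *\<^sub>C \<eta>"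
      using that by (intro bexI[of _ "(\<xi>, \<xi>')"]) auto
    fix z assume "\<exists>(\<eta>, \<eta>')\<in>B. \<xi>' + \<i> *\<^sub>C \<xi> = \<eta>' + \<i> *\<^sub>C \<eta> \<and> z = \<eta>' - \<i> *\<^sub>C \<eta>"
    then obtain \<eta> \<eta>' where \<eta>: "(\<eta>, \<eta>') \<in> B" "\<xi>' + \<i> *\<^sub>C \<xi> = \<eta>' + \<i> *\<^sub>C \<eta>" "z = \<eta>' - \<i> *\<^sub>C \<eta>" by auto
    have "shift_op \<i> (\<xi> - \<eta>, \<xi>' - \<eta>') = 0"
      using \<eta>(2)
        by (simp add: complex_vector.scale_right_diff_distrib) (metis add_diff_add diff_self)
    then have "norm (\<xi> - \<eta>, \<xi>' - \<eta>') = 0"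
      using norm_shift[OF op_diff[OF csub that \<eta>(1)], of \<i>] by simp
    then show "z = \<xi>' - \<i> *\<^sub>C \<xi>" using \<eta>(3) by (simp add: zero_prod_def)
  qed
  have add: "k (x + y) = k x + k y" for x y
  proof -
    obtain a a' where a: "(a, a') \<in> B" "x = a' + \<i> *\<^sub>C a" by (rule cayley_ex)
    obtain b b' where b: "(b, b') \<in> B" "y = b' + \<i> *\<^sub>C b" by (rule cayley_ex)
    have "x + y = (a' + b') + \<i> *\<^sub>C (a + b)" by (simp add: a b scaleC_add_right)
    then have "k (x + y) = (a' + b') - \<i> *\<^sub>C (a + b)" by (simp only: k[OF op_add[OF csub a(1) b(1)]])
    then show ?thesis using k[OF a(1)] k[OF b(1)] a b by (simp add: scaleC_add_right)
  qed
  have scale: "k (c *\<^sub>C x) = c *\<^sub>C k x" for c x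
  proof -
    obtain a a' where a: "(a, a') \<in> B" "x = a' + \<i> *\<^sub>C a" by (rule cayley_ex)
    have "c *\<^sub>C x = (c *\<^sub>C a') + \<i> *\<^sub>C (c *\<^sub>C a)"
      by (simp add: a scaleC_add_right scaleC_scaleC mult.commute)
    then have "k (c *\<^sub>C x) = (c *\<^sub>C a') - \<i> *\<^sub>C (c *\<^sub>C a)" by (simp only: k[OF op_scale[OF csub a(1)]])
    then show ?thesis using k[OF a(1)] a
      by (simp add: complex_vector.scale_right_diff_distrib scaleC_scaleC mult.commute)
  qed
  have nrm: "norm (k x) = norm x" for x
  proof -
    obtain a a' where a: "(a, a') \<in> B" "x = a' + \<i> *\<^sub>C a" by (rule cayley_ex)
    then show ?thesis using k[OF a(1)] norm_shift[OF a(1), of \<i>] norm_shift[OF a(1), of "-\<i>"]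
      by simp
  qed
  have "bounded_linear k"
    by (rule bounded_linear_intro[where K = 1]) (simp_all add: add scale nrm scaleR_scaleC)
  then have *: "blinfun_apply (cayley B) = k"
    by (simp add: cayley_def k_def[abs_def] bounded_linear_Blinfun_apply)
  have "y \<in> range k" for y
  proof -
    have "y \<in> shift_op (- \<i>) ` B" using range_shift[of "-\<i>"] by simp
    then obtain a a' where "(a, a') \<in> B" "y = a' - \<i> *\<^sub>C a" by auto
    then show ?thesis using k by (metis rangeI)
  qed
  then show "cayley B \<in> unitaries UNIV"
    by (auto simp: unitaries_UNIV * cblin_def scale nrm)
  show "(\<xi>, \<xi>') \<in> B \<Longrightarrow> cayley B (\<xi>' + \<i> *\<^sub>C \<xi>) = \<xi>' - \<i> *\<^sub>C \<xi>"
    using * k by simp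
qed

text \<open>The Cayley transform plus 1 sends \<xi>' + i \<xi> to 2 \<xi>', so its range is that of
  \<open>B\<close> and its kernel is i times the kernel of \<open>B\<close>.\<close>

lemma cayley_unitaries_F:
  assumes "fredholm_in UNIV B"
  shows "cayley B \<in> unitaries_F UNIV"
proof -
  have plus: "cayley B (\<xi>' + \<i> *\<^sub>C \<xi>) + (\<xi>' + \<i> *\<^sub>C \<xi>) = 2 *\<^sub>R \<xi>'" if "(\<xi>, \<xi>') \<in> B" for \<xi> \<xi>'
    by (simp add: cayley_apply[OF that] scaleR_2)
  have ran: "range (\<lambda>x. cayley B x + x) = Range B"
  proof (intro equalityI subsetI)
    fix y assume "y \<in> range (\<lambda>x. cayley B x + x)"
    then obtain x where y: "y = cayley B x + x" by blast
    obtain a a' where a: "(a, a') \<in> B" "x = a' + \<i> *\<^sub>C a" by (rule cayley_ex)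
    then have "y = 2 *\<^sub>R a'" using plus y by simp
    then show "y \<in> Range B"
      using op_scale[OF csub a(1), of 2] by (auto simp: scaleR_scaleC)
  next
    fix y assume "y \<in> Range B"
    then obtain x where x: "(x, y) \<in> B" by blast
    have "2 *\<^sub>R ((1/2) *\<^sub>C y) = y" by (simp add: scaleR_scaleC scaleC_scaleC)
    then show "y \<in> range (\<lambda>x. cayley B x + x)"
      using plus[OF op_scale[OF csub x, of "1/2"]]
      by (intro image_eqI[of _ _ "(1/2) *\<^sub>C y + \<i> *\<^sub>C (1/2) *\<^sub>C x"]) simp_all
  qed
  have "{x. cayley B x + x = 0} \<subseteq> scaleC_blinfun \<i> ` op_ker B"
  proof
    fix x assume x: "x \<in> {x. cayley B x + x = 0}"
    obtain a a' where a: "(a, a') \<in> B" "x = a' + \<i> *\<^sub>C a" by (rule cayley_ex)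
    then have "a' = 0" using x plus[OF a(1)] by simp
    then show "x \<in> scaleC_blinfun \<i> ` op_ker B" using a by (simp add: op_ker_def)
  qed
  moreover have "finite_dim (scaleC_blinfun \<i> ` op_ker B)"
    using assms by (intro finite_dim_image cblin_scaleC) (simp add: fredholm_in_def)
  ultimately have "finite_dim {x. cayley B x + x = 0}" by (rule finite_dim_subset[rotated])
  then show ?thesis
    using assms cayley_unitary by (simp add: unitaries_F_UNIV fredholm_map_def ran fredholm_in_def)
qed

end

section \<open>Boundary values\<close>

lemma fst_scaleC [simp]: "fst (c *\<^sub>C p) = c *\<^sub>C fst p"
  by (simp add: scaleC_prod_def)

lemma scaleC_two_ii: "(2 * \<i>) *\<^sub>C x = \<i> *\<^sub>C x + \<i> *\<^sub>C (x::'a::chilbert_space)"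
  by (metis scaleC_scaleC scaleC_two)

locale boundary =
  fixes A :: "'a::chilbert_space operator" and \<gamma> :: "'a \<Rightarrow> 'v::chilbert_space"
  assumes sym: "symmetric_op A" and bm: "boundary_map A \<gamma>"
begin

abbreviation "G \<equiv> adjoint_op A"

lemma csub_A: "csubspace A" and closed_A: "closed A" and A_G: "A \<subseteq> G"
  using sym by (auto simp: symmetric_op_def)

lemma \<gamma>_add: "\<xi> \<in> Domain G \<Longrightarrow> \<eta> \<in> Domain G \<Longrightarrow> \<gamma> (\<xi> + \<eta>) = \<gamma> \<xi> + \<gamma> \<eta>"
  using bm by (simp add: boundary_map_def)

lemma \<gamma>_scale: "\<xi> \<in> Domain G \<Longrightarrow> \<gamma> (c *\<^sub>C \<xi>) = c *\<^sub>C \<gamma> \<xi>"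
  using bm by (simp add: boundary_map_def)

lemma \<gamma>_A: "(\<xi>, \<xi>') \<in> A \<Longrightarrow> \<gamma> \<xi> = 0"
proof -
  assume "(\<xi>, \<xi>') \<in> A"
  moreover have "{\<xi> \<in> Domain G. \<gamma> \<xi> = 0} = Domain A" using bm by (simp add: boundary_map_def)
  ultimately show ?thesis by blast
qed

lemma \<gamma>_norm: "p \<in> G \<Longrightarrow> norm (\<gamma> (fst p)) = infdist p A"
  using bm by (auto simp: boundary_map_def)

lemma adjoint_iff_ortho: "(x, y) \<in> G \<longleftrightarrow> (y, - x) \<in> ortho_compl A"
proof -
  have "cinner a' x = cinner a y \<longleftrightarrow> cinner y a = cinner x a'" for a a'
    using cinner_commute[of a' x] cinner_commute[of a y] by auto
  then show ?thesis
    unfolding adjoint_op_def ortho_compl_def by (auto simp: cinner_prod_def cinner_minus_left)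
qed

text \<open>The orthogonal complement of the graph of \<^term>\<open>A\<close> in that of its adjoint is the
  model of the space of boundary values in which all computations take place.\<close>

definition "E = G \<inter> ortho_compl A"

lemma csub_E: "csubspace E"
  unfolding E_def
    by (intro complex_vector.subspace_inter csubspace_adjoint_op csubspace_ortho_compl)

lemma closed_E: "closed E"
  unfolding E_def by (intro closed_Int closed_adjoint_op closed_ortho_compl)

lemma E_G: "p \<in> E \<Longrightarrow> p \<in> G" by (simp add: E_def)

text \<open>By \<open>adjoint_iff_ortho\<close>, orthogonality to \<open>A\<close> means that a
  rotated pair lies in the adjoint; on \<open>E\<close> the adjoint thus squares to -1. This
  rotation is what becomes \<open>J\<close>.\<close>

lemma E_rot: "(x, y) \<in> E \<Longrightarrow> (y, - x) \<in> E"
proof -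
  assume "(x, y) \<in> E"
  then have 1: "(y, - x) \<in> ortho_compl A" and 2: "(x, y) \<in> ortho_compl A"
    by (auto simp: E_def adjoint_iff_ortho)
  have "(-1) *\<^sub>C (x, y) \<in> ortho_compl A"
    by (rule complex_vector.subspace_scale[OF csubspace_ortho_compl 2])
  then show ?thesis using 1 by (simp add: E_def adjoint_iff_ortho)
qed

abbreviation "P \<equiv> orth_projection E"

lemma P_E: "P p \<in> E" by (rule orth_projection_in[OF csub_E closed_E])

text \<open>\<open>G\<close> is the orthogonal sum of \<open>A\<close> and \<open>E\<close>, so the
  projection to \<open>E\<close> removes exactly the component in \<open>A\<close>.\<close>

lemma diff_P_A: assumes "p \<in> G" shows "p - P p \<in> A"
proof -
  let ?q = "orth_projection A p"
  note q = orth_projection_in[OF csub_A closed_A, of p] orth_projection_diff[OF csub_A closed_A, of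
      p]
  have "P p = p - ?q"
  proof (rule orth_projection_eq[OF csub_E closed_E])
    show "p - ?q \<in> E"
      using q assms A_G
        by (auto simp: E_def intro!: complex_vector.subspace_diff[OF csubspace_adjoint_op])
    show "p - (p - ?q) \<in> ortho_compl E"
      using q(1) by (auto simp: E_def ortho_compl_def cinner_eq_0_commute[of ?q])
  qed
  then show ?thesis using q by simp
qed

lemma \<gamma>_norm_E: assumes "p \<in> E" shows "norm (\<gamma> (fst p)) = norm p"
proof -
  obtain y where y: "y \<in> A" "p - y \<in> ortho_compl A" "norm (p - y) = infdist p A"
    using orth_decomposition[OF csub_A closed_A] by blast
  have "y = 0"
    by (rule orth_decomposition_unique[OF csub_A y(1) _ y(2)])
      (use assms in \<open>simp_all add: E_def complex_vector.subspace_0[OF csub_A]\<close>)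
  then show ?thesis using \<gamma>_norm[OF E_G[OF assms]] y(3) by simp
qed

text \<open>In contrast to \<^term>\<open>\<gamma>\<close>, which is linear only on the domain of the adjoint, this is a
  globally defined bounded operator.\<close>

definition "\<beta> = Blinfun (\<lambda>p. \<gamma> (fst (P p)))"

lemma P_Domain: "fst (P p) \<in> Domain G"
  using E_G[OF P_E[of p]] by (metis Domain.DomainI prod.collapse)

lemma \<beta>_apply: "\<beta> p = \<gamma> (fst (P p))" and cblin_\<beta>: "cblin \<beta>"
proof -
  let ?f = "\<lambda>p. \<gamma> (fst (P p))"
  have add: "?f (p + q) = ?f p + ?f q" for p q
    by (simp add: blinfun.add_right \<gamma>_add P_Domain)
  have scale: "?f (c *\<^sub>C p) = c *\<^sub>C ?f p" for c p
    by (simp add: cblinD[OF cblin_orth_projection[OF csub_E closed_E]] \<gamma>_scale P_Domain)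
  have "bounded_linear ?f"
  proof (rule bounded_linear_intro[where K = "norm P"])
    show "norm (?f p) \<le> norm p * norm P" for p
      using norm_blinfun[of P p] by (simp add: \<gamma>_norm_E[OF P_E] mult.commute)
    show "?f (r *\<^sub>R p) = r *\<^sub>R ?f p" for r p
      using scale[of "of_real r" p] by (simp add: scaleR_scaleC)
  qed (rule add)
  then have *: "blinfun_apply \<beta> = ?f" by (simp add: \<beta>_def bounded_linear_Blinfun_apply)
  show "\<beta> p = \<gamma> (fst (P p))" by (simp add: *)
  show "cblin \<beta>" by (simp add: cblin_def * scale)
qed

lemma \<beta>_G: assumes "(x, y) \<in> G" shows "\<beta> (x, y) = \<gamma> x"
proof -
  let ?q = "P (x, y)"
  have "(x - fst ?q, y - snd ?q) \<in> A"
    using diff_P_A[OF assms] by (metis diff_Pair prod.collapse)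
  then have "\<gamma> (x - fst ?q) = 0" "x - fst ?q \<in> Domain G" using \<gamma>_A A_G by auto
  then show ?thesis
    using \<gamma>_add[OF P_Domain[of "(x, y)"], of "x - fst ?q"] by (simp add: \<beta>_apply)
qed

lemma \<beta>_cinner: "cinner (\<beta> p) (\<beta> q) = cinner (P p) (P q)"
  unfolding \<beta>_apply
proof (rule isometry_cinner[where f = "\<lambda>p. \<gamma> (fst p)", OF csub_E])
  have D: "fst p \<in> Domain G" if "p \<in> E" for p
    using E_G[OF that] by (metis Domain.DomainI prod.collapse)
  show "\<gamma> (fst (x + y)) = \<gamma> (fst x) + \<gamma> (fst y)" if "x \<in> E" "y \<in> E" for x y
    using that D by (simp add: \<gamma>_add)
  show "\<gamma> (fst (c *\<^sub>C x)) = c *\<^sub>C \<gamma> (fst x)" if "x \<in> E" for c x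
    using that D by (simp add: \<gamma>_scale scaleC_prod_def)
qed (simp_all add: \<gamma>_norm_E P_E)

lemma \<beta>_cinner_E: "p \<in> E \<Longrightarrow> cinner (\<beta> p) (\<beta> q) = cinner p q"
  by (simp add: \<beta>_cinner orth_projection_id[OF csub_E closed_E]
      orth_projection_sym[OF csub_E closed_E, symmetric])

lemma norm_\<beta>: "norm (\<beta> p) = norm (P p)"
  by (simp add: \<beta>_apply \<gamma>_norm_E P_E)

lemma norm_\<beta>_E: "p \<in> E \<Longrightarrow> norm (\<beta> p) = norm p"
  by (simp add: norm_\<beta> orth_projection_id[OF csub_E closed_E])

lemma \<beta>_eq_imp: assumes "p \<in> G" "q \<in> G" "\<beta> p = \<beta> q" shows "p - q \<in> A"
proof -
  have "norm (P (p - q)) = 0"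
    using assms(3) norm_\<beta>[of "p - q"] by (simp add: blinfun.diff_right)
  then show ?thesis
    using diff_P_A[OF complex_vector.subspace_diff[OF csubspace_adjoint_op assms(1,2)]] by simp
qed

abbreviation "\<V> \<equiv> bvals A \<gamma>"
abbreviation "\<omega> \<equiv> bform A \<gamma>"
abbreviation "J \<equiv> bstruct A \<gamma>"

lemma \<beta>_\<V>: "p \<in> G \<Longrightarrow> \<beta> p \<in> \<V>"
  by (cases p) (auto simp: \<beta>_G bvals_def)

lemma \<V>_E: assumes "v \<in> \<V>" obtains x y where "(x, y) \<in> E" "v = \<beta> (x, y)"
proof -
  obtain a b where ab: "(a, b) \<in> G" "v = \<gamma> a" using assms by (auto simp: bvals_def)
  have "v = \<beta> (P (a, b))"
    by (simp add: ab \<beta>_apply[of "P (a, b)"] orth_projection_id[OF csub_E closed_E P_E]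
        flip: \<beta>_G[OF ab(1)] \<beta>_apply)
  then show ?thesis using that P_E by (metis prod.collapse)
qed

lemma csub_\<V>: "csubspace \<V>"
proof -
  have "\<V> = \<beta> ` G" by (force simp: bvals_def \<beta>_G image_iff)
  then show ?thesis by (simp add: csubspace_image cblin_\<beta> csubspace_adjoint_op)
qed

text \<open>Two lifts of the same boundary value differ by an element of \<open>A\<close>, on which
  Green's form against \<open>G\<close> vanishes; hence the description in \<open>bform\<close>
  determines a unique number.\<close>

lemma bform_eq:
  assumes "(x, x') \<in> G" "(y, y') \<in> G"
  shows "\<omega> (\<gamma> x) (\<gamma> y) = cinner x' y - cinner x y'"
  unfolding bform_def
proof (rule the_equality)
  show "\<exists>(\<xi>, \<xi>')\<in>G. \<exists>(\<eta>, \<eta>')\<in>G. \<gamma> \<xi> = \<gamma> x \<and> \<gamma> \<eta> = \<gamma> y \<and>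
      cinner x' y - cinner x y' = cinner \<xi>' \<eta> - cinner \<xi> \<eta>'"
    by (rule bexI[OF _ assms(1)], clarify, rule bexI[OF _ assms(2)]) auto
  fix c assume "\<exists>(\<xi>, \<xi>')\<in>G. \<exists>(\<eta>, \<eta>')\<in>G. \<gamma> \<xi> = \<gamma> x \<and> \<gamma> \<eta> = \<gamma> y \<and> c = cinner \<xi>' \<eta> - cinner \<xi> \<eta>'"
  then obtain \<xi> \<xi>' \<eta> \<eta>' where c: "(\<xi>, \<xi>') \<in> G" "(\<eta>, \<eta>') \<in> G" "\<gamma> \<xi> = \<gamma> x" "\<gamma> \<eta> = \<gamma> y"
    "c = cinner \<xi>' \<eta> - cinner \<xi> \<eta>'" by auto
  have "(x - \<xi>, x' - \<xi>') \<in> A" "(y - \<eta>, y' - \<eta>') \<in> A"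
    using \<beta>_eq_imp[OF assms(1) c(1)] \<beta>_eq_imp[OF assms(2) c(2)] c assms by (simp_all add: \<beta>_G)
  then have "cinner (x' - \<xi>') y = cinner (x - \<xi>) y'" "cinner (y' - \<eta>') \<xi> = cinner (y - \<eta>) \<xi>'"
    using assms(2) c(1) by (auto intro: adjoint_opD)
  then have "cinner x' y - cinner x y' = cinner \<xi>' y - cinner \<xi> y'"
    "cinner \<xi> (y' - \<eta>') = cinner \<xi>' (y - \<eta>)"
    unfolding cinner_commute[of \<xi> "y' - \<eta>'"] cinner_commute[of \<xi>' "y - \<eta>"]
    by (simp add: cinner_diff_left algebra_simps, simp only:)
  then show "c = cinner x' y - cinner x y'" unfolding c(5) cinner_diff_right by algebra
qed

text \<open>Green's form <y, a> - <x, b> is the graph inner product of (y, -x) with (a, b), so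
  \<open>J\<close> is the rotation of \<open>E\<close> seen through \<open>\<beta>\<close>.\<close>

lemma bstruct_eq:
  assumes "(x, y) \<in> E"
  shows "J (\<beta> (x, y)) = \<beta> (y, - x)"
  unfolding bstruct_def
proof (rule the_equality)
  have form: "\<omega> (\<beta> (x, y)) z = cinner (\<beta> (y, - x)) z" if z: "z \<in> \<V>" for z
  proof -
    obtain a b where ab: "(a, b) \<in> E" "z = \<beta> (a, b)" using z by (rule \<V>_E)
    have "cinner (\<beta> (y, - x)) (\<beta> (a, b)) = cinner y a - cinner x b"
      by (simp add: \<beta>_cinner_E[OF E_rot[OF assms]] cinner_prod_def cinner_minus_left)
    then show ?thesis
      using bform_eq[OF E_G[OF assms] E_G[OF ab(1)]] \<beta>_G[OF E_G[OF assms]] \<beta>_G[OF E_G[OF ab(1)]]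
      by (simp add: ab)
  qed
  then show "\<beta> (y, - x) \<in> \<V> \<and> (\<forall>z\<in>\<V>. \<omega> (\<beta> (x, y)) z = cinner (\<beta> (y, - x)) z)"
    using \<beta>_\<V>[OF E_G[OF E_rot[OF assms]]] by blast
  fix w assume w: "w \<in> \<V> \<and> (\<forall>z\<in>\<V>. \<omega> (\<beta> (x, y)) z = cinner w z)"
  define d where "d = w - \<beta> (y, - x)"
  have "d \<in> \<V>"
    unfolding d_def using w \<beta>_\<V>[OF E_G[OF E_rot[OF assms]]]
    by (intro complex_vector.subspace_diff[OF csub_\<V>]) auto
  then have "cinner w d = cinner (\<beta> (y, - x)) d" using w form by metis
  then have "cinner d d = 0" by (simp add: d_def cinner_diff_left)
  then show "w = \<beta> (y, - x)" by (simp add: d_def)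
qed

text \<open>The deficiency spaces, which \<^term>\<open>\<gamma>\<close> identifies with the eigenspaces of \<^term>\<open>J\<close> up to
  the factor $\sqrt 2$.\<close>

definition "N s = {n. (n, s *\<^sub>C n) \<in> G}"

lemma N_eq: "s = \<i> \<or> s = - \<i> \<Longrightarrow> N s = ortho_compl (shift_op s ` A)"
  using ortho_compl_range_shift by (auto simp: N_def)

lemma csub_N: "s = \<i> \<or> s = - \<i> \<Longrightarrow> csubspace (N s)"
  by (simp add: N_eq csubspace_ortho_compl)

text \<open>Multiplication by s turns (n, s n) into (s n, - n) since s^2 = -1, and rotating this
  element of \<open>G\<close> gives a pair orthogonal to \<open>A\<close>.\<close>

lemma N_E: assumes "s = \<i> \<or> s = - \<i>" and n: "n \<in> N s" shows "(n, s *\<^sub>C n) \<in> E"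
proof -
  have "s *\<^sub>C (n, s *\<^sub>C n) \<in> G"
    using n complex_vector.subspace_scale[OF csubspace_adjoint_op] by (simp add: N_def)
  then have "(s *\<^sub>C n, - n) \<in> G" using assms(1) by (auto simp: scaleC_prod_def scaleC_scaleC)
  then have "(- n, - (s *\<^sub>C n)) \<in> ortho_compl A" by (simp add: adjoint_iff_ortho)
  from complex_vector.subspace_scale[OF csubspace_ortho_compl this, of "-1"]
  show ?thesis using n by (simp add: E_def N_def scaleC_prod_def)
qed

lemma \<beta>_N: "n \<in> N s \<Longrightarrow> \<beta> (n, s *\<^sub>C n) = \<gamma> n"
  by (simp add: N_def \<beta>_G)

lemma N_Domain: "n \<in> N s \<Longrightarrow> n \<in> Domain G"
  by (auto simp: N_def)

text \<open>The pair (n, s n) has twice the squared norm of n, which is the origin of the factors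
  sqrt 2.\<close>

lemma norm_\<gamma>_N: assumes s: "s = \<i> \<or> s = - \<i>" and n: "n \<in> N s" shows "norm (\<gamma> n) = sqrt 2 * norm n"
proof -
  have "norm (\<gamma> n) = norm (n, s *\<^sub>C n)"
    using norm_\<beta>_E[OF N_E[OF assms]] \<beta>_N[OF n] by simp
  also have "\<dots> = sqrt (2 * (norm n)\<^sup>2)" using s by (auto simp: norm_Pair norm_scaleC)
  finally show ?thesis by (simp add: real_sqrt_mult)
qed

lemma inj_\<gamma>_N: assumes s: "s = \<i> \<or> s = - \<i>" shows "inj_on \<gamma> (N s)"
proof (rule inj_onI)
  fix m n assume mn: "m \<in> N s" "n \<in> N s" "\<gamma> m = \<gamma> n"
  have "(-1) *\<^sub>C n \<in> N s" by (rule complex_vector.subspace_scale[OF csub_N[OF s] mn(2)])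
  from \<gamma>_add[OF N_Domain[OF mn(1)] N_Domain[OF this]]
  have "\<gamma> (m + (-1) *\<^sub>C n) = \<gamma> m + (-1) *\<^sub>C \<gamma> n"
    by (simp only: \<gamma>_scale[OF N_Domain[OF mn(2)]])
  then have "norm (m - n) = 0"
    using norm_\<gamma>_N[OF s, of "m - n"] complex_vector.subspace_diff[OF csub_N[OF s] mn(1,2)] mn(3)
      by simp
  then show "m = n" by simp
qed

text \<open>Since \<open>J\<close> is the rotation, an eigenvector lifts to a pair of
  \<open>E\<close> with (y, -x) = s (x, y), hence y = s x.\<close>

lemma eigenspace:
  assumes s: "s = \<i> \<or> s = - \<i>"
  shows "{v \<in> \<V>. J v = s *\<^sub>C v} = \<gamma> ` N s"
proof (intro equalityI subsetI)
  fix v assume v: "v \<in> {v \<in> \<V>. J v = s *\<^sub>C v}"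
  then obtain x y where xy: "(x, y) \<in> E" "v = \<beta> (x, y)" using \<V>_E by blast
  have e: "(y, - x) - s *\<^sub>C (x, y) \<in> E"
    by (intro complex_vector.subspace_diff complex_vector.subspace_scale csub_E E_rot xy)
  have "\<beta> ((y, - x) - s *\<^sub>C (x, y)) = 0"
    using v by (simp add: xy bstruct_eq[OF xy(1)] blinfun.diff_right cblinD[OF cblin_\<beta>])
  then have "(y, - x) - s *\<^sub>C (x, y) = 0" using norm_\<beta>_E[OF e] by simp
  then have y: "y = s *\<^sub>C x" by (simp add: scaleC_prod_def zero_prod_def)
  then have "x \<in> N s" using E_G[OF xy(1)] by (simp add: N_def)
  then show "v \<in> \<gamma> ` N s" using xy y \<beta>_N by auto
next
  fix v assume "v \<in> \<gamma> ` N s"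
  then obtain n where n: "n \<in> N s" "v = \<gamma> n" by blast
  have "J v = \<beta> (s *\<^sub>C n, - n)"
    using bstruct_eq[OF N_E[OF s n(1)]] by (simp add: n \<beta>_N)
  also have "(s *\<^sub>C n, - n) = s *\<^sub>C (n, s *\<^sub>C n)" using s by (auto simp: scaleC_prod_def scaleC_scaleC)
  also have "\<beta> \<dots> = s *\<^sub>C v" by (simp add: cblinD[OF cblin_\<beta>] \<beta>_N n)
  finally show "v \<in> {v \<in> \<V>. J v = s *\<^sub>C v}"
    using n by (auto simp: bvals_def N_Domain)
qed

lemma eig_plus_eq: "eig_plus \<V> J = \<gamma> ` N \<i>"
  using eigenspace[of \<i>] by (simp add: eig_plus_def)

lemma eig_minus_eq: "eig_minus \<V> J = \<gamma> ` N (- \<i>)"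
  using eigenspace[of "-\<i>"] by (simp add: eig_minus_def)

lemma image_\<gamma>_N:
  assumes s: "s = \<i> \<or> s = - \<i>"
  shows csub_image_\<gamma>_N: "csubspace (\<gamma> ` N s)" and closed_image_\<gamma>_N: "closed (\<gamma> ` N s)"
proof -
  let ?D = "(\<lambda>n. (n, s *\<^sub>C n)) ` N s"
  have D: "?D = G \<inter> {p. snd p = s *\<^sub>C fst p}" by (force simp: N_def)
  have eq: "\<gamma> ` N s = \<beta> ` ?D" by (simp add: image_image \<beta>_N cong: image_cong)
  have cs: "csubspace ?D"
    unfolding D by (intro complex_vector.subspace_inter csubspace_adjoint_op)
      (auto simp: complex_vector.subspace_def scaleC_add_right scaleC_prod_def scaleC_scaleC
          mult.commute)
  have cl: "closed ?D"
    unfolding D by (intro closed_Int closed_adjoint_op closed_Collect_eq continuous_intros)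
  show "csubspace (\<gamma> ` N s)" unfolding eq by (intro csubspace_image cblin_\<beta> cs)
  show "closed (\<gamma> ` N s)"
    unfolding eq by (intro closed_isometric_image cl cs) (auto simp: norm_\<beta>_E N_E s)
qed

lemma csub_eig_plus: "csubspace (eig_plus \<V> J)" and closed_eig_plus: "closed (eig_plus \<V> J)"
  using image_\<gamma>_N[of \<i>] by (simp_all add: eig_plus_eq)

lemma ext_G: assumes "adjoint_op B = B" "A \<subseteq> B" shows "B \<subseteq> G"
proof
  fix p assume "p \<in> B"
  then have "p \<in> adjoint_op B" using assms by simp
  then show "p \<in> G" using assms(2) by (auto simp: adjoint_op_def)
qed

lemma \<gamma>_Domain_ext: assumes "adjoint_op B = B" "A \<subseteq> B" shows "\<gamma> ` Domain B = \<beta> ` B"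
  using ext_G[OF assms] by (force simp: \<beta>_G image_iff)

lemma csub_ext: assumes "adjoint_op B = B" "A \<subseteq> B" shows "csubspace (\<gamma> ` Domain B)"
proof -
  interpret self_adjoint_op B by unfold_locales (rule assms)
  show ?thesis by (simp add: \<gamma>_Domain_ext[OF assms] csubspace_image cblin_\<beta> csub)
qed

lemma closed_ext: assumes B: "adjoint_op B = B" "A \<subseteq> B" shows "closed (\<gamma> ` Domain B)"
proof -
  interpret self_adjoint_op B by unfold_locales (rule assms)
  \<comment> \<open>As \<open>B\<close> contains \<open>A\<close>, the component in \<open>A\<close>
    can be removed without leaving \<open>B\<close>; what remains lies in \<open>E\<close>, where
    \<open>\<beta>\<close> is isometric.\<close>
  have "\<beta> ` B = \<beta> ` (B \<inter> E)"
  proof (intro equalityI subsetI)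
    fix v assume "v \<in> \<beta> ` B"
    then obtain p where p: "p \<in> B" "v = \<beta> p" by blast
    have "p - P p \<in> B" using p ext_G[OF B] diff_P_A B by blast
    then have "P p \<in> B" using p complex_vector.subspace_diff[OF csub p(1)] by fastforce
    moreover have "\<beta> (P p) = \<beta> p" by (simp add: \<beta>_apply orth_projection_id[OF csub_E closed_E P_E])
    ultimately show "v \<in> \<beta> ` (B \<inter> E)" using p P_E by (metis IntI imageI)
  qed auto
  moreover have "closed (\<beta> ` (B \<inter> E))"
    by (intro closed_isometric_image closed_Int clos closed_E complex_vector.subspace_inter csub
        csub_E)
      (simp add: norm_\<beta>_E)
  ultimately show ?thesis by (simp add: \<gamma>_Domain_ext[OF assms])
qed

text \<open>\<open>cayley B\<close> carries the range of A + i onto that of A - i, hence the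
  complement of the first into that of the second.\<close>

lemma cayley_N: assumes B: "adjoint_op B = B" "A \<subseteq> B" and n: "n \<in> N \<i>" shows "cayley B n \<in> N (- \<i>)"
proof -
  interpret self_adjoint_op B by unfold_locales (rule assms)
  have "cinner (cayley B n) (shift_op (- \<i>) p) = 0" if "p \<in> A" for p
  proof -
    obtain a a' where p: "p = (a, a')" by force
    have "cinner (cayley B n) (cayley B (a' + \<i> *\<^sub>C a)) = cinner n (a' + \<i> *\<^sub>C a)"
      by (rule unitary_cinner[OF cayley_unitary])
    also have "\<dots> = 0" using n that p by (auto simp: N_eq ortho_compl_def)
    finally show ?thesis using cayley_apply[of a a'] that p B by auto
  qed
  then show ?thesis by (auto simp: N_eq ortho_compl_def)
qed

text \<open>For n = \<xi>' + i \<xi> and k = \<xi>' - i \<xi> the lifts to \<open>E\<close> are (n,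
  i n) and (k, - i k). Their difference is 2 i (\<xi>, \<xi>') and their sum is 2 (\<xi>', - \<xi>):
  one vector from the boundary condition of \<open>B\<close> and one from its image under
  \<open>J\<close>, which is orthogonal to it.\<close>

lemma cayley_\<gamma>:
  assumes B: "adjoint_op B = B" "A \<subseteq> B" and n: "n \<in> N \<i>"
  obtains \<xi> \<xi>' where "(\<xi>, \<xi>') \<in> B" "\<gamma> n - \<gamma> (cayley B n) = (2 * \<i>) *\<^sub>C \<gamma> \<xi>"
    "\<gamma> n + \<gamma> (cayley B n) = 2 *\<^sub>C \<beta> (\<xi>', - \<xi>)" "(\<xi>, \<xi>') \<in> E"
proof -
  interpret self_adjoint_op B by unfold_locales (rule assms)
  obtain \<xi> \<xi>' where x: "(\<xi>, \<xi>') \<in> B" "n = \<xi>' + \<i> *\<^sub>C \<xi>" by (rule cayley_ex)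
  let ?k = "cayley B n"
  have k: "?k = \<xi>' - \<i> *\<^sub>C \<xi>" using cayley_apply[OF x(1)] x by simp
  have kN: "?k \<in> N (- \<i>)" by (rule cayley_N[OF assms])
  have e: "(n, \<i> *\<^sub>C n) \<in> E" "(?k, (- \<i>) *\<^sub>C ?k) \<in> E" using N_E[of \<i>] N_E[of "-\<i>"] n kN by auto
  have g: "\<gamma> n = \<beta> (n, \<i> *\<^sub>C n)" "\<gamma> ?k = \<beta> (?k, (- \<i>) *\<^sub>C ?k)"
    using \<beta>_N[OF n] \<beta>_N[OF kN] by auto
  have "(u, \<i> *\<^sub>C u) - (v, (- \<i>) *\<^sub>C v) = (2 * \<i>) *\<^sub>C (\<xi>, \<xi>')"
    if "u = \<xi>' + \<i> *\<^sub>C \<xi>" "v = \<xi>' - \<i> *\<^sub>C \<xi>" for u v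
    by (simp add: that scaleC_prod_def scaleC_add_right complex_vector.scale_right_diff_distrib
        scaleC_two_ii)
  note d = this[OF x(2) k]
  have "(u, \<i> *\<^sub>C u) + (v, (- \<i>) *\<^sub>C v) = 2 *\<^sub>C (\<xi>', - \<xi>)"
    if "u = \<xi>' + \<i> *\<^sub>C \<xi>" "v = \<xi>' - \<i> *\<^sub>C \<xi>" for u v
    by (simp add: that scaleC_prod_def scaleC_add_right complex_vector.scale_right_diff_distrib
        scaleC_two)
  note s = this[OF x(2) k]
  have 1: "\<gamma> n - \<gamma> ?k = (2 * \<i>) *\<^sub>C \<gamma> \<xi>"
  proof -
    have "\<gamma> n - \<gamma> ?k = (2 * \<i>) *\<^sub>C \<beta> (\<xi>, \<xi>')"
      by (simp only: g d cblinD[OF cblin_\<beta>] flip: blinfun.diff_right)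
    moreover have "(\<xi>, \<xi>') \<in> G" using x(1) ext_G[OF B] by blast
    ultimately show ?thesis by (simp only: \<beta>_G)
  qed
  have 2: "\<gamma> n + \<gamma> ?k = 2 *\<^sub>C \<beta> (\<xi>', - \<xi>)"
    by (simp only: g s cblinD[OF cblin_\<beta>] flip: blinfun.add_right)
  have "(2 * \<i>) *\<^sub>C (\<xi>, \<xi>') \<in> E" unfolding d[symmetric]
    by (rule complex_vector.subspace_diff[OF csub_E e])
  then have "inverse (2 * \<i>) *\<^sub>C ((2 * \<i>) *\<^sub>C (\<xi>, \<xi>')) \<in> E"
    by (rule complex_vector.subspace_scale[OF csub_E])
  then have "(\<xi>, \<xi>') \<in> E" by (simp add: scaleC_scaleC)
  then show ?thesis using that x 1 2 by blast
qed

text \<open>By \<open>cayley_\<gamma>\<close> it is the difference of \<open>\<gamma> n\<close> and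
  \<open>\<gamma> (cayley B n)\<close> that lies in the boundary condition, whence the minus
  sign.\<close>

lemma lag_unitary_eq:
  assumes B: "adjoint_op B = B" "A \<subseteq> B" and n: "n \<in> N \<i>"
  shows "lag_unitary \<V> J (\<gamma> ` Domain B) (\<gamma> n) = - \<gamma> (cayley B n)"
  unfolding lag_unitary_def
proof (rule the_equality)
  interpret self_adjoint_op B by unfold_locales (rule assms)
  let ?L = "\<gamma> ` Domain B"
  note csL = csub_ext[OF B]
  let ?k = "cayley B n"
  have kN: "?k \<in> N (- \<i>)" by (rule cayley_N[OF assms])
  have csm: "csubspace (\<gamma> ` N (- \<i>))" by (simp add: csub_image_\<gamma>_N)
  have in_L: "\<gamma> n + - \<gamma> ?k \<in> ?L"
  proof -
    obtain \<xi> \<xi>' where x: "(\<xi>, \<xi>') \<in> B" "\<gamma> n - \<gamma> ?k = (2 * \<i>) *\<^sub>C \<gamma> \<xi>"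
      using cayley_\<gamma>[OF assms] by metis
    then show ?thesis using complex_vector.subspace_scale[OF csL, of "\<gamma> \<xi>" "2 * \<i>"] by auto
  qed
  then show "- \<gamma> ?k \<in> eig_minus \<V> J \<and> \<gamma> n + - \<gamma> ?k \<in> ?L"
    using complex_vector.subspace_neg[OF csm] kN by (auto simp: eig_minus_eq)
  \<comment> \<open>Two candidates differ by some \<open>\<gamma> m\<close> in the boundary
    condition with m in \<open>N (- \<i>)\<close>. The form vanishes on the pair of
    \<open>\<gamma> m\<close> with itself, but it also equals -2 i |m|^2.\<close>
  fix y assume y: "y \<in> eig_minus \<V> J \<and> \<gamma> n + y \<in> ?L"
  have "y - - \<gamma> ?k \<in> \<gamma> ` N (- \<i>)"
    using y kN complex_vector.subspace_add[OF csm] by (auto simp: eig_minus_eq)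
  then obtain m where m: "m \<in> N (- \<i>)" "y - - \<gamma> ?k = \<gamma> m" by blast
  have "(\<gamma> n + y) - (\<gamma> n + - \<gamma> ?k) \<in> ?L"
    using y in_L complex_vector.subspace_diff[OF csL] by blast
  then have "\<gamma> m \<in> ?L" using m(2) by (simp add: algebra_simps)
  then obtain \<xi> \<xi>' where x: "(\<xi>, \<xi>') \<in> B" "\<gamma> m = \<gamma> \<xi>" by auto
  have xG: "(\<xi>, \<xi>') \<in> G" using x ext_G[OF B] by auto
  have mG: "(m, - \<i> *\<^sub>C m) \<in> G" using m by (simp add: N_def)
  have "\<omega> (\<gamma> m) (\<gamma> m) = 0"
    using bform_eq[OF xG xG] adjoint_opD[OF x(1), of \<xi> \<xi>'] x B by simp
  then have "m = 0" using bform_eq[OF mG mG] by (simp add: cinner_simps)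
  moreover have "\<gamma> 0 = 0" using \<gamma>_A[of 0 0] complex_vector.subspace_0[OF csub_A]
    by (simp add: zero_prod_def)
  ultimately show "y = - \<gamma> ?k" using m(2) by (simp add: eq_neg_iff_add_eq_0)
qed

text \<open>The sum of the two boundary values is orthogonal to the boundary condition, so half
  their difference is the projection. Through this formula the distance of Lagrangians controls the
  distance of Cayley transforms.\<close>

lemma orth_projection_ext:
  assumes B: "adjoint_op B = B" "A \<subseteq> B" and n: "n \<in> N \<i>"
  shows "orth_projection (\<gamma> ` Domain B) (\<gamma> n) = (1/2) *\<^sub>C (\<gamma> n - \<gamma> (cayley B n))"
proof (rule orth_projection_eq[OF csub_ext[OF B] closed_ext[OF B]])
  obtain \<xi> \<xi>' where x: "(\<xi>, \<xi>') \<in> B" "\<gamma> n - \<gamma> (cayley B n) = (2 * \<i>) *\<^sub>C \<gamma> \<xi>"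
    "\<gamma> n + \<gamma> (cayley B n) = 2 *\<^sub>C \<beta> (\<xi>', - \<xi>)" "(\<xi>, \<xi>') \<in> E"
    by (rule cayley_\<gamma>[OF assms])
  show "(1/2) *\<^sub>C (\<gamma> n - \<gamma> (cayley B n)) \<in> \<gamma> ` Domain B"
    unfolding x(2) by (intro complex_vector.subspace_scale csub_ext B) (use x in auto)
  have "\<gamma> n - (1/2) *\<^sub>C (\<gamma> n - \<gamma> (cayley B n)) = (1/2) *\<^sub>C (\<gamma> n + \<gamma> (cayley B n))"
  proof -
    have "\<gamma> n = (1/2) *\<^sub>C \<gamma> n + (1/2) *\<^sub>C \<gamma> n" by simp
    then show ?thesis
      by (simp add: complex_vector.scale_right_diff_distrib scaleC_add_right diff_eq_eq)
  qed
  also have "\<dots> = \<beta> (\<xi>', - \<xi>)" by (simp add: x scaleC_scaleC)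
  also have "\<dots> \<in> ortho_compl (\<gamma> ` Domain B)"
  proof -
    have "cinner (\<beta> (\<xi>', - \<xi>)) (\<beta> (\<eta>, \<eta>')) = 0" if "(\<eta>, \<eta>') \<in> B" for \<eta> \<eta>'
      using adjoint_opD[OF x(1), of \<eta> \<eta>'] that B
      by (simp add: \<beta>_cinner_E[OF E_rot[OF x(4)]] cinner_prod_def cinner_minus_left)
    then show ?thesis unfolding \<gamma>_Domain_ext[OF B] by (auto simp: ortho_compl_def)
  qed
  finally show "\<gamma> n - (1/2) *\<^sub>C (\<gamma> n - \<gamma> (cayley B n)) \<in> ortho_compl (\<gamma> ` Domain B)" .
qed

text \<open>By \<open>bform_eq\<close>, the two inclusions between the operator and its adjoint are
  those between \<open>L\<close> and its annihilator.\<close>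

lemma bc_op_lagrangian:
  assumes L: "lagrangian \<V> \<omega> L"
  shows bc_op_adjoint: "adjoint_op (bc_op A \<gamma> L) = bc_op A \<gamma> L"
    and bc_op_ext: "A \<subseteq> bc_op A \<gamma> L"
    and \<gamma>_Domain_bc_op: "\<gamma> ` Domain (bc_op A \<gamma> L) = L"
proof -
  have L1: "csubspace L" "L \<subseteq> \<V>" and L2: "v \<in> L \<longleftrightarrow> v \<in> \<V> \<and> (\<forall>w\<in>L. \<omega> v w = 0)" for v
    using L unfolding lagrangian_def by blast+
  show ext: "A \<subseteq> bc_op A \<gamma> L"
    using A_G \<gamma>_A complex_vector.subspace_0[OF L1(1)] by (auto simp: bc_op_def)
  show im: "\<gamma> ` Domain (bc_op A \<gamma> L) = L"
    using L1(2) by (force simp: bc_op_def bvals_def)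
  show "adjoint_op (bc_op A \<gamma> L) = bc_op A \<gamma> L"
  proof (intro equalityI subrelI)
    fix y y' assume y: "(y, y') \<in> adjoint_op (bc_op A \<gamma> L)"
    then have yG: "(y, y') \<in> G" using ext by (auto simp: adjoint_op_def)
    have "\<omega> (\<gamma> y) w = 0" if w: "w \<in> L" for w
    proof -
      have "w \<in> \<gamma> ` Domain (bc_op A \<gamma> L)" using w im by blast
      then obtain x x' where x: "(x, x') \<in> bc_op A \<gamma> L" "w = \<gamma> x" by blast
      then have "(x, x') \<in> G" by (simp add: bc_op_def)
      then have "\<omega> (\<gamma> y) w = cinner y' x - cinner y x'" using bform_eq[OF yG] x by simp
      also have "\<dots> = 0"
        using adjoint_opD[OF x(1) y] cinner_commute[of y' x] cinner_commute[of y x'] by simp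
      finally show ?thesis .
    qed
    then have "\<gamma> y \<in> L" using L2[of "\<gamma> y"] yG by (auto simp: bvals_def)
    then show "(y, y') \<in> bc_op A \<gamma> L" using yG by (simp add: bc_op_def)
  next
    fix y y' assume y: "(y, y') \<in> bc_op A \<gamma> L"
    have "cinner x' y = cinner x y'" if x: "(x, x') \<in> bc_op A \<gamma> L" for x x'
    proof -
      have "\<omega> (\<gamma> x) (\<gamma> y) = 0" using L2[of "\<gamma> x"] x y by (auto simp: bc_op_def)
      then show ?thesis using bform_eq[of x x' y y'] x y by (simp add: bc_op_def)
    qed
    then show "(y, y') \<in> adjoint_op (bc_op A \<gamma> L)" by (auto simp: adjoint_op_def)
  qed
qed

end

section \<open>The homotopy\<close>

locale boundary_closed_range = boundary A \<gamma>
  for A :: "'a::chilbert_space operator" and \<gamma> :: "'a \<Rightarrow> 'v::chilbert_space" +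
  assumes closed_range: "closed (Range A)"
begin

abbreviation "K \<equiv> op_ker A"

lemma csub_K: "csubspace K"
  using complex_vector.subspace_0[OF csub_A] op_add[OF csub_A, of _ 0 _ 0] op_scale[OF csub_A, of _
      0]
  by (auto simp: complex_vector.subspace_def op_ker_def zero_prod_def)

lemma closed_K: "closed K"
proof -
  have "K = (\<lambda>x. (x, 0)) -` A" by (auto simp: op_ker_def)
  then show ?thesis by (simp add: closed_vimage closed_A continuous_intros)
qed



text \<open>The injective part of \<open>A\<close>, with the same range.\<close>

definition "A\<^sub>1 = A \<inter> {p. fst p \<in> ortho_compl K}"

lemma csub_A1: "csubspace A\<^sub>1"
  using csub_A csubspace_ortho_compl[of K] unfolding A\<^sub>1_def complex_vector.subspace_def
  by auto

lemma closed_A1: "closed A\<^sub>1"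
proof -
  have "A\<^sub>1 = A \<inter> fst -` ortho_compl K" by (auto simp: A\<^sub>1_def)
  then show ?thesis
    by (simp add: closed_Int closed_A closed_vimage closed_ortho_compl continuous_intros)
qed

lemma A_split:
  assumes "(a, a') \<in> A"
  shows "(orth_projection K a, 0) \<in> A" "(a - orth_projection K a, a') \<in> A\<^sub>1"
proof -
  show 1: "(orth_projection K a, 0) \<in> A"
    using orth_projection_in[OF csub_K closed_K, of a] by (simp add: op_ker_def)
  show "(a - orth_projection K a, a') \<in> A\<^sub>1"
    using op_diff[OF csub_A assms 1] orth_projection_diff[OF csub_K closed_K, of a]
    by (simp add: A\<^sub>1_def)
qed

text \<open>The open mapping theorem for the second projection of the graph yields some preimage of
  controlled norm; injectivity of \<open>A\<^sub>1\<close> identifies it with the given one.\<close>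

lemma A1_bound: obtains C where "C > 0" "\<And>a a'. (a, a') \<in> A\<^sub>1 \<Longrightarrow> norm a \<le> C * norm a'"
proof -
  have R: "snd ` A\<^sub>1 = Range A"
    using A_split(2) by (force simp: A\<^sub>1_def image_iff)
  have "\<exists>C>0. \<forall>y\<in>snd ` A\<^sub>1. \<exists>x\<in>A\<^sub>1. snd x = y \<and> norm x \<le> C * norm y"
    by (rule open_mapping_bound[OF bounded_linear_snd csubspace_imp_subspace[OF csub_A1] closed_A1])
      (simp add: R closed_range)
  then obtain C where C: "C > 0" "\<And>y. y \<in> snd ` A\<^sub>1 \<Longrightarrow> \<exists>x\<in>A\<^sub>1. snd x = y \<and> norm x \<le> C * norm y"
    by blast
  have "norm a \<le> C * norm a'" if a: "(a, a') \<in> A\<^sub>1" for a a'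
  proof -
    have "a' \<in> snd ` A\<^sub>1" using a by force
    then obtain x where x: "x \<in> A\<^sub>1" "snd x = a'" "norm x \<le> C * norm a'" using C(2) by blast
    obtain b where b: "x = (b, a')" using x(2) by (metis prod.collapse)
    have d: "(a - b, 0) \<in> A\<^sub>1" using op_diff[OF csub_A1 a x(1)[unfolded b]] by simp
    then have "a - b \<in> K" "a - b \<in> ortho_compl K" by (auto simp: A\<^sub>1_def op_ker_def)
    then have "cinner (a - b) (a - b) = 0" by (simp add: ortho_compl_def)
    then have "a = b" by simp
    then show ?thesis using x(3) b norm_fst_le[of b a'] by simp
  qed
  with C(1) show ?thesis by (rule that)
qed

text \<open>The self-adjoint extension with boundary condition the Cauchy data space.\<close>

definition "A\<^sub>C = {(k + a, a') |k a a'. (k, 0) \<in> G \<and> (a, a') \<in> A}"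

lemma ker_G: "(k, 0) \<in> G \<longleftrightarrow> k \<in> ortho_compl (Range A)"
  by (auto simp: adjoint_op_def ortho_compl_def cinner_zero_right cinner_eq_0_commute[of k])

lemma A_AC: "A \<subseteq> A\<^sub>C"
proof
  fix p assume "p \<in> A"
  moreover have "(0, 0) \<in> G" using complex_vector.subspace_0[OF csubspace_adjoint_op]
    by (metis zero_prod_def)
  ultimately show "p \<in> A\<^sub>C" unfolding A\<^sub>C_def by (cases p) force
qed

lemma csub_Range: "csubspace (Range A)"
proof -
  have "cblin (snd_blinfun :: ('a \<times> 'a) \<Rightarrow>\<^sub>L 'a)" by (simp add: cblin_def scaleC_prod_def)
  from csubspace_image[OF this csub_A] show ?thesis by (simp add: Range_snd)
qed

lemma adjoint_AC: "adjoint_op A\<^sub>C = A\<^sub>C"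
proof (intro equalityI subrelI)
  fix y y' assume y: "(y, y') \<in> adjoint_op A\<^sub>C"
  have yG: "(y, y') \<in> G" using y A_AC by (auto simp: adjoint_op_def)
  \<comment> \<open>Tested against (k, 0) for k in the kernel of the adjoint. As
    \<open>Range A\<close> is closed, the double complement is \<open>Range A\<close>
    itself.\<close>
  have "y' \<in> ortho_compl (ortho_compl (Range A))"
    unfolding ortho_compl_def[of "ortho_compl (Range A)"]
  proof safe
    fix k assume "k \<in> ortho_compl (Range A)"
    then have "(k, 0) \<in> A\<^sub>C"
      using complex_vector.subspace_0[OF csub_A] unfolding A\<^sub>C_def ker_G[symmetric]
      by (force simp: zero_prod_def)
    then have "cinner 0 y = cinner k y'" using y by (rule adjoint_opD)
    then show "cinner y' k = 0" by (simp add: cinner_zero_left cinner_eq_0_commute[of y'])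
  qed
  then have "y' \<in> Range A" by (simp add: ortho_compl_ortho_compl[OF csub_Range closed_range])
  then obtain a where a: "(a, y') \<in> A" by blast
  then have "(y - a, 0) \<in> G" using op_diff[OF csubspace_adjoint_op yG, of a y'] A_G by auto
  then have "((y - a) + a, y') \<in> A\<^sub>C" using a unfolding A\<^sub>C_def by blast
  then show "(y, y') \<in> A\<^sub>C" by simp
next
  fix y y' assume "(y, y') \<in> A\<^sub>C"
  then obtain k a where y: "y = k + a" "(k, 0) \<in> G" "(a, y') \<in> A" by (auto simp: A\<^sub>C_def)
  have "cinner x' y = cinner x y'" if x: "(x, x') \<in> A\<^sub>C" for x x'
  proof -
    obtain l b where b: "x = l + b" "(l, 0) \<in> G" "(b, x') \<in> A" using x by (auto simp: A\<^sub>C_def)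
    have "cinner x' k = 0" "cinner y' l = 0" "cinner x' a = cinner b y'"
      using adjoint_opD[OF b(3) y(2)] adjoint_opD[OF y(3) b(2)] adjoint_opD[OF b(3), of a y'] y(3)
          A_G
      by (auto simp: cinner_zero_right)
    then show ?thesis using cinner_eq_0_commute[of l y'] by (simp add: y b cinner_simps)
  qed
  then show "(y, y') \<in> adjoint_op A\<^sub>C" by (auto simp: adjoint_op_def)
qed

lemma \<gamma>_Domain_AC: "\<gamma> ` Domain A\<^sub>C = cauchy_data A \<gamma>"
proof -
  have "\<gamma> (k + a) = \<gamma> k" if "(k, 0) \<in> G" "(a, a') \<in> A" for k a a'
    using that A_G \<gamma>_A by (subst \<gamma>_add) auto
  moreover have "(0, 0) \<in> A" using complex_vector.subspace_0[OF csub_A] by (simp add: zero_prod_def)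
  ultimately show ?thesis
    unfolding cauchy_data_def op_ker_def A\<^sub>C_def by (force simp: image_iff Domain_iff)
qed

sublocale AC: self_adjoint_op A\<^sub>C
  by unfold_locales (rule adjoint_AC)

abbreviation "\<kappa>\<^sub>C \<equiv> cayley A\<^sub>C"

text \<open>The component of a in \<open>K\<close> is moved over to k, since the kernel of
  \<open>A\<close> is contained in that of the adjoint.\<close>

lemma AC_decomposition:
  assumes "(c, c') \<in> A\<^sub>C"
  obtains k b where "c = k + b" "(k, 0) \<in> G" "(b, c') \<in> A\<^sub>1"
proof -
  obtain k a where a: "c = k + a" "(k, 0) \<in> G" "(a, c') \<in> A" using assms by (auto simp: A\<^sub>C_def)
  have "(k + orth_projection K a, 0 + 0) \<in> G"
    using A_split(1)[OF a(3)] A_G a(2) by (intro op_add csubspace_adjoint_op) auto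
  then show ?thesis
    using that[of "k + orth_projection K a" "a - orth_projection K a"] a A_split(2)[OF a(3)] by simp
qed

text \<open>\<open>R\<close> and \<open>K\<close> together make up the range of A + i, so the
  complement of \<open>R\<close> is the orthogonal sum of \<open>N \<i>\<close> and
  \<open>K\<close>.\<close>

definition "R = shift_op \<i> ` A\<^sub>1"

lemma csub_R: "csubspace R"
  unfolding R_def by (intro csubspace_image cblin_shift_op csub_A1)

lemma closed_R: "closed R"
  unfolding R_def
  by (intro closed_isometric_image closed_A1 csub_A1 norm_shift_op[OF A_G]) (auto simp: A\<^sub>1_def)

text \<open>Reflecting the Cayley transform of \<^term>\<open>A\<^sub>C\<close> on the complement of \<^term>\<open>R\<close> gives the
  unitary along whose Cayley path the Cayley transforms of all extensions are deformed. In
  Lagrangian terms it belongs to the sum of the Cauchy data space, the kernel of \<^term>\<open>A\<close> and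
  the rotated graph of \<^term>\<open>A\<^sub>1\<close>.\<close>

definition "w = \<kappa>\<^sub>C o\<^sub>L phase (ortho_compl R) (-1)"

lemma w_unitary: "w \<in> unitaries UNIV"
  unfolding w_def
  by (intro unitaries_compose AC.cayley_unitary phase_unitary csubspace_ortho_compl
      closed_ortho_compl) simp

lemma w_R: "r \<in> R \<Longrightarrow> w r = \<kappa>\<^sub>C r"
proof -
  assume "r \<in> R"
  then have "r \<in> ortho_compl (ortho_compl R)"
    by (simp add: ortho_compl_ortho_compl[OF csub_R closed_R])
  then show ?thesis
    by (simp add: w_def phase_apply orth_projection_zero[OF csubspace_ortho_compl
        closed_ortho_compl])
qed

lemma w_perp: "f \<in> ortho_compl R \<Longrightarrow> w f = - \<kappa>\<^sub>C f"
proof -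
  assume "f \<in> ortho_compl R"
  then have "phase (ortho_compl R) (-1) f = f + (-2) *\<^sub>C f"
    by (simp add: phase_apply orth_projection_id[OF csubspace_ortho_compl closed_ortho_compl])
  also have "\<dots> = - f" by (simp add: scaleC_two)
  finally show ?thesis by (simp add: w_def blinfun.minus_right)
qed

lemma w_plus_R: assumes "(a, a') \<in> A\<^sub>1" shows "w (a' + \<i> *\<^sub>C a) + (a' + \<i> *\<^sub>C a) = 2 *\<^sub>R a'"
proof -
  have "a' + \<i> *\<^sub>C a \<in> R" using assms unfolding R_def by force
  moreover have "(a, a') \<in> A\<^sub>C" using assms A_AC by (auto simp: A\<^sub>1_def)
  ultimately show ?thesis by (simp add: w_R AC.cayley_apply scaleR_2)
qed

lemma w_plus_perp:
  assumes "(c, c') \<in> A\<^sub>C" "c' + \<i> *\<^sub>C c \<in> ortho_compl R"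
  shows "w (c' + \<i> *\<^sub>C c) + (c' + \<i> *\<^sub>C c) = 2 *\<^sub>R \<i> *\<^sub>C c"
  using assms by (simp add: w_perp AC.cayley_apply scaleR_2)

text \<open>For y = r + f with r = a' + i a in \<open>R\<close> and f = c' + i c orthogonal to it,
  (w + 1) y = 2 (a' + i c), so a' and c must be controlled by their combination u. The summand k of
  c in the kernel of the adjoint separates them: it is orthogonal to the range of \<open>A\<close>,
  which contains a', and <c, k> is the full squared graph norm of c. All other terms are bounded by
  \<open>A1_bound\<close>.\<close>

lemma w_plus_one_bounded_below: obtains e where "e > 0" "\<And>y. e * norm y \<le> norm (w y + y)"
proof -
  obtain C where C: "C > 0" "\<And>a a'. (a, a') \<in> A\<^sub>1 \<Longrightarrow> norm a \<le> C * norm a'" by (rule A1_bound) blast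
  \<comment> \<open>Bounds k = c - b by the graph norm of c: 1 accounts for c and \<open>C\<close>
    for b.\<close>
  define M where "M = 1 + C"
  have M: "M \<ge> 1" using C by (simp add: M_def)
  have "norm y \<le> ((3 + M) * M) * norm (w y + y)" for y
  proof -
    define r f where "r = orth_projection R y" and "f = y - r"
    have "r \<in> R" and f: "f \<in> ortho_compl R" and y: "y = r + f"
      by (simp_all add: r_def f_def orth_projection_in orth_projection_diff csub_R closed_R)
    then obtain a a' where a: "(a, a') \<in> A\<^sub>1" "r = a' + \<i> *\<^sub>C a" by (auto simp: R_def)
    obtain c c' where c: "(c, c') \<in> A\<^sub>C" "f = c' + \<i> *\<^sub>C c" by (rule AC.cayley_ex)
    obtain k b where b: "c = k + b" "(k, 0) \<in> G" "(b, c') \<in> A\<^sub>1" by (rule AC_decomposition[OF c(1)])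
    define u where "u = a' + \<i> *\<^sub>C c"
    have "w y + y = (w r + r) + (w f + f)" by (simp add: y blinfun.add_right)
    also have "\<dots> = 2 *\<^sub>R u"
      using w_plus_R[OF a(1)] w_plus_perp[OF c(1)] f by (simp add: a c u_def scaleR_add_right)
    finally have wy: "norm (w y + y) = 2 * norm u" by simp
    define m where "m = norm (c, c')"
    have m: "norm c \<le> m" "norm c' \<le> m" "m\<^sup>2 = (norm c)\<^sup>2 + (norm c')\<^sup>2"
      using norm_fst_le[of c c'] norm_snd_le[of c' c] by (simp_all add: m_def norm_Pair)
    \<comment> \<open>Orthogonality of f to \<open>R\<close>, read in the graph inner product, which
      \<open>shift_op \<i>\<close> preserves on \<open>A\<^sub>C\<close>.\<close>
    have "cinner (c, c') (b, c') = cinner (shift_op \<i> (c, c')) (shift_op \<i> (b, c'))"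
      using c(1) b(3) A_AC
      by (intro isometry_cinner[where S = A\<^sub>C, symmetric] AC.csub)
        (auto simp: A\<^sub>1_def blinfun.add_right cblinD[OF cblin_shift_op] AC.norm_shift simp del:
            shift_op_apply)
    also have "\<dots> = 0"
    proof -
      have "shift_op \<i> (b, c') \<in> R" using b(3) unfolding R_def by blast
      then show ?thesis using f by (simp add: c(2) ortho_compl_def)
    qed
    finally have "cinner c b + cinner c' c' = 0" by (simp add: cinner_prod_def)
    then have "cinner c k = cinner c c + cinner c' c'"
      by (simp add: b(1) cinner_add_right)
    also have "\<dots> = of_real (m\<^sup>2)" by (simp add: cinner_self m(3))
    finally have ck: "cinner c k = of_real (m\<^sup>2)" .
    have "cinner a' k = 0"
      using adjoint_opD[of a a' A k 0] a(1) b(2) by (auto simp: A\<^sub>1_def cinner_zero_right)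
    then have "cinner u k = \<i> * of_real (m\<^sup>2)" by (simp add: u_def cinner_simps ck)
    then have "m\<^sup>2 = cmod (cinner u k)" by (simp add: norm_mult norm_power)
    also have "\<dots> \<le> norm u * norm k" by (rule norm_cinner_le)
    finally have mk: "m\<^sup>2 \<le> norm u * norm k" .
    have "norm k \<le> M * m"
    proof -
      have "norm k \<le> norm c + norm b" using norm_triangle_ineq4[of c b] by (simp add: b(1))
      moreover have "norm b \<le> C * norm c'" by (rule C(2)[OF b(3)])
      moreover have "\<dots> \<le> C * m" using m C by (simp add: mult_left_mono)
      ultimately show ?thesis using m by (simp add: M_def algebra_simps)
    qed
    from mk mult_left_mono[OF this norm_ge_zero[of u]] have "m * m \<le> m * (M * norm u)"
      by (simp add: power2_eq_square algebra_simps)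
    moreover have "m \<ge> 0" by (simp add: m_def)
    ultimately have mu: "m \<le> M * norm u" using M by (cases "m = 0") auto
    have "norm a' \<le> norm u + norm c"
      using norm_triangle_ineq4[of u "\<i> *\<^sub>C c"] by (simp add: u_def norm_scaleC)
    then have a'u: "norm a' \<le> (1 + M) * norm u" using m mu by (simp add: algebra_simps)
    have "norm y \<le> norm r + norm f" unfolding y by (rule norm_triangle_ineq)
    moreover have "norm r \<le> norm a' + norm a"
      using norm_triangle_ineq[of a' "\<i> *\<^sub>C a"] by (simp add: a norm_scaleC)
    moreover have "norm a \<le> C * norm a'" by (rule C(2)[OF a(1)])
    moreover have "norm f \<le> norm c' + norm c"
      using norm_triangle_ineq[of c' "\<i> *\<^sub>C c"] by (simp add: c norm_scaleC)
    ultimately have "norm y \<le> M * norm a' + 2 * m" using m by (simp add: M_def algebra_simps)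
    also have "\<dots> \<le> M * ((1 + M) * norm u) + 2 * (M * norm u)"
      using a'u mu M by (intro add_mono mult_left_mono) auto
    also have "\<dots> = ((3 + M) * M) * norm u" by (simp add: algebra_simps)
    also have "\<dots> \<le> ((3 + M) * M) * norm (w y + y)"
      unfolding wy using M by (intro mult_left_mono) auto
    finally show ?thesis .
  qed
  moreover have "(3 + M) * M > 0" using M by simp
  ultimately show ?thesis
    by (intro that[of "inverse ((3 + M) * M)"]) (simp_all add: field_simps del: mult_pos_pos)
qed

lemma w_cayley_path:
  obtains Y where "skew Y" "cayley_path Y 1 = w" "\<And>f. f \<in> ortho_compl R \<Longrightarrow> Y f \<in> R"
proof -
  obtain e where e: "e > 0" "\<And>y. e * norm y \<le> norm (w y + y)"
    by (rule w_plus_one_bounded_below) blast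
  obtain H where H: "cblin H" "H o\<^sub>L (w + id_blinfun) = id_blinfun" "(w + id_blinfun) o\<^sub>L H
      = id_blinfun"
    using unitary_plus_one_inverse[OF w_unitary e] by blast
  define Y where "Y = id_blinfun - 2 *\<^sub>R H"
  have "Y f \<in> R" if f: "f \<in> ortho_compl R" for f
  proof -
    obtain c c' where c: "(c, c') \<in> A\<^sub>C" "f = c' + \<i> *\<^sub>C c" by (rule AC.cayley_ex)
    obtain k b where b: "c = k + b" "(k, 0) \<in> G" "(b, c') \<in> A\<^sub>1" by (rule AC_decomposition[OF c(1)])
    \<comment> \<open>Chosen so that (w + 1) (u + f) = 2 c' + 2 i c = 2 f, which gives Y f = f - 2 H
      f = - u.\<close>
    define u where "u = c' + \<i> *\<^sub>C b"
    have u: "u \<in> R" using b(3) unfolding R_def u_def by force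
    have "w (u + f) + (u + f) = (w u + u) + (w f + f)" by (simp add: blinfun.add_right)
    also have "\<dots> = 2 *\<^sub>R f"
      using w_plus_R[OF b(3)] w_plus_perp[OF c(1)] f by (simp add: c u_def scaleR_add_right)
    finally have "H (2 *\<^sub>R f) = u + f"
      using arg_cong[OF H(2), of "\<lambda>v. blinfun_apply v (u + f)"] by (simp add: blinfun.add_left)
    then have "Y f = (-1) *\<^sub>C u"
      by (simp add: Y_def blinfun.diff_left blinfun.scaleR_left blinfun.scaleR_right)
    then show ?thesis using complex_vector.subspace_scale[OF csub_R u, of "-1"] by simp
  qed
  then show ?thesis using that cayley_path_1[OF w_unitary H] by (simp add: Y_def)
qed

text \<open>For (a, a') in \<open>A\<^sub>1\<close>, a vector of \<open>K\<close> is orthogonal to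
  a' by symmetry of \<open>A\<close> and to a by the definition of \<open>A\<^sub>1\<close>.\<close>

lemma K_perp_R: "K \<subseteq> ortho_compl R"
proof
  fix k assume k: "k \<in> K"
  have "cinner k (a' + \<i> *\<^sub>C a) = 0" if "(a, a') \<in> A\<^sub>1" for a a'
  proof -
    have "cinner 0 a = cinner k a'"
      using k that A_G by (intro adjoint_opD[of k 0 A]) (auto simp: op_ker_def A\<^sub>1_def)
    moreover have "cinner k a = 0"
      using k that by (auto simp: A\<^sub>1_def ortho_compl_def cinner_eq_0_commute[of k])
    ultimately show ?thesis by (simp add: cinner_simps)
  qed
  then show "k \<in> ortho_compl R" by (auto simp: ortho_compl_def R_def)
qed

lemma N_perp_R: "N \<i> \<subseteq> ortho_compl R"
  unfolding R_def by (auto simp: N_eq ortho_compl_def A\<^sub>1_def)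

lemma N_perp_K: "n \<in> N \<i> \<Longrightarrow> n \<in> ortho_compl K"
  unfolding ortho_compl_def
proof safe
  fix k assume n: "n \<in> N \<i>" and k: "k \<in> K"
  then have "shift_op \<i> (k, 0) \<in> shift_op \<i> ` A" by (intro imageI) (simp add: op_ker_def)
  then have "cinner n (\<i> *\<^sub>C k) = 0" using n by (auto simp: N_eq ortho_compl_def)
  then show "cinner n k = 0" by (simp add: cinner_scaleC_right)
qed

text \<open>On \<^term>\<open>N \<i>\<close>, \<^term>\<open>q B\<close> is the unitary of the pair of boundary conditions of
  \<^term>\<open>B\<close> and \<^term>\<open>A\<^sub>C\<close>. On the complement it is $1$ on \<^term>\<open>R\<close> and $-1$ on \<^term>\<open>K\<close>,
  which \<^term>\<open>q\<^sub>0 B\<close> corrects.\<close>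

definition "q B = inv_blinfun w o\<^sub>L cayley B"
definition "q\<^sub>0 B = q B o\<^sub>L phase K (-1)"

abbreviation "\<Lambda> \<equiv> eig_plus \<V> J"

definition "\<psi> = inv_into (N \<i>) \<gamma>"

lemma \<psi>: "v \<in> \<Lambda> \<Longrightarrow> \<psi> v \<in> N \<i>" "v \<in> \<Lambda> \<Longrightarrow> \<gamma> (\<psi> v) = v" "n \<in> N \<i> \<Longrightarrow> \<psi> (\<gamma> n) = n"
  using inj_\<gamma>_N[of \<i>] by (auto simp: \<psi>_def eig_plus_eq)

lemma \<psi>_add: "u \<in> \<Lambda> \<Longrightarrow> v \<in> \<Lambda> \<Longrightarrow> \<psi> (u + v) = \<psi> u + \<psi> v"
proof -
  assume uv: "u \<in> \<Lambda>" "v \<in> \<Lambda>"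
  have "u + v = \<gamma> (\<psi> u + \<psi> v)" using \<gamma>_add[OF N_Domain[OF \<psi>(1)] N_Domain[OF \<psi>(1)]] uv
    by (simp add: \<psi>)
  then show ?thesis using \<psi> uv complex_vector.subspace_add[OF csub_N[of \<i>]] by auto
qed

lemma \<psi>_scale: "v \<in> \<Lambda> \<Longrightarrow> \<psi> (c *\<^sub>C v) = c *\<^sub>C \<psi> v"
proof -
  assume v: "v \<in> \<Lambda>"
  have "c *\<^sub>C v = \<gamma> (c *\<^sub>C \<psi> v)" using \<gamma>_scale[OF N_Domain[OF \<psi>(1)[OF v]]] v by (simp add: \<psi>)
  then show ?thesis using \<psi> v complex_vector.subspace_scale[OF csub_N[of \<i>]] by auto
qed

lemma norm_\<psi>: "v \<in> \<Lambda> \<Longrightarrow> norm v = sqrt 2 * norm (\<psi> v)"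
  using norm_\<gamma>_N[of \<i> "\<psi> v"] \<psi> by simp

context
  fixes B assumes B: "adjoint_op B = B" "A \<subseteq> B"
begin

interpretation B: self_adjoint_op B by unfold_locales (rule B)

lemma q_unitary: "q B \<in> unitaries UNIV"
  unfolding q_def by (intro unitaries_compose inv_unitary_unitary w_unitary B.cayley_unitary)

lemma q0_unitary: "q\<^sub>0 B \<in> unitaries UNIV"
  unfolding q\<^sub>0_def by (intro unitaries_compose q_unitary phase_unitary csub_K closed_K) simp

lemma w_q: "w (q B x) = cayley B x"
  by (simp add: q_def w_unitary)

lemma cayley_shift: assumes "p \<in> A" shows "cayley B (shift_op \<i> p) = \<kappa>\<^sub>C (shift_op \<i> p)"
proof -
  obtain a a' where p: "p = (a, a')" by force
  then have "(a, a') \<in> B" "(a, a') \<in> A\<^sub>C" using assms B A_AC by auto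
  then show ?thesis by (simp add: p B.cayley_apply AC.cayley_apply)
qed

lemma q_R: assumes "r \<in> R" shows "q B r = r"
proof -
  have "cayley B r = \<kappa>\<^sub>C r" using assms cayley_shift by (auto simp: R_def A\<^sub>1_def)
  also have "\<dots> = w r" using w_R[OF assms] by simp
  finally show ?thesis by (simp add: q_def w_unitary)
qed

text \<open>Every Cayley transform here is -1 on \<open>K\<close>. As \<open>K\<close> is orthogonal
  to \<open>R\<close>, the sign in \<open>w\<close> makes \<open>w\<close> the identity
  there.\<close>

lemma q_K: assumes "k \<in> K" shows "q B k = - k"
proof -
  have k: "(k, 0) \<in> B" "(k, 0) \<in> A\<^sub>C" using assms B A_AC by (auto simp: op_ker_def)
  have *: "u k = - k" if "u (0 + \<i> *\<^sub>C k) = 0 - \<i> *\<^sub>C k" "cblin u" for u :: "'a \<Rightarrow>\<^sub>L 'a"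
  proof -
    have "\<i> *\<^sub>C u k = \<i> *\<^sub>C (- k)" using that by (simp add: cblinD)
    then have "(- \<i>) *\<^sub>C \<i> *\<^sub>C u k = (- \<i>) *\<^sub>C \<i> *\<^sub>C (- k)" by (simp only:)
    then show ?thesis by (simp only: scaleC_scaleC) simp
  qed
  have "cayley B k = - k" "\<kappa>\<^sub>C k = - k"
    using *[OF B.cayley_apply[OF k(1)]] *[OF AC.cayley_apply[OF k(2)]]
    by (simp_all add: unitary_cblin B.cayley_unitary AC.cayley_unitary)
  moreover have "w k = k" using w_perp[of k] K_perp_R assms calculation(2) by auto
  ultimately have "w (q B k) = w (- k)" by (simp add: w_q blinfun.minus_right)
  then show ?thesis by (metis inv_unitary_left w_unitary)
qed

text \<open>The range of A + i is the orthogonal sum of \<open>R\<close> and \<open>K\<close>: on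
  \<open>R\<close> both factors of \<open>q\<^sub>0 B\<close> are trivial, on \<open>K\<close> their
  signs cancel.\<close>

lemma q0_shift: assumes "p \<in> A" shows "q\<^sub>0 B (shift_op \<i> p) = shift_op \<i> p"
proof -
  obtain a a' where p: "p = (a, a')" by force
  let ?k = "orth_projection K a"
  note s = A_split[OF assms[unfolded p]]
  define r where "r = a' + \<i> *\<^sub>C (a - ?k)"
  have r: "r \<in> R" using s(2) unfolding R_def r_def by force
  have k: "?k \<in> K" using s(1) by (simp add: op_ker_def)
  have ik: "\<i> *\<^sub>C ?k \<in> K" using complex_vector.subspace_scale[OF csub_K k] .
  have eq: "shift_op \<i> p = r + \<i> *\<^sub>C ?k"
    by (simp add: p r_def complex_vector.scale_right_diff_distrib)
  have "r \<in> ortho_compl K"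
    using K_perp_R r by (force simp: ortho_compl_def cinner_eq_0_commute[of r])
  then have "phase K (-1) r = r"
    by (simp add: phase_apply orth_projection_zero[OF csub_K closed_K])
  moreover have "phase K (-1) (\<i> *\<^sub>C ?k) = - (\<i> *\<^sub>C ?k)"
  proof -
    have "phase K (-1) (\<i> *\<^sub>C ?k) = \<i> *\<^sub>C ?k + (-2) *\<^sub>C (\<i> *\<^sub>C ?k)"
      by (simp add: phase_apply orth_projection_id[OF csub_K closed_K ik])
    also have "\<dots> = - (\<i> *\<^sub>C ?k)"
      unfolding complex_vector.scale_minus_left scaleC_two by simp
    finally show ?thesis .
  qed
  ultimately show ?thesis
    unfolding eq q\<^sub>0_def by (simp add: blinfun.add_right q_R[OF r] blinfun.minus_right q_K[OF ik])
qed

text \<open>Fixing the range of A + i, the unitary \<open>q\<^sub>0 B\<close> preserves its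
  complement \<open>N \<i>\<close>. There the phase is trivial and \<open>w\<close> is the negative
  of \<open>\<kappa>\<^sub>C\<close>, so \<open>q\<^sub>0 B\<close> followed by
  \<open>\<kappa>\<^sub>C\<close> is the negative of \<open>cayley B\<close>.\<close>

lemma q0_N: assumes n: "n \<in> N \<i>" shows "q\<^sub>0 B n \<in> N \<i>" "\<gamma> (\<kappa>\<^sub>C (q\<^sub>0 B n)) = - \<gamma> (cayley B n)"
proof -
  have "cinner (q\<^sub>0 B n) (shift_op \<i> p) = 0" if "p \<in> A" for p
    using unitary_cinner[OF q0_unitary, of n "shift_op \<i> p"] n that
    by (simp add: q0_shift N_eq ortho_compl_def del: shift_op_apply)
  then show N: "q\<^sub>0 B n \<in> N \<i>" by (auto simp: N_eq ortho_compl_def simp del: shift_op_apply)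
  have "phase K (-1) n = n"
    by (simp add: phase_apply orth_projection_zero[OF csub_K closed_K N_perp_K[OF n]])
  then have "w (q\<^sub>0 B n) = cayley B n" by (simp add: q\<^sub>0_def w_q)
  moreover have "w (q\<^sub>0 B n) = - \<kappa>\<^sub>C (q\<^sub>0 B n)" using w_perp N N_perp_R by blast
  ultimately have "\<kappa>\<^sub>C (q\<^sub>0 B n) = (-1) *\<^sub>C cayley B n" by (metis minus_minus scaleC_minus1)
  then show "\<gamma> (\<kappa>\<^sub>C (q\<^sub>0 B n)) = - \<gamma> (cayley B n)"
    using \<gamma>_scale[OF N_Domain[OF cayley_N[OF B n]], of "-1"] by simp
qed

text \<open>Through \<open>\<gamma>\<close>, the unitaries of the Cauchy data space and of the
  boundary condition of \<open>B\<close> become the negatives of \<open>\<kappa>\<^sub>C\<close> and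
  \<open>cayley B\<close> on \<open>N \<i>\<close>. These two signs cancel in the quotient, and the
  sign in \<open>pair_unitary\<close> is the one in \<open>q0_N\<close>.\<close>

lemma pair_unitary:
  shows pair_unitary_apply: "v \<in> \<Lambda> \<Longrightarrow> pair_unitary \<V> J (\<gamma> ` Domain B) (cauchy_data A \<gamma>) v
      = \<gamma> (q\<^sub>0 B (\<psi> v))"
    and cblin_pair_unitary: "cblin (pair_unitary \<V> J (\<gamma> ` Domain B) (cauchy_data A \<gamma>))"
proof -
  let ?P = "orth_projection \<Lambda>"
  note P = orth_projection_in[OF csub_eig_plus closed_eig_plus]
  let ?uC = "lag_unitary \<V> J (cauchy_data A \<gamma>)" and ?uL = "lag_unitary \<V> J (\<gamma> ` Domain B)"
  define f where "f v = \<gamma> (q\<^sub>0 B (\<psi> (?P v)))" for v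
  have uC: "?uC (\<gamma> n) = - \<gamma> (\<kappa>\<^sub>C n)" if "n \<in> N \<i>" for n
    using lag_unitary_eq[OF adjoint_AC A_AC that] by (simp add: \<gamma>_Domain_AC)
  have inj: "inj_on ?uC \<Lambda>"
  proof (rule inj_onI)
    fix u v assume uv: "u \<in> \<Lambda>" "v \<in> \<Lambda>" "?uC u = ?uC v"
    have "\<gamma> (\<kappa>\<^sub>C (\<psi> u)) = \<gamma> (\<kappa>\<^sub>C (\<psi> v))" using uC[of "\<psi> u"] uC[of "\<psi> v"] uv \<psi> by simp
    then have "\<kappa>\<^sub>C (\<psi> u) = \<kappa>\<^sub>C (\<psi> v)"
      using inj_\<gamma>_N[of "-\<i>"] cayley_N[OF adjoint_AC A_AC] \<psi>(1) uv by (auto dest: inj_onD)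
    then have "\<psi> u = \<psi> v" by (metis AC.cayley_unitary inv_unitary_left)
    then show "u = v" using \<psi>(2) uv by metis
  qed
  have "- inv_into \<Lambda> ?uC (?uL (?P v)) = f v" for v
  proof -
    define n where "n = \<psi> (?P v)"
    have n: "n \<in> N \<i>" "?P v = \<gamma> n" using \<psi> P by (simp_all add: n_def)
    \<comment> \<open>The preimage under \<open>?uC\<close>, which \<open>pair_unitary\<close> still
      negates; hence the sign.\<close>
    let ?m = "(-1) *\<^sub>C q\<^sub>0 B n"
    have mN: "?m \<in> N \<i>" using complex_vector.subspace_scale[OF csub_N q0_N(1)[OF n(1)]] by blast
    have "?uL (?P v) = - \<gamma> (cayley B n)" using lag_unitary_eq[OF B n(1)] n(2) by simp
    also have "\<dots> = \<gamma> (\<kappa>\<^sub>C (q\<^sub>0 B n))" using q0_N(2)[OF n(1)] by simp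
    also have "\<dots> = ?uC (\<gamma> ?m)"
      using \<gamma>_scale[OF N_Domain[OF cayley_N[OF adjoint_AC A_AC q0_N(1)[OF n(1)]]], of "-1"]
      unfolding uC[OF mN]
        by (simp add: cblinD[OF unitary_cblin[OF AC.cayley_unitary]] blinfun.minus_right)
    finally have "inv_into \<Lambda> ?uC (?uL (?P v)) = \<gamma> ?m"
      using inv_into_f_f[OF inj, of "\<gamma> ?m"] mN by (simp add: eig_plus_eq del: scaleC_minus1)
    also have "\<dots> = (-1) *\<^sub>C \<gamma> (q\<^sub>0 B n)" by (rule \<gamma>_scale[OF N_Domain[OF q0_N(1)[OF n(1)]]])
    finally show ?thesis by (simp add: f_def n_def)
  qed
  then have def: "pair_unitary \<V> J (\<gamma> ` Domain B) (cauchy_data A \<gamma>) = Blinfun f"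
    by (simp add: pair_unitary_def)
  have scale: "f (c *\<^sub>C v) = c *\<^sub>C f v" for c v
    using \<gamma>_scale[OF N_Domain[OF q0_N(1)[OF \<psi>(1)[OF P]]]]
    by (simp add: f_def cblinD[OF cblin_orth_projection[OF csub_eig_plus closed_eig_plus]] \<psi>_scale P
        cblinD[OF unitary_cblin[OF q0_unitary]])
  have "bounded_linear f"
  proof (rule bounded_linear_intro[where K = "norm ?P"])
    show "f (u + v) = f u + f v" for u v
      using \<gamma>_add[OF N_Domain[OF q0_N(1)[OF \<psi>(1)[OF P]]] N_Domain[OF q0_N(1)[OF \<psi>(1)[OF P]]]]
      by (simp add: f_def blinfun.add_right \<psi>_add P)
    show "f (r *\<^sub>R v) = r *\<^sub>R f v" for r v using scale by (simp add: scaleR_scaleC)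
    show "norm (f v) \<le> norm v * norm ?P" for v
    proof -
      have "norm (f v) = sqrt 2 * norm (\<psi> (?P v))"
        using norm_\<gamma>_N[OF _ q0_N(1)[OF \<psi>(1)[OF P]]] by (simp add: f_def unitary_norm[OF q0_unitary])
      also have "\<dots> = norm (?P v)" using norm_\<psi>[OF P] by simp
      also have "\<dots> \<le> norm ?P * norm v" by (rule norm_blinfun)
      finally show ?thesis by (simp add: mult.commute)
    qed
  qed
  then have *: "blinfun_apply (pair_unitary \<V> J (\<gamma> ` Domain B) (cauchy_data A \<gamma>)) = f"
    by (simp add: def bounded_linear_Blinfun_apply)
  show "cblin (pair_unitary \<V> J (\<gamma> ` Domain B) (cauchy_data A \<gamma>))"
    by (simp add: cblin_def * scale)
  show "v \<in> \<Lambda> \<Longrightarrow> pair_unitary \<V> J (\<gamma> ` Domain B) (cauchy_data A \<gamma>) v = \<gamma> (q\<^sub>0 B (\<psi> v))"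
    by (simp add: * f_def orth_projection_id[OF csub_eig_plus closed_eig_plus])
qed

end

end

text \<open>\<open>X\<close> is an arbitrary space and \<open>f\<close> is not presented as a
  function of \<open>g\<close>, so an estimate between pairs of points takes the place of a
  composition.\<close>

lemma continuous_map_Lipschitz:
  fixes f :: "'x \<Rightarrow> 'b::metric_space" and g :: "'x \<Rightarrow> 'c::metric_space"
  assumes g: "continuous_map X euclidean g" and C: "C > 0"
    and fg: "\<And>x y. x \<in> topspace X \<Longrightarrow> y \<in> topspace X \<Longrightarrow> dist (f x) (f y) \<le> C * dist (g x) (g y)"
  shows "continuous_map X euclidean f"
  unfolding mtopology_is_euclidean[symmetric] Met_TC.continuous_map_to_metric
proof (intro ballI allI impI)
  fix x and e :: real assume x: "x \<in> topspace X" and e: "e > 0"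
  define U where "U = {y \<in> topspace X. g y \<in> ball (g x) (e / C)}"
  have "openin X U"
    unfolding U_def by (rule openin_continuous_map_preimage[OF g]) simp
  moreover have "x \<in> U" using x e C by (simp add: U_def)
  moreover have "f y \<in> Met_TC.mball (f x) e" if "y \<in> U" for y
  proof -
    have "dist (f x) (f y) \<le> C * dist (g x) (g y)" using fg x that by (simp add: U_def)
    also have "\<dots> < e" using that C by (simp add: U_def pos_less_divide_eq mult.commute)
    finally show ?thesis by simp
  qed
  ultimately show "\<exists>U. openin X U \<and> x \<in> U \<and> (\<forall>y\<in>U. f y \<in> Met_TC.mball (f x) e)" by blast
qed

section \<open>Continuity of the Cayley transforms, and the deformation to the unitary of the
  pair\<close>

context boundary_closed_range
begin

abbreviation "S \<equiv> shift_op \<i> ` A"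

lemma csub_S: "csubspace S" by (intro csubspace_image cblin_shift_op csub_A)

lemma closed_S: "closed S"
  by (intro closed_isometric_image closed_A csub_A norm_shift_op[OF A_G]) auto

text \<open>The two transforms agree on the range of A + i. On \<open>N \<i>\<close>,
  \<open>orth_projection_ext\<close> expresses \<open>\<gamma> (cayley B n)\<close> as
  \<open>\<gamma> n\<close> minus twice its projection to the boundary condition; the factors sqrt 2
  on the two deficiency spaces cancel.\<close>

lemma cayley_Lipschitz:
  assumes B: "adjoint_op B = B" "A \<subseteq> B" and B': "adjoint_op B' = B'" "A \<subseteq> B'"
  shows "dist (cayley B) (cayley B') \<le>
    2 * dist (orth_projection (\<gamma> ` Domain B)) (orth_projection (\<gamma> ` Domain B'))"
  unfolding dist_norm
proof (rule norm_blinfun_bound)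
  let ?p = "orth_projection (\<gamma> ` Domain B)" and ?p' = "orth_projection (\<gamma> ` Domain B')"
  fix z
  define r n where "r = orth_projection S z" and "n = z - r"
  have r: "r \<in> S" and n: "n \<in> N \<i>"
    by (simp_all add: r_def n_def N_eq orth_projection_in orth_projection_diff csub_S closed_S)
  have z: "z = r + n" by (simp add: n_def)
  have "n \<in> ortho_compl S" using n by (simp add: N_eq)
  then have "cinner n r = 0" using r unfolding ortho_compl_def by blast
  then have "cinner r n = 0" by (simp add: cinner_eq_0_commute[of r])
  then have "(norm z)\<^sup>2 = (norm r)\<^sup>2 + (norm n)\<^sup>2" unfolding z by (rule norm_plus_sq_orth)
  then have "(norm n)\<^sup>2 \<le> (norm z)\<^sup>2" by simp
  then have nz: "norm n \<le> norm z" by (rule power2_le_imp_le) simp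
  have \<gamma>\<kappa>: "\<gamma> (cayley D n) = \<gamma> n - 2 *\<^sub>C orth_projection (\<gamma> ` Domain D) (\<gamma> n)"
    if "adjoint_op D = D" "A \<subseteq> D" for D
    by (simp add: orth_projection_ext[OF that n] scaleC_scaleC)
  let ?k = "cayley B n" and ?k' = "cayley B' n"
  have kN: "?k \<in> N (- \<i>)" "(-1) *\<^sub>C ?k' \<in> N (- \<i>)"
    using cayley_N[OF B n] complex_vector.subspace_scale[OF csub_N cayley_N[OF B' n]] by blast+
  have "?k + (-1) *\<^sub>C ?k' \<in> N (- \<i>)" by (intro complex_vector.subspace_add csub_N kN) simp
  then have "sqrt 2 * norm (?k - ?k') = norm (\<gamma> (?k + (-1) *\<^sub>C ?k'))"
    using norm_\<gamma>_N[of "-\<i>"] by simp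
  also have "\<gamma> (?k + (-1) *\<^sub>C ?k') = \<gamma> ?k - \<gamma> ?k'"
    using \<gamma>_add[OF N_Domain[OF kN(1)] N_Domain[OF kN(2)]] \<gamma>_scale[OF N_Domain[OF cayley_N[OF B' n]],
        of "-1"]
    by simp
  also have "\<dots> = (-2) *\<^sub>C (?p - ?p') (\<gamma> n)"
    by (simp add: \<gamma>\<kappa>[OF B] \<gamma>\<kappa>[OF B'] blinfun.diff_left complex_vector.scale_right_diff_distrib)
  also have "norm \<dots> = 2 * norm ((?p - ?p') (\<gamma> n))" by (simp only: norm_scaleC) simp
  also have "\<dots> \<le> 2 * (norm (?p - ?p') * norm (\<gamma> n))"
    using norm_blinfun by (intro mult_left_mono) auto
  also have "\<dots> = sqrt 2 * (2 * norm (?p - ?p') * norm n)"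
    using norm_\<gamma>_N[OF _ n] by simp
  finally have "norm (?k - ?k') \<le> 2 * norm (?p - ?p') * norm n" by simp
  also have "\<dots> \<le> 2 * norm (?p - ?p') * norm z" using nz by (intro mult_left_mono) auto
  also have "?k - ?k' = (cayley B - cayley B') z"
    using r cayley_shift[OF B] cayley_shift[OF B']
    by (auto simp: z blinfun.diff_left blinfun.add_right)
  finally show "norm ((cayley B - cayley B') z) \<le> 2 * norm (?p - ?p') * norm z" .
qed simp

text \<open>Two homotopies meet in \<open>q B\<close>: multiplication by the Cayley path joins it to
  the Cayley transform, and rotating the phase on \<open>K\<close> from 1 to -1 joins it to
  \<open>q\<^sub>0 B\<close>.\<close>

lemma homotopic_cayley_q0:
  assumes B: "\<And>x. x \<in> topspace X \<Longrightarrow> adjoint_op (B x) = B x" "\<And>x. x \<in> topspace X \<Longrightarrow> A \<subseteq> B x"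
    and fred: "\<And>x. x \<in> topspace X \<Longrightarrow> fredholm_in UNIV (B x)"
    and cont: "continuous_map X euclidean (\<lambda>x. cayley (B x))"
  shows "homotopic_with (\<lambda>_. True) X (top_of_set (unitaries_F UNIV)) (\<lambda>x. cayley (B x)) (\<lambda>x. q\<^sub>0 (B
      x))"
proof -
  obtain Y where Y: "skew Y" "cayley_path Y 1 = w" "\<And>f. f \<in> ortho_compl R \<Longrightarrow> Y f \<in> R"
    by (rule w_cayley_path) blast
  \<comment> \<open>The Fredholm property is known at t = 1, where the product is the Cayley
    transform of a Fredholm operator; \<open>fredholm_cayley_path\<close> spreads it to every
    \<open>t\<close>.\<close>
  have F1: "cayley_path Y t o\<^sub>L q (B x) \<in> unitaries_F UNIV" if x: "x \<in> topspace X" for t x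
  proof -
    interpret B: self_adjoint_op "B x" by unfold_locales (rule B(1)[OF x])
    note Bx = B(1)[OF x] B(2)[OF x]
    have "fredholm_map (\<lambda>y. cayley (B x) y + y)"
      using B.cayley_unitaries_F[OF fred[OF x]] by (simp add: unitaries_F_UNIV)
    then have 1: "fredholm_map (\<lambda>y. cayley_path Y 1 (q (B x) y) + y)"
      by (simp add: Y(2) w_q[OF Bx])
    have "fredholm_map (\<lambda>y. cayley_path Y t (q (B x) y) + y)"
      by (rule fredholm_cayley_path[OF Y(1) _ q_unitary[OF Bx] _ csub_R 1])
        (use Y(3) q_R[OF Bx] in auto)
    then show ?thesis
      by (simp add: unitaries_F_UNIV unitaries_compose cayley_path_unitary Y q_unitary[OF Bx])
  qed
  have F2: "q (B x) o\<^sub>L phase K (cis (pi * t)) \<in> unitaries_F UNIV" if x: "x \<in> topspace X" for t x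
  proof -
    note Bx = B(1)[OF x] B(2)[OF x]
    \<comment> \<open>\<open>F1\<close> at t = 0, where the Cayley path is the identity.\<close>
    have 1: "fredholm_map (\<lambda>y. q (B x) y + y)"
      using F1[OF x, of 0]
        by (simp add: cayley_path_0[OF Y(1)] blinfun_compose_simps unitaries_F_UNIV)
    have "fredholm_map (\<lambda>y. q (B x) (phase K (cis (pi * t)) y) + y)"
      by (rule fredholm_phase[OF csub_K closed_K q_unitary[OF Bx] _ 1]) (rule q_K[OF Bx])
    then show ?thesis
      by (simp add: unitaries_F_UNIV unitaries_compose q_unitary[OF Bx] phase_unitary csub_K
          closed_K)
  qed
  have cq: "continuous_map X euclidean (\<lambda>x. q (B x))"
    unfolding q_def by (intro continuous_map_blinfun_compose cont) simp
  have "homotopic_with (\<lambda>_. True) X (top_of_set (unitaries_F UNIV))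
      (\<lambda>x. cayley_path Y 0 o\<^sub>L (q (B x) o\<^sub>L id_blinfun)) (\<lambda>x. cayley_path Y 1 o\<^sub>L (q (B x) o\<^sub>L
          id_blinfun))"
    using F1 by (intro homotopic_compose cq continuous_on_subset[OF continuous_on_cayley_path[OF
        Y(1)]])
      (auto simp: blinfun_compose_simps)
  moreover have "cayley_path Y 0 o\<^sub>L (q (B x) o\<^sub>L id_blinfun) = q (B x)" for x
    by (simp add: cayley_path_0[OF Y(1)] blinfun_compose_simps)
  moreover have "cayley_path Y 1 o\<^sub>L (q (B x) o\<^sub>L id_blinfun) = cayley (B x)" for x
    by (rule blinfun_eqI) (simp add: Y(2) q_def w_unitary)
  ultimately have 1:
      "homotopic_with (\<lambda>_. True) X (top_of_set (unitaries_F UNIV)) (\<lambda>x. cayley (B x)) (\<lambda>x. q (B x))"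
    by (simp add: homotopic_with_symD)
  have "homotopic_with (\<lambda>_. True) X (top_of_set (unitaries_F UNIV))
      (\<lambda>x. id_blinfun o\<^sub>L (q (B x) o\<^sub>L phase K (cis (pi * 0))))
      (\<lambda>x. id_blinfun o\<^sub>L (q (B x) o\<^sub>L phase K (cis (pi * 1))))"
    using F2 by (intro homotopic_compose cq continuous_intros) (auto simp: blinfun_compose_simps)
  then have 2:
      "homotopic_with (\<lambda>_. True) X (top_of_set (unitaries_F UNIV)) (\<lambda>x. q (B x)) (\<lambda>x. q\<^sub>0 (B x))"
    by (simp add: q\<^sub>0_def blinfun_compose_simps)
  show ?thesis by (rule homotopic_with_trans[OF 1 2])
qed

text \<open>Splitting off the summand \<^term>\<open>S\<close>, on which \<^term>\<open>q\<^sub>0 B\<close> is the identity, and absorbing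
  it into the auxiliary space.\<close>

lemma transport_pair_unitary:
  fixes \<Phi> \<sigma> :: "'a \<times> 'a \<Rightarrow> 'a"
  assumes \<Phi>: "unitary_iso UNIV \<Phi>" and \<sigma>: "unitary_iso (S \<times> UNIV) \<sigma>"
  obtains \<Psi> :: "'v \<times> 'a \<Rightarrow> 'a" where "unitary_iso (\<Lambda> \<times> UNIV) \<Psi>"
    "\<And>B. adjoint_op B = B \<Longrightarrow> A \<subseteq> B \<Longrightarrow>
      transport (\<Lambda> \<times> UNIV) \<Psi> (plus_one (pair_unitary \<V> J (\<gamma> ` Domain B) (cauchy_data A \<gamma>))) =
      transport UNIV \<Phi> (plus_one (q\<^sub>0 B))"
proof -
  have cs: "csubspace (S \<times> (UNIV :: 'a set))" by (simp add: csubspace_Times csub_S)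
  have csU: "csubspace (UNIV :: ('a \<times> 'a) set)" by simp
  have cs\<Lambda>: "csubspace (\<Lambda> \<times> (UNIV :: 'a set))" by (simp add: csubspace_Times csub_eig_plus)
  note D = unitary_isoD[OF \<Phi>] and I = unitary_iso_inv[OF csU \<Phi>]
  note D\<sigma> = unitary_isoD[OF \<sigma>] and I\<sigma> = unitary_iso_inv[OF cs \<sigma>]
  let ?i = "inv_into (S \<times> UNIV) \<sigma>"
  \<comment> \<open>The factor sqrt 2 makes \<open>\<psi>\<close> isometric, and
    \<open>\<sigma>\<close> lets the auxiliary space supply both the missing summand
    \<open>S\<close> of the first component and the second component.\<close>
  define m where "m z = (sqrt 2 *\<^sub>R \<psi> (fst z) + fst (?i (snd z)), snd (?i (snd z)))" for z
  have m_add: "m (x + y) = m x + m y" if "x \<in> \<Lambda> \<times> UNIV" "y \<in> \<Lambda> \<times> UNIV" for x y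
    using that by (auto simp: m_def \<psi>_add I\<sigma> scaleR_add_right)
  have m_scale: "m (c *\<^sub>C x) = c *\<^sub>C m x" if "x \<in> \<Lambda> \<times> UNIV" for c x
    using that
      by (auto simp: m_def \<psi>_scale I\<sigma> scaleR_scaleC_commute scaleC_add_right scaleC_prod_def)
  have m_norm: "norm (m x) = norm x" if x: "x \<in> \<Lambda> \<times> UNIV" for x
  proof -
    obtain v h where vh: "x = (v, h)" "v \<in> \<Lambda>" using x by auto
    obtain r b where rb: "?i h = (r, b)" by force
    have r: "r \<in> S" using I\<sigma>(1)[of h] rb by auto
    have "\<psi> v \<in> ortho_compl S" using \<psi>(1) vh by (simp add: N_eq)
    then have "cinner (\<psi> v) r = 0" using r unfolding ortho_compl_def by blast
    then have "cinner (sqrt 2 *\<^sub>R \<psi> v) r = 0" by (simp add: cinner_scaleR_left)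
    from norm_plus_sq_orth[OF this]
    have "(norm (m x))\<^sup>2 = (sqrt 2 * norm (\<psi> v))\<^sup>2 + ((norm r)\<^sup>2 + (norm b)\<^sup>2)"
      by (simp add: m_def vh rb norm_Pair)
    also have "(norm r)\<^sup>2 + (norm b)\<^sup>2 = (norm (r, b))\<^sup>2" by (simp add: norm_Pair)
    also have "norm (r, b) = norm h" using I\<sigma>(4)[of h] rb by simp
    also have "sqrt 2 * norm (\<psi> v) = norm v" using norm_\<psi>[OF vh(2)] by simp
    finally have "(norm (m x))\<^sup>2 = (norm x)\<^sup>2" by (simp add: vh norm_Pair)
    then show ?thesis by simp
  qed
  have m_surj: "y \<in> m ` (\<Lambda> \<times> UNIV)" for y
  proof -
    obtain a b where ab: "y = (a, b)" by force
    define r n where "r = orth_projection S a" and "n = a - r"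
    have r: "r \<in> S" and n: "n \<in> N \<i>"
      by (simp_all add: r_def n_def N_eq orth_projection_in orth_projection_diff csub_S closed_S)
    define n' where "n' = inverse (sqrt 2) *\<^sub>R n"
    have n': "n' \<in> N \<i>" unfolding n'_def by (intro csubspace_scaleR csub_N n) simp
    have "m (\<gamma> n', \<sigma> (r, b)) = (n + r, b)"
      using I\<sigma>(3)[of "(r, b)"] r by (simp add: m_def \<psi>(3)[OF n']) (simp add: n'_def)
    also have "\<dots> = y" by (simp add: ab n_def)
    finally show ?thesis using n'
      by (intro image_eqI[of _ _ "(\<gamma> n', \<sigma> (r, b))"]) (simp_all add: eig_plus_eq)
  qed
  define \<Psi> where "\<Psi> z = \<Phi> (m z)" for z
  have \<Psi>: "unitary_iso (\<Lambda> \<times> UNIV) \<Psi>"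
  proof -
    have "\<Psi> ` (\<Lambda> \<times> UNIV) = UNIV"
    proof (intro equalityI subsetI)
      fix y
      obtain z where "z \<in> \<Lambda> \<times> UNIV" "inv_into UNIV \<Phi> y = m z" using m_surj by blast
      then show "y \<in> \<Psi> ` (\<Lambda> \<times> UNIV)" using I(2)[of y] by (auto simp: \<Psi>_def)
    qed simp
    then show ?thesis
      unfolding unitary_iso_def by (simp add: \<Psi>_def m_add m_scale m_norm D del: mem_Sigma_iff)
  qed
  have "transport (\<Lambda> \<times> UNIV) \<Psi> (plus_one (pair_unitary \<V> J (\<gamma> ` Domain B) (cauchy_data A \<gamma>))) =
      transport UNIV \<Phi> (plus_one (q\<^sub>0 B))" if B: "adjoint_op B = B" "A \<subseteq> B" for B
  proof (rule blinfun_eqI)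
    let ?u = "pair_unitary \<V> J (\<gamma> ` Domain B) (cauchy_data A \<gamma>)"
    have u: "?u v = \<gamma> (q\<^sub>0 B (\<psi> v))" "?u v \<in> \<Lambda>" "\<psi> (?u v) = q\<^sub>0 B (\<psi> v)" if "v \<in> \<Lambda>" for v
      using pair_unitary_apply[OF B that] q0_N(1)[OF B \<psi>(1)[OF that]] \<psi>(3)
        by (simp_all add: eig_plus_eq)
    fix y
    define z where "z = inv_into (\<Lambda> \<times> UNIV) \<Psi> y"
    have z: "z \<in> \<Lambda> \<times> UNIV" "\<Psi> z = y"
      using unitary_iso_inv[OF cs\<Lambda> \<Psi>] by (simp_all only: z_def)
    obtain v h where vh: "z = (v, h)" "v \<in> \<Lambda>" using z(1) by auto
    obtain r b where rb: "?i h = (r, b)" by force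
    have r: "q\<^sub>0 B r = r" using I\<sigma>(1)[of h] rb q0_shift[OF B] by auto
    have "transport (\<Lambda> \<times> UNIV) \<Psi> (plus_one ?u) y = \<Psi> (plus_one ?u z)"
      unfolding z_def
      by (rule transport_apply(1)[OF cs\<Lambda> \<Psi> _ cblin_plus_one[OF cblin_pair_unitary[OF B]]]) (auto
          simp: u(2))
    also have "\<dots> = \<Phi> (plus_one (q\<^sub>0 B) (m z))"
      using u[OF vh(2)] r
      by (simp add: vh \<Psi>_def m_def rb blinfun.add_right blinfun.scaleR_right)
    also have "m z = inv_into UNIV \<Phi> y"
      using I(3)[of "m z"] z(2) by (simp add: \<Psi>_def)
    also have "\<Phi> (plus_one (q\<^sub>0 B) (inv_into UNIV \<Phi> y)) = transport UNIV \<Phi> (plus_one (q\<^sub>0 B)) y"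
      by (rule transport_apply(1)[symmetric, OF csU \<Phi> _ cblin_plus_one[OF unitary_cblin[OF
          q0_unitary[OF B]]]]) simp
    finally show "transport (\<Lambda> \<times> UNIV) \<Psi> (plus_one ?u) y = transport UNIV \<Phi> (plus_one (q\<^sub>0 B)) y" .
  qed
  with \<Psi> show ?thesis by (rule that)
qed

end

theorem theorem3:
  fixes A :: "'a::chilbert_space operator"
    and \<gamma> :: "'a \<Rightarrow> 'v::chilbert_space"
    and X :: "'x topology"
    and L :: "'x \<Rightarrow> 'v set"
  assumes "separable_space (euclidean :: 'a topology)"
    and "\<not> finite_dim (UNIV :: 'a set)"
    and "symmetric_op A"
    and "semi_fredholm A"
    and "boundary_map A \<gamma>"
    and "\<And>x. x \<in> topspace X \<Longrightarrow> fredholm_bc A \<gamma> (L x)"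
    and "continuous_subspaces X L"
  shows "op_index X (\<lambda>x. bc_op A \<gamma> (L x)) =
           pair_index X (bvals A \<gamma>) (bstruct A \<gamma>) L (\<lambda>_. cauchy_data A \<gamma>) \<and>
         op_index X (\<lambda>x. bc_op A \<gamma> (L x)) \<in> K1 X"
proof -
  interpret boundary_closed_range A \<gamma>
    by unfold_locales (use assms in \<open>simp_all add: semi_fredholm_def\<close>)
  let ?Y = "top_of_set (unitaries_F (UNIV :: 'a set))"
  define B where "B x = bc_op A \<gamma> (L x)" for x
  have lag: "lagrangian \<V> \<omega> (L x)" if "x \<in> topspace X" for x
    using assms(6)[OF that] by (simp add: fredholm_bc_def)
  have B: "adjoint_op (B x) = B x" "A \<subseteq> B x" "fredholm_in UNIV (B x)" "\<gamma> ` Domain (B x) = L x"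
    if "x \<in> topspace X" for x
    using bc_op_lagrangian[OF lag[OF that]] assms(6)[OF that]
      by (simp_all add: B_def fredholm_bc_def)
  obtain \<Phi> :: "'a \<times> 'a \<Rightarrow> 'a" where \<Phi>: "unitary_iso (UNIV \<times> UNIV) \<Phi>"
    using unitary_iso_Times_UNIV[OF assms(1,2), of UNIV] by auto
  obtain \<sigma> :: "'a \<times> 'a \<Rightarrow> 'a" where \<sigma>: "unitary_iso (S \<times> UNIV) \<sigma>"
    using unitary_iso_Times_UNIV[OF assms(1,2) csub_S closed_S] by auto
  \<comment> \<open>\<open>\<Psi>\<close> is adapted to \<open>\<Phi>\<close>, so that the
    transported families of pair unitaries and of \<open>q\<^sub>0\<close> agree pointwise and not
    just up to homotopy.\<close>
  obtain \<Psi> :: "'v \<times> 'a \<Rightarrow> 'a" where \<Psi>: "unitary_iso (\<Lambda> \<times> UNIV) \<Psi>"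
    "\<And>B. adjoint_op B = B \<Longrightarrow> A \<subseteq> B \<Longrightarrow>
      transport (\<Lambda> \<times> UNIV) \<Psi> (plus_one (pair_unitary \<V> J (\<gamma> ` Domain B) (cauchy_data A \<gamma>))) =
      transport (UNIV \<times> UNIV) \<Phi> (plus_one (q\<^sub>0 B))"
    using transport_pair_unitary[OF _ \<sigma>, of \<Phi>] \<Phi> by (auto simp: UNIV_Times_UNIV)
  have "continuous_map X euclidean (\<lambda>x. cayley (B x))"
  proof (rule continuous_map_Lipschitz[where C = 2])
    show "continuous_map X euclidean (\<lambda>x. orth_projection (L x))"
      using assms(7) by (simp add: continuous_subspaces_def)
    show "dist (cayley (B x)) (cayley (B y))
        \<le> 2 * dist (orth_projection (L x)) (orth_projection (L y))"
      if "x \<in> topspace X" "y \<in> topspace X" for x y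
      using cayley_Lipschitz[OF B(1,2)[OF that(1)] B(1,2)[OF that(2)]] B(4) that by simp
  qed simp
  with B have htpy: "homotopic_with (\<lambda>_. True) X ?Y (\<lambda>x. cayley (B x)) (\<lambda>x. q\<^sub>0 (B x))"
    by (intro homotopic_cayley_q0)
  let ?T = "\<lambda>u. transport (UNIV \<times> UNIV) \<Phi> (plus_one u)"
  have T: "homotopic_with (\<lambda>_. True) X ?Y (\<lambda>x. ?T (cayley (B x))) (\<lambda>x. ?T (q\<^sub>0 (B x)))"
    using homotopic_with_compose_continuous_map_left[OF htpy continuous_transport[OF \<Phi>]]
    by (simp add: o_def)
  note cT = homotopic_with_imp_continuous_maps[OF T]
  have op: "op_index X B = htpy_class X ?Y (\<lambda>x. ?T (cayley (B x)))"
    unfolding op_index_def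
  proof (rule K1_index_eq[OF _ \<Phi>])
    show "cblin (cayley (B x)) \<and> cayley (B x) ` UNIV \<subseteq> UNIV" if "x \<in> topspace X" for x
    proof -
      interpret self_adjoint_op "B x" by unfold_locales (rule B(1)[OF that])
      show ?thesis using cayley_unitary by (simp add: unitary_cblin)
    qed
  qed (use cT in simp_all)
  let ?p = "\<lambda>x. pair_unitary \<V> J (L x) (cauchy_data A \<gamma>)"
  have pT: "transport (\<Lambda> \<times> UNIV) \<Psi> (plus_one (?p x)) = ?T (q\<^sub>0 (B x))" if "x \<in> topspace X" for x
    using \<Psi>(2)[OF B(1,2)[OF that]] B(4)[OF that] by simp
  \<comment> \<open>Continuity and values in \<open>unitaries_F UNIV\<close> are inherited from the
    transported family of \<open>q\<^sub>0\<close>, with no separate estimate for the pair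
    unitaries.\<close>
  have cP: "continuous_map X ?Y (\<lambda>x. transport (\<Lambda> \<times> UNIV) \<Psi> (plus_one (?p x)))"
    using cT pT by (auto intro: continuous_map_eq)
  have "pair_index X \<V> J L (\<lambda>_. cauchy_data A \<gamma>) =
      htpy_class X ?Y (\<lambda>x. transport (\<Lambda> \<times> UNIV) \<Psi> (plus_one (?p x)))"
    unfolding pair_index_def
  proof (rule K1_index_eq[where f = ?p, OF csub_eig_plus \<Psi>(1) _ cP])
    fix x assume x: "x \<in> topspace X"
    note Bx = B(1,2)[OF x]
    have "?p x v \<in> \<Lambda>" if "v \<in> \<Lambda>" for v
      using pair_unitary_apply[OF Bx that] q0_N(1)[OF Bx \<psi>(1)[OF that]] B(4)[OF x]
      by (simp add: eig_plus_eq)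
    then show "cblin (?p x) \<and> ?p x ` \<Lambda> \<subseteq> \<Lambda>"
      using cblin_pair_unitary[OF Bx] B(4)[OF x] by auto
  qed
  also have "\<dots> = htpy_class X ?Y (\<lambda>x. ?T (q\<^sub>0 (B x)))"
    using htpy_class_cong[OF cP pT] .
  also have "\<dots> = op_index X B" unfolding op by (rule htpy_class_eq[OF T, symmetric])
  finally have "op_index X B = pair_index X \<V> J L (\<lambda>_. cauchy_data A \<gamma>)" ..
  moreover have "op_index X B \<in> K1 X"
    unfolding op K1_def htpy_classes_def using cT by blast
  ultimately show ?thesis by (simp add: B_def[abs_def])
qed

end
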